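(* Let $G$ be a $3$-connected graph that has no minor isomorphic to $K_{3,3}$. Then every longest circuit of $G$ has a chord; that is, for every circuit $C$ of $G$ of maximum length among all circuits of $G$, there is an edge of $G$ that joins two vertices of $C$ and is not an edge of $C$.
   Context: Graphs are finite and simple. A circuit of a graph $G$ is a connected $2$-regular subgraph of $G$ (i.e. a cycle); a longest circuit is one with the maximum number of edges among all circuits of $G$. A chord of a circuit $C$ of $G$ is an edge of $G$ that joins two vertices of $C$ and is not an edge of $C$. $K_{3,3}$ is the complete bipartite graph with both parts of size $3$. A minor of a graph $G$ is a graph that can be obtained from $G$ by a sequence of vertex deletions, edge deletions and edge contractions. A graph is $3$-connected if it has at least $4$ vertices and remains connected after deleting any set of at most $2$ vertices. *)

theory Defs
  imports "Graph_Theory.Kuratowski"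
begin

text \<open>
  A finite simple graph is a \<^locale>\<open>pair_graph\<close>: a finite vertex set together with an
  irreflexive symmetric set of arcs. An undirected edge \<open>{u, v}\<close> corresponds to the two arcs
  \<open>(u, v)\<close> and \<open>(v, u)\<close>.
\<close>

definition uedges :: "'a pair_pre_digraph \<Rightarrow> 'a set set" where
  "uedges G = (\<lambda>(u, v). {u, v}) ` parcs G"

definition three_connected :: "'a pair_pre_digraph \<Rightarrow> bool" where
  "three_connected G \<longleftrightarrow> 4 \<le> card (pverts G) \<and>
     (\<forall>S \<subseteq> pverts G. card S \<le> 2 \<longrightarrow>
        Digraph_Component.connected (with_proj G \<restriction> (pverts G - S)))"

text \<open>
  In a symmetric digraph the out-degree of a vertex is its degree in the undirected graph.
\<close>

definition is_circuit :: "'a pair_pre_digraph \<Rightarrow> 'a pair_pre_digraph \<Rightarrow> bool" where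
  "is_circuit C G \<longleftrightarrow> pair_graph C \<and> subgraph (with_proj C) (with_proj G) \<and>
     Digraph_Component.connected (with_proj C) \<and>
     (\<forall>v \<in> pverts C. out_degree (with_proj C) v = 2)"

definition longest_circuit :: "'a pair_pre_digraph \<Rightarrow> 'a pair_pre_digraph \<Rightarrow> bool" where
  "longest_circuit C G \<longleftrightarrow> is_circuit C G \<and>
     (\<forall>D. is_circuit D G \<longrightarrow> card (uedges D) \<le> card (uedges C))"

definition is_chord :: "'a set \<Rightarrow> 'a pair_pre_digraph \<Rightarrow> 'a pair_pre_digraph \<Rightarrow> bool" where
  "is_chord e C G \<longleftrightarrow> e \<in> uedges G \<and> e \<subseteq> pverts C \<and> e \<notin> uedges C"

definition delete_vertex :: "'a pair_pre_digraph \<Rightarrow> 'a \<Rightarrow> 'a pair_pre_digraph" where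
  "delete_vertex G v =
     \<lparr> pverts = pverts G - {v}, parcs = {(x, y) \<in> parcs G. x \<noteq> v \<and> y \<noteq> v} \<rparr>"

definition delete_edge :: "'a pair_pre_digraph \<Rightarrow> 'a \<Rightarrow> 'a \<Rightarrow> 'a pair_pre_digraph" where
  "delete_edge G u v = \<lparr> pverts = pverts G, parcs = parcs G - {(u, v), (v, u)} \<rparr>"

text \<open>
  Contracting the edge \<open>uv\<close> identifies \<open>v\<close> with \<open>u\<close>; the merged vertex keeps the name \<open>u\<close>.
  The loop that arises is dropped, and parallel edges coincide, so the result is again simple.
\<close>

definition contract_edge :: "'a pair_pre_digraph \<Rightarrow> 'a \<Rightarrow> 'a \<Rightarrow> 'a pair_pre_digraph" where
  "contract_edge G u v = (let f = id(v := u) in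
     \<lparr> pverts = pverts G - {v},
       parcs = {(f x, f y) | x y. (x, y) \<in> parcs G \<and> f x \<noteq> f y} \<rparr>)"

inductive minor_step :: "'a pair_pre_digraph \<Rightarrow> 'a pair_pre_digraph \<Rightarrow> bool" where
  delete_vertex: "v \<in> pverts G \<Longrightarrow> minor_step G (delete_vertex G v)"
| delete_edge: "(u, v) \<in> parcs G \<Longrightarrow> minor_step G (delete_edge G u v)"
| contract_edge: "(u, v) \<in> parcs G \<Longrightarrow> minor_step G (contract_edge G u v)"

definition graph_minor :: "'a pair_pre_digraph \<Rightarrow> 'a pair_pre_digraph \<Rightarrow> bool" where
  "graph_minor H G \<longleftrightarrow> minor_step\<^sup>*\<^sup>* G H"

text \<open>
  The library predicate \<open>K\<^bsub>3,3\<^esub>\<close> is invariant under isomorphism, so it expresses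
  ``isomorphic to \<open>K\<^bsub>3,3\<^esub>\<close>''.
\<close>

definition has_K33_minor :: "'a pair_pre_digraph \<Rightarrow> bool" where
  "has_K33_minor G \<longleftrightarrow> (\<exists>H. graph_minor H G \<and> K\<^bsub>3,3\<^esub> (with_proj H))"

end

theory Submission
  imports Defs
begin

text \<open>
  Suppose \<open>C\<close> is a longest circuit, of length \<open>n\<close>, without a chord, and call the components of
  \<open>G - V(C)\<close> bridges. By 3-connectivity every bridge has at least three feet on \<open>C\<close>, and, \<open>C\<close> having no
  chord, every vertex of \<open>C\<close> is a foot. An odd cycle of pairwise consecutively overlapping bridges
  gives a \<open>K\<^bsub>3,3\<^esub>\<close> minor: rerouting \<open>C\<close> through one of the bridges shortens the odd cycle by two, and
  three mutually overlapping bridges are treated by hand. So the bridges can be put on two sides of \<open>C\<close>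
  such that those on one side do not cross.

  Each side then looks like a planar drawing whose faces are bounded by \<open>j\<close> corners (a bridge and one of its
  feet) and \<open>c\<close> edges of \<open>C\<close>. Counting faces gives
  \<open>\<Sum> (6 - 2j - c) = 12 + 4D - 6s - 2n \<ge> 12 + 2(D - n)\<close> over both sides, where there are \<open>s\<close> bridges with
  \<open>D\<close> feet altogether. On the other hand \<open>C\<close> cannot be lengthened by replacing a few short segments with paths
  through bridges. A discharging argument based on five such exchanges bounds the same sum by \<open>2(D - n)\<close>.
\<close>

section \<open>Connected sets and rings of bags\<close>

text \<open>The charge \<open>6 - 2j - c\<close> is 6 minus a face length: when every bridge is
  contracted to one vertex, each corner puts two edges of its bridge on the boundary of the face.
  There are then n + s vertices and n + D edges, so the stated total is Euler's formula, and the
  inequality after it uses that every bridge has three feet. The bound 2(D - n) allows a vertex of C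
  with d feet to pay 2(d - 1). As every vertex of C is a foot, this is never negative, but a vertex
  with a single foot has nothing to give. Short faces are the obstacle. With one corner and l + 1
  edges the charge is 3 - l, with two corners it is 2 - c, and no vertex nearby need be able to pay.
  Such charge is therefore sent across C, and the exchanges show that the face on the other side can
  take it or that some vertex has a second foot. No drawing is ever constructed. Feet are sets of
  integers with period n, sides are the two colours of the overlap relation, and faces are gaps
  between consecutive feet.\<close>

locale sym_rel =
  fixes R :: "'a rel"
  assumes sym_R: "sym R"
begin

text \<open>True of the empty set, so that empty bags need no exception.\<close>

definition conn :: "'a set \<Rightarrow> bool" where
  "conn S \<longleftrightarrow> (\<forall>x\<in>S. \<forall>y\<in>S. (x, y) \<in> (R \<inter> S \<times> S)\<^sup>*)"

definition adj :: "'a set \<Rightarrow> 'a set \<Rightarrow> bool" where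
  "adj A B \<longleftrightarrow> (\<exists>a\<in>A. \<exists>b\<in>B. (a, b) \<in> R)"

lemma adj_sym: "adj A B \<Longrightarrow> adj B A"
  unfolding adj_def using sym_R by (meson symD)

lemma adj_mono: "adj A B \<Longrightarrow> A \<subseteq> A' \<Longrightarrow> B \<subseteq> B' \<Longrightarrow> adj A' B'"
  unfolding adj_def by blast

lemma conn_empty: "conn {}" unfolding conn_def by simp

lemma conn_sing: "conn {x}" unfolding conn_def by simp

lemma sym_restrict: "sym ((R \<inter> S \<times> S)\<^sup>*)"
  using sym_R by (intro sym_rtrancl) (auto simp: sym_def)

lemma conn_mono_path: "conn A \<Longrightarrow> A \<subseteq> S \<Longrightarrow> x \<in> A \<Longrightarrow> y \<in> A \<Longrightarrow> (x, y) \<in> (R \<inter> S \<times> S)\<^sup>*"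
  unfolding conn_def using rtrancl_mono[of "R \<inter> A \<times> A" "R \<inter> S \<times> S"] by blast

lemma connI_centre:
  assumes "\<And>x. x \<in> S \<Longrightarrow> (c, x) \<in> (R \<inter> S \<times> S)\<^sup>*"
  shows "conn S"
  unfolding conn_def
proof (intro ballI)
  fix x y assume "x \<in> S" "y \<in> S"
  then have "(x, c) \<in> (R \<inter> S \<times> S)\<^sup>*" "(c, y) \<in> (R \<inter> S \<times> S)\<^sup>*"
    using assms sym_restrict by (auto dest: symD)
  then show "(x, y) \<in> (R \<inter> S \<times> S)\<^sup>*" by (rule rtrancl_trans)
qed

text \<open>Serves for a bridge together with the arcs of the ring that it swallows, and for an arc
  together with the bridges attached to it.\<close>

lemma conn_star:
  assumes A: "conn A" "A \<noteq> {}" and F: "\<And>B. B \<in> F \<Longrightarrow> conn B \<and> adj A B"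
  shows "conn (A \<union> \<Union>F)"
proof -
  let ?S = "A \<union> \<Union>F"
  obtain c where c: "c \<in> A" using A by blast
  show ?thesis
  proof (rule connI_centre[of _ c])
    fix x assume "x \<in> ?S"
    then consider "x \<in> A" | B where "B \<in> F" "x \<in> B" by blast
    then show "(c, x) \<in> (R \<inter> ?S \<times> ?S)\<^sup>*"
    proof cases
      case 1 then show ?thesis using conn_mono_path[OF A(1) _ c] by blast
    next
      case 2
      obtain a b where ab: "a \<in> A" "b \<in> B" "(a, b) \<in> R" using F[OF 2(1)] unfolding adj_def by blast
      have "(c, a) \<in> (R \<inter> ?S \<times> ?S)\<^sup>*" using conn_mono_path[OF A(1) _ c ab(1)] by blast
      moreover have "(a, b) \<in> R \<inter> ?S \<times> ?S" using ab 2 by blast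
      moreover have "(b, x) \<in> (R \<inter> ?S \<times> ?S)\<^sup>*" using conn_mono_path[of B ?S b x] F[OF 2(1)] ab 2 by blast
      ultimately show ?thesis by (meson rtrancl.rtrancl_into_rtrancl rtrancl_trans)
    qed
  qed
qed

lemma conn_union: "conn A \<Longrightarrow> conn B \<Longrightarrow> adj A B \<Longrightarrow> conn (A \<union> B)"
proof -
  assume "conn A" "conn B" "adj A B"
  then have "conn (A \<union> \<Union>{B})" using conn_star[of A "{B}"] unfolding adj_def by blast
  then show ?thesis by simp
qed

lemma conn_adj:
  assumes "conn (A \<union> B)" "A \<inter> B = {}" "A \<noteq> {}" "B \<noteq> {}"
  shows "adj A B"
proof -
  obtain a b where ab: "a \<in> A" "b \<in> B" using assms by blast
  have "(a, b) \<in> (R \<inter> (A \<union> B) \<times> (A \<union> B))\<^sup>*" using assms(1) ab unfolding conn_def by blast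
  then have "b \<in> A \<or> adj A B" using ab(1)
  proof (induction rule: rtrancl_induct)
    case (step y z) then show ?case unfolding adj_def by blast
  qed simp
  then show ?thesis using ab assms by blast
qed

text \<open>The \<open>P i\<close> and the \<open>H j\<close> are branch sets of the two classes.
  Branch sets allow ring and bridges to be regrouped freely; \<open>K33_model_imp_minor\<close>
  turns them into minor operations.\<close>

definition K33_model :: bool where
  "K33_model \<longleftrightarrow> (\<exists>P H :: nat \<Rightarrow> 'a set.
     (\<forall>i<3. conn (P i) \<and> P i \<noteq> {} \<and> conn (H i) \<and> H i \<noteq> {}) \<and>
     (\<forall>i<3. \<forall>j<3. i \<noteq> j \<longrightarrow> P i \<inter> P j = {} \<and> H i \<inter> H j = {}) \<and>
     (\<forall>i<3. \<forall>j<3. P i \<inter> H j = {} \<and> adj (P i) (H j)))"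

text \<open>
  A ring is a circuit whose \<open>i\<close>-th vertex has been replaced by a connected bag; indices are taken modulo \<open>N\<close>. Bags
  may be empty, so that rerouting a ring need not renumber its positions.
\<close>

definition ring :: "int \<Rightarrow> (int \<Rightarrow> 'a set) \<Rightarrow> bool" where
  "ring N bag \<longleftrightarrow> 0 < N \<and> (\<forall>i. bag (i + N) = bag i) \<and> (\<forall>i. conn (bag i)) \<and>
     (\<forall>i j. i < j \<and> j < i + N \<longrightarrow> bag i \<inter> bag j = {}) \<and>
     (\<forall>i j. i < j \<and> j < i + N \<and> bag i \<noteq> {} \<and> bag j \<noteq> {} \<and> (\<forall>k. i < k \<and> k < j \<longrightarrow> bag k = {}) \<longrightarrow> adj (bag i) (bag j))"

definition arc :: "(int \<Rightarrow> 'a set) \<Rightarrow> int \<Rightarrow> int \<Rightarrow> 'a set" where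
  "arc bag a b = (\<Union>k\<in>{a..b}. bag k)"

text \<open>
  The second component is a set of positions at which the bridge is known to attach; it need not contain all of them.
\<close>

definition bridge :: "int \<Rightarrow> (int \<Rightarrow> 'a set) \<Rightarrow> 'a set \<times> int set \<Rightarrow> bool" where
  "bridge N bag S \<longleftrightarrow> conn (fst S) \<and> (\<forall>i. fst S \<inter> bag i = {}) \<and> (\<forall>i\<in>snd S. adj (fst S) (bag i)) \<and>
     (\<forall>i. i + N \<in> snd S \<longleftrightarrow> i \<in> snd S)"

lemma ringD:
  assumes "ring N bag"
  shows "0 < N" "bag (i + N) = bag i" "conn (bag i)" "i < j \<Longrightarrow> j < i + N \<Longrightarrow> bag i \<inter> bag j = {}"
    "i < j \<Longrightarrow> j < i + N \<Longrightarrow> bag i \<noteq> {} \<Longrightarrow> bag j \<noteq> {} \<Longrightarrow> \<forall>k. i < k \<and> k < j \<longrightarrow> bag k = {} \<Longrightarrow> adj (bag i) (bag j)"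
proof -
  show "0 < N" "bag (i + N) = bag i" "conn (bag i)" using assms unfolding ring_def by simp_all
  show "i < j \<Longrightarrow> j < i + N \<Longrightarrow> bag i \<inter> bag j = {}" using assms unfolding ring_def by simp
  have *: "\<forall>i j. i < j \<and> j < i + N \<and> bag i \<noteq> {} \<and> bag j \<noteq> {} \<and> (\<forall>k. i < k \<and> k < j \<longrightarrow> bag k = {}) \<longrightarrow> adj (bag i) (bag j)"
    using assms unfolding ring_def by (elim conjE)
  show "i < j \<Longrightarrow> j < i + N \<Longrightarrow> bag i \<noteq> {} \<Longrightarrow> bag j \<noteq> {} \<Longrightarrow> \<forall>k. i < k \<and> k < j \<longrightarrow> bag k = {} \<Longrightarrow> adj (bag i) (bag j)"
    using *[THEN spec[of _ i], THEN spec[of _ j]] by simp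
qed

lemma bridgeD:
  assumes "bridge N bag S"
  shows "conn (fst S)" "fst S \<inter> bag i = {}" "i \<in> snd S \<Longrightarrow> adj (fst S) (bag i)" "i + N \<in> snd S \<longleftrightarrow> i \<in> snd S"
  using assms unfolding bridge_def by blast+

lemma bridge_sub: "bridge N bag S \<Longrightarrow> i - N \<in> snd S \<longleftrightarrow> i \<in> snd S"
  using bridgeD(4)[of N bag S "i - N"] by simp

text \<open>The arc grows by one bag at a time. A nonempty new bag is attached to the last nonempty
  bag before it, since its direct predecessor may be empty.\<close>

lemma arc_conn:
  assumes r: "ring N bag" and ab: "b < a + N"
  shows "conn (arc bag a b)"
proof (cases "a \<le> b")
  case False then show ?thesis unfolding arc_def using conn_empty by simp
next
  case True
  then show ?thesis using ab
  proof (induction b rule: int_ge_induct)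
    case base then show ?case unfolding arc_def using ringD(3)[OF r] by simp
  next
    case (step b)
    have e: "arc bag a (b + 1) = arc bag a b \<union> bag (b + 1)"
    proof -
      have "{a..b + 1} = insert (b + 1) {a..b}" using step by auto
      then show ?thesis unfolding arc_def by auto
    qed
    have IH: "conn (arc bag a b)" using step by simp
    show ?case
    proof (cases "arc bag a b = {} \<or> bag (b + 1) = {}")
      case True then show ?thesis using e IH ringD(3)[OF r] by auto
    next
      case False
      let ?L = "{k \<in> {a..b}. bag k \<noteq> {}}"
      have fL: "finite ?L" by (rule finite_subset[of _ "{a..b}"]) auto
      have "?L \<noteq> {}" using False unfolding arc_def by auto
      then have L: "Max ?L \<in> ?L" using Max_in[OF fL] by blast
      define l where "l = Max ?L"
      have l: "a \<le> l" "l \<le> b" "bag l \<noteq> {}" using L l_def by auto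
      have "bag k = {}" if "l < k" "k < b + 1" for k
      proof (rule ccontr)
        assume "bag k \<noteq> {}"
        then have "k \<in> ?L" using that l by auto
        then show False using Max_ge[OF fL, of k] that l_def by simp
      qed
      then have "adj (bag l) (bag (b + 1))" using ringD(5)[OF r, of l "b + 1"] l step(3) False by auto
      then have "adj (arc bag a b) (bag (b + 1))" by (rule adj_mono) (use l in \<open>auto simp: arc_def\<close>)
      then show ?thesis using conn_union[OF IH ringD(3)[OF r]] e by simp
    qed
  qed
qed

lemma arc_disj:
  assumes r: "ring N bag" and "b < c" "d < a + N"
  shows "arc bag a b \<inter> arc bag c d = {}"
proof (rule ccontr)
  assume "\<not> ?thesis"
  then obtain i j x where "a \<le> i" "i \<le> b" "c \<le> j" "j \<le> d" "x \<in> bag i" "x \<in> bag j" unfolding arc_def by auto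
  then show False using ringD(4)[OF r, of i j] assms by auto
qed

lemma arc_shift: "ring N bag \<Longrightarrow> arc bag (a + N) (b + N) = arc bag a b"
proof -
  assume r: "ring N bag"
  have "{a + N..b + N} = (\<lambda>k. k + N) ` {a..b}" by simp
  then have "arc bag (a + N) (b + N) = \<Union> ((\<lambda>k. bag (k + N)) ` {a..b})" unfolding arc_def by (simp only: image_image)
  then show ?thesis unfolding arc_def ringD(2)[OF r] .
qed

text \<open>The two arcs together form one arc shorter than a period. It is connected, so its two
  nonempty parts are adjacent.\<close>

lemma arc_adj:
  assumes r: "ring N bag" and "arc bag a b \<noteq> {}" "arc bag (b + 1) c \<noteq> {}" "c < a + N"
  shows "adj (arc bag a b) (arc bag (b + 1) c)"
proof -
  have ab: "a \<le> b" "b + 1 \<le> c" using assms unfolding arc_def by auto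
  have "{a..c} = {a..b} \<union> {b + 1..c}" using ab by auto
  then have "arc bag a c = arc bag a b \<union> arc bag (b + 1) c" unfolding arc_def by auto
  then have "conn (arc bag a b \<union> arc bag (b + 1) c)" using arc_conn[OF r assms(4)] by simp
  then show ?thesis using conn_adj arc_disj[OF r, of b "b + 1" c a] assms by auto
qed

text \<open>Three disjoint intervals of the ring serve as one side of the \<open>K\<^bsub>3,3\<^esub>\<close>; the bridge \<open>Y (f j)\<close> absorbs
  the open arc following the \<open>j\<close>-th interval, unless \<open>f j \<ge> 3\<close>.\<close>

lemma K33_of_intervals:
  fixes Y :: "nat \<Rightarrow> 'a set \<times> int set" and a b a' :: "nat \<Rightarrow> int" and f :: "nat \<Rightarrow> nat"
  assumes r: "ring N bag" and br: "\<And>k. k < 3 \<Longrightarrow> bridge N bag (Y k)"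
    and dY: "\<And>k l. k < 3 \<Longrightarrow> l < 3 \<Longrightarrow> k \<noteq> l \<Longrightarrow> fst (Y k) \<inter> fst (Y l) = {}"
    and o: "a 0 \<le> b 0" "b 0 < a 1" "a 1 \<le> b 1" "b 1 < a 2" "a 2 \<le> b 2" "b 2 < a 0 + N"
    and a': "a' 0 = a 1" "a' 1 = a 2" "a' 2 = a 0 + N"
    and f: "\<And>i. i < 3 \<Longrightarrow> f i < 3 \<Longrightarrow> \<exists>m\<in>snd (Y (f i)). b i < m \<and> m < a' i"
    and meets: "\<And>j k. j < 3 \<Longrightarrow> k < 3 \<Longrightarrow> (\<exists>m\<in>snd (Y k). a j \<le> m \<and> m \<le> b j) \<or> f j = k \<or> f ((j + 2) mod 3) = k"
  shows K33_model
proof -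
  define P where "P j = arc bag (a j) (b j)" for j
  define M where "M j = arc bag (b j + 1) (a' j - 1)" for j
  define F where "F k = M ` {i. i < 3 \<and> f i = k}" for k
  define H where "H k = fst (Y k) \<union> \<Union>(F k)" for k
  have lt3: "i < 3 \<Longrightarrow> i = 0 \<or> i = 1 \<or> i = (2::nat)" for i by auto
  have PM: "P i \<inter> P j = {}" "M i \<inter> M j = {}" if "i < 3" "j < 3" "i \<noteq> j" for i j
  proof -
    have *: "P 0 \<inter> P 1 = {}" "P 0 \<inter> P 2 = {}" "P 1 \<inter> P 2 = {}" "M 0 \<inter> M 1 = {}" "M 0 \<inter> M 2 = {}" "M 1 \<inter> M 2 = {}"
      unfolding P_def M_def a' by (rule arc_disj[OF r]; use o in linarith)+
    show "P i \<inter> P j = {}" "M i \<inter> M j = {}" using * lt3[OF that(1)] lt3[OF that(2)] that(3) by (auto simp: Int_commute)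
  qed
  have PMd: "P i \<inter> M j = {}" if "i < 3" "j < 3" for i j
  proof -
    have 1: "P 0 \<inter> M 0 = {}" "P 0 \<inter> M 1 = {}" "P 0 \<inter> M 2 = {}" "P 1 \<inter> M 1 = {}" "P 1 \<inter> M 2 = {}" "P 2 \<inter> M 2 = {}"
      unfolding P_def M_def a' by (rule arc_disj[OF r]; use o in linarith)+
    have "M 0 \<inter> P 1 = {}" "M 0 \<inter> P 2 = {}" "M 1 \<inter> P 2 = {}"
      unfolding P_def M_def a' by (rule arc_disj[OF r]; use o in linarith)+
    then show ?thesis using 1 lt3[OF that(1)] lt3[OF that(2)] by (auto simp: Int_commute)
  qed
  have Yarc: "fst (Y k) \<inter> arc bag x y = {}" if "k < 3" for k x y
    unfolding arc_def using bridgeD(2)[OF br[OF that]] by blast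
  have meet_arc: "adj (fst (Y k)) (arc bag x y)" if "k < 3" "m \<in> snd (Y k)" "x \<le> m" "m \<le> y" for k m x y
    by (rule adj_mono[OF bridgeD(3)[OF br[OF that(1)] that(2)]]) (use that in \<open>auto simp: arc_def\<close>)
  have Mf: "adj (fst (Y (f i))) (M i)" if i: "i < 3" "f i < 3" for i
  proof -
    obtain m where "m \<in> snd (Y (f i))" "b i < m" "m < a' i" using f[OF i] by blast
    then show ?thesis unfolding M_def using meet_arc[OF i(2)] by simp
  qed
  have Mne: "M i \<noteq> {}" if "i < 3" "f i < 3" for i using Mf[OF that] unfolding adj_def by blast
  have FD: "\<exists>i<3. f i = k \<and> B = M i" if "B \<in> F k" for B k using that unfolding F_def by auto
  have meetsP: "(\<exists>m\<in>snd (Y k). a j \<le> m \<and> m \<le> b j) \<longrightarrow> adj (fst (Y k)) (P j)" if "k < 3" for j k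
    unfolding P_def using meet_arc[OF that] by blast
  have Pne: "P j \<noteq> {}" if j: "j < 3" for j
  proof (cases "\<exists>k<3. \<exists>m\<in>snd (Y k). a j \<le> m \<and> m \<le> b j")
    case True
    then show ?thesis using meetsP unfolding adj_def by blast
  next
    case False
    \<comment> \<open>If no bridge has a foot in the interval, each of the three must be one of only
      two absorbers, those of the neighbouring open arcs.\<close>
    then have n: "k = f j \<or> k = f ((j + 2) mod 3)" if "k < 3" for k using meets[OF j that] that by auto
    show ?thesis using n[of 0] n[of 1] n[of 2] by auto
  qed
  have PMadj: "f j < 3 \<longrightarrow> adj (P j) (M j)" "f ((j + 2) mod 3) < 3 \<longrightarrow> adj (P j) (M ((j + 2) mod 3))" if j: "j < 3" for j
  proof -
    show "f j < 3 \<longrightarrow> adj (P j) (M j)"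
    proof
      assume "f j < 3"
      then have m: "M j \<noteq> {}" using Mne j by blast
      have "a' j - 1 < a j + N" using lt3[OF j] o a' by auto
      then show "adj (P j) (M j)" unfolding P_def M_def
        by (intro arc_adj[OF r]) (use Pne[OF j] m in \<open>auto simp: P_def M_def\<close>)
    qed
    show "f ((j + 2) mod 3) < 3 \<longrightarrow> adj (P j) (M ((j + 2) mod 3))"
    proof
      let ?i = "(j + 2) mod 3"
      assume "f ?i < 3"
      then have m: "M ?i \<noteq> {}" using Mne[of ?i] by simp
      have "adj (M ?i) (P j)"
      \<comment> \<open>The open arc before interval 0 is the one after interval 2, so the
        comparison takes place one period later.\<close>
      proof (cases "j = 0")
        case True
        have e: "M ?i = arc bag (b 2 + 1) (a 0 + N - 1)" "P j = arc bag (a 0 + N - 1 + 1) (b 0 + N)"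
          unfolding M_def P_def using True a' arc_shift[OF r, of "a 0" "b 0"] by (simp_all add: numeral_2_eq_2)
        have "b 0 + N < b 2 + 1 + N" using o by linarith
        then show ?thesis using arc_adj[OF r, of "b 2 + 1" "a 0 + N - 1" "b 0 + N"] m Pne[OF j] unfolding e by blast
      next
        case False
        then have i: "?i = j - 1" "a' (j - 1) = a j" using lt3[OF j] a' by auto
        have e: "M ?i = arc bag (b (j - 1) + 1) (a j - 1)" "P j = arc bag (a j - 1 + 1) (b j)"
          unfolding M_def P_def i by simp_all
        have "b j < b (j - 1) + 1 + N" using lt3[OF j] False o by auto
        then show ?thesis using arc_adj[OF r, of "b (j - 1) + 1" "a j - 1" "b j"] m Pne[OF j] unfolding e by blast
      qed
      then show "adj (P j) (M ?i)" by (rule adj_sym)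
    qed
  qed
  have Yne: "fst (Y k) \<noteq> {}" if k: "k < 3" for k
  proof -
    consider m where "m \<in> snd (Y k)" | "f 0 = k" | "f 2 = k" using meets[of 0 k] k by (auto simp: numeral_2_eq_2)
    then show ?thesis
    proof cases
      case 1 then show ?thesis using bridgeD(3)[OF br[OF k]] unfolding adj_def by blast
    next
      case 2 then show ?thesis using Mf[of 0] k unfolding adj_def by auto
    next
      case 3 then show ?thesis using Mf[of 2] k unfolding adj_def by auto
    qed
  qed
  have cM: "conn (M j)" if "j < 3" for j unfolding M_def by (rule arc_conn[OF r]) (use lt3[OF that] a' o in auto)
  have cH: "conn (H i)" if i: "i < 3" for i unfolding H_def
  proof (rule conn_star[OF bridgeD(1)[OF br[OF i]] Yne[OF i]])
    fix B assume "B \<in> F i"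
    then obtain p where "p < 3" "f p = i" "B = M p" using FD by blast
    then show "conn B \<and> adj (fst (Y i)) B" using cM Mf[of p] i by auto
  qed
  show ?thesis unfolding K33_model_def
  proof (rule exI[of _ P], rule exI[of _ H], intro conjI allI impI)
    fix i :: nat assume i: "i < 3"
    show "conn (P i)" unfolding P_def by (rule arc_conn[OF r]) (use lt3[OF i] o in auto)
    show "P i \<noteq> {}" by (rule Pne[OF i])
    show "conn (H i)" by (rule cH[OF i])
    show "H i \<noteq> {}" unfolding H_def using Yne[OF i] by blast
  next
    fix i j :: nat assume ij: "i < 3" "j < 3" "i \<noteq> j"
    show "P i \<inter> P j = {}" using PM ij by blast
    have YM: "fst (Y k) \<inter> M l = {}" if "k < 3" for k l unfolding M_def using Yarc[OF that] .
    have a1: "B \<inter> B' = {}" if BB: "B \<in> F i" "B' \<in> F j" for B B'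
    proof -
      obtain p q where "p < 3" "f p = i" "B = M p" "q < 3" "f q = j" "B' = M q" using FD BB by blast
      then show ?thesis using PM(2)[of p q] ij by auto
    qed
    have a2: "fst (Y i) \<inter> B = {}" if "B \<in> F j" for B using FD[OF that] YM[OF ij(1)] by auto
    have a3: "fst (Y j) \<inter> B = {}" if "B \<in> F i" for B using FD[OF that] YM[OF ij(2)] by auto
    have "\<Union>(F i) \<inter> \<Union>(F j) = {}" using a1 by blast
    moreover have "fst (Y i) \<inter> \<Union>(F j) = {}" using a2 by blast
    moreover have "fst (Y j) \<inter> \<Union>(F i) = {}" using a3 by blast
    ultimately show "H i \<inter> H j = {}" unfolding H_def using dY[OF ij] by auto
  next
    fix i j :: nat assume ij: "i < 3" "j < 3"
    have "P i \<inter> B = {}" if "B \<in> F j" for B using FD[OF that] PMd[OF ij(1)] by auto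
    moreover have "P i \<inter> fst (Y j) = {}" unfolding P_def using Yarc[OF ij(2)] by blast
    ultimately show "P i \<inter> H j = {}" unfolding H_def by blast
    have sub: "f p = j \<Longrightarrow> p < 3 \<Longrightarrow> M p \<subseteq> H j" for p unfolding H_def F_def by blast
    consider "\<exists>m\<in>snd (Y j). a i \<le> m \<and> m \<le> b i" | "f i = j" | "f ((i + 2) mod 3) = j" using meets ij by blast
    then show "adj (P i) (H j)"
    proof cases
      case 1
      then have "adj (P i) (fst (Y j))" using meetsP[OF ij(2)] adj_sym by blast
      then show ?thesis by (rule adj_mono) (auto simp: H_def)
    next
      case 2
      then have "adj (P i) (M i)" using PMadj(1)[OF ij(1)] ij(2) by simp
      then show ?thesis by (rule adj_mono) (use sub[OF 2 ij(1)] in auto)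
    next
      case 3
      then have "adj (P i) (M ((i + 2) mod 3))" using PMadj(2)[OF ij(1)] ij(2) by simp
      then show ?thesis by (rule adj_mono) (use sub[OF 3] in auto)
    qed
  qed
qed

end

section \<open>Overlapping bridges\<close>

definition periodic :: "int \<Rightarrow> int set \<Rightarrow> bool" where
  "periodic N X \<longleftrightarrow> 0 < N \<and> (\<forall>i. i + N \<in> X \<longleftrightarrow> i \<in> X)"

text \<open>Quantified over every start \<open>p\<close>, so that three ordered feet are at hand in
  whichever window a case distinction uses. For periodic sets one window suffices, by
  \<open>bigI\<close>.\<close>

definition big :: "int \<Rightarrow> int set \<Rightarrow> bool" where
  "big N X \<longleftrightarrow> (\<forall>p. \<exists>x\<in>X. \<exists>y\<in>X. \<exists>z\<in>X. p \<le> x \<and> x < y \<and> y < z \<and> z < p + N)"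

text \<open>
  Two cuts \<open>p\<close> and \<open>q\<close> of the circle have \<open>Y\<close> on one side and \<open>X\<close> on the other, both possibly containing
  \<open>p\<close> and \<open>q\<close>. A set with three or more elements therefore overlaps itself.
\<close>

definition non_overlapping :: "int \<Rightarrow> int set \<Rightarrow> int set \<Rightarrow> bool" where
  "non_overlapping N X Y \<longleftrightarrow> (\<exists>p q. p \<le> q \<and> q \<le> p + N \<and> (\<forall>i. p < i \<and> i < q \<longrightarrow> i \<notin> X) \<and> (\<forall>i. q < i \<and> i < p + N \<longrightarrow> i \<notin> Y))"

definition gap :: "int set \<Rightarrow> int \<Rightarrow> int \<Rightarrow> bool" where
  "gap X x y \<longleftrightarrow> x < y \<and> x \<in> X \<and> y \<in> X \<and> (\<forall>i. x < i \<and> i < y \<longrightarrow> i \<notin> X)"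

lemma periodicD: "periodic N X \<Longrightarrow> i + N \<in> X \<longleftrightarrow> i \<in> X" "periodic N X \<Longrightarrow> i - N \<in> X \<longleftrightarrow> i \<in> X" "periodic N X \<Longrightarrow> 0 < N"
proof -
  assume p: "periodic N X"
  show "i + N \<in> X \<longleftrightarrow> i \<in> X" for i using p unfolding periodic_def by blast
  from this[of "i - N"] show "i - N \<in> X \<longleftrightarrow> i \<in> X" by simp
  show "0 < N" using p unfolding periodic_def by blast
qed

lemma bigD:
  assumes "big N X"
  obtains x y z where "x \<in> X" "y \<in> X" "z \<in> X" "p \<le> x" "x < y" "y < z" "z < p + N"
  using assms unfolding big_def by blast

lemma non_overlapping_sym: assumes "periodic N X" "non_overlapping N X Y" shows "non_overlapping N Y X"
proof -
  obtain p q where pq: "p \<le> q" "q \<le> p + N" "\<forall>i. p < i \<and> i < q \<longrightarrow> i \<notin> X" "\<forall>i. q < i \<and> i < p + N \<longrightarrow> i \<notin> Y"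
    using assms(2) unfolding non_overlapping_def by blast
  have "i \<notin> X" if "p + N < i" "i < q + N" for i using pq(3)[rule_format, of "i - N"] periodicD(2)[OF assms(1)] that by auto
  then show ?thesis unfolding non_overlapping_def using pq by (intro exI[of _ q] exI[of _ "p + N"]) auto
qed

lemma overlapD:
  assumes "\<not> non_overlapping N X Y" "p \<le> q" "q \<le> p + N" "\<forall>i. p < i \<and> i < q \<longrightarrow> i \<notin> X"
  obtains i where "q < i" "i < p + N" "i \<in> Y"
  using assms unfolding non_overlapping_def by blast

lemma gap_ex:
  assumes p: "periodic N X" and b: "big N X" and t: "t \<notin> X"
  obtains x y where "gap X x y" "x < t" "t < y"
proof -
  let ?L = "{i \<in> {t - N..<t}. i \<in> X}" and ?U = "{i \<in> {t<..t + N}. i \<in> X}"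
  have fL: "finite ?L" by (rule finite_subset[of _ "{t - N..<t}"]) auto
  have fU: "finite ?U" by (rule finite_subset[of _ "{t<..t + N}"]) auto
  obtain a where a: "a \<in> X" "t - N \<le> a" "a < t" using bigD[OF b, of "t - N"] by (metis diff_add_cancel dual_order.strict_trans)
  have "?L \<noteq> {}" using a by auto
  then have L: "Max ?L \<in> ?L" using Max_in[OF fL] by blast
  have aN: "a + N \<in> X" using a(1) periodicD(1)[OF p] by blast
  then have "a + N \<noteq> t" using t by blast
  then have "a + N \<in> ?U" using aN a by simp
  then have "?U \<noteq> {}" by blast
  then have U: "Min ?U \<in> ?U" using Min_in[OF fU] by blast
  define l u where "l = Max ?L" and "u = Min ?U"
  have l: "l \<in> X" "t - N \<le> l" "l < t" and u: "u \<in> X" "t < u" "u \<le> t + N" using L U l_def u_def by simp_all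
  have "i \<notin> X" if i': "l < i" "i < u" for i
  proof
    assume i: "i \<in> X"
    then have "i \<noteq> t" using t by blast
    then consider "i < t" | "t < i" by linarith
    then show False
    proof cases
      case 1
      then have "i \<in> ?L" using i i' l by simp
      then show False using Max_ge[OF fL, of i] i' l_def by simp
    next
      case 2
      then have "i \<in> ?U" using i i' u by simp
      then show False using Min_le[OF fU, of i] i' u_def by simp
    qed
  qed
  then have "gap X l u" using l u unfolding gap_def by simp
  then show ?thesis using that l u by blast
qed

lemma gap_lt: assumes "big N X" "gap X x y" obtains s where "s \<in> X" "y < s" "s < x + N"
proof -
  obtain a b c where s: "a \<in> X" "b \<in> X" "c \<in> X" "x \<le> a" "a < b" "b < c" "c < x + N" using bigD[OF assms(1), of x] .
  have "y \<le> b" using s assms(2) unfolding gap_def by (meson linorder_not_le order_le_less_trans)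
  then show ?thesis using that[OF s(3)] s by simp
qed

section \<open>Three pairwise overlapping bridges\<close>

context sym_rel begin

definition triple where
  "triple N bag S U V \<longleftrightarrow> ring N bag \<and> bridge N bag S \<and> bridge N bag U \<and> bridge N bag V \<and>
     fst S \<inter> fst U = {} \<and> fst S \<inter> fst V = {} \<and> fst U \<inter> fst V = {}"

lemma triple_perm: "triple N bag S U V \<Longrightarrow> triple N bag U S V" "triple N bag S U V \<Longrightarrow> triple N bag S V U"
  "triple N bag S U V \<Longrightarrow> triple N bag V U S" "triple N bag S U V \<Longrightarrow> triple N bag U V S" "triple N bag S U V \<Longrightarrow> triple N bag V S U"
  unfolding triple_def by (auto simp: Int_commute)

lemma triple_periodic: "triple N bag S U V \<Longrightarrow> periodic N (snd S)" "triple N bag S U V \<Longrightarrow> periodic N (snd U)"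
  "triple N bag S U V \<Longrightarrow> periodic N (snd V)"
  unfolding triple_def periodic_def using bridgeD(4) ringD(1) by blast+

abbreviation hits :: "int set \<Rightarrow> int \<Rightarrow> int \<Rightarrow> bool" where
  "hits X a b \<equiv> \<exists>m\<in>X. a \<le> m \<and> m \<le> b"

lemma K33_triple:
  assumes t: "triple N bag S U V"
    and o: "a0 \<le> b0" "b0 < a1" "a1 \<le> b1" "b1 < a2" "a2 \<le> b2" "b2 < a0 + N"
    and f: "f0 = (0::nat) \<longrightarrow> hits (snd S) (b0 + 1) (a1 - 1)" "f0 = 1 \<longrightarrow> hits (snd U) (b0 + 1) (a1 - 1)" "f0 = 2 \<longrightarrow> hits (snd V) (b0 + 1) (a1 - 1)"
      "f1 = (0::nat) \<longrightarrow> hits (snd S) (b1 + 1) (a2 - 1)" "f1 = 1 \<longrightarrow> hits (snd U) (b1 + 1) (a2 - 1)" "f1 = 2 \<longrightarrow> hits (snd V) (b1 + 1) (a2 - 1)"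
      "f2 = (0::nat) \<longrightarrow> hits (snd S) (b2 + 1) (a0 + N - 1)" "f2 = 1 \<longrightarrow> hits (snd U) (b2 + 1) (a0 + N - 1)" "f2 = 2 \<longrightarrow> hits (snd V) (b2 + 1) (a0 + N - 1)"
    and S: "hits (snd S) a0 b0 \<or> f0 = 0 \<or> f2 = 0" "hits (snd S) a1 b1 \<or> f0 = 0 \<or> f1 = 0" "hits (snd S) a2 b2 \<or> f1 = 0 \<or> f2 = 0"
    and U: "hits (snd U) a0 b0 \<or> f0 = 1 \<or> f2 = 1" "hits (snd U) a1 b1 \<or> f0 = 1 \<or> f1 = 1" "hits (snd U) a2 b2 \<or> f1 = 1 \<or> f2 = 1"
    and V: "hits (snd V) a0 b0 \<or> f0 = 2 \<or> f2 = 2" "hits (snd V) a1 b1 \<or> f0 = 2 \<or> f1 = 2" "hits (snd V) a2 b2 \<or> f1 = 2 \<or> f2 = 2"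
  shows K33_model
proof -
  define Y where "Y k = (if k = 0 then S else if k = 1 then U else V)" for k :: nat
  define a where "a k = (if k = 0 then a0 else if k = 1 then a1 else a2)" for k :: nat
  define b where "b k = (if k = 0 then b0 else if k = 1 then b1 else b2)" for k :: nat
  define a' where "a' k = (if k = 0 then a1 else if k = 1 then a2 else a0 + N)" for k :: nat
  define f where "f k = (if k = 0 then f0 else if k = 1 then f1 else f2)" for k :: nat
  note defs = Y_def a_def b_def a'_def f_def
  have lt3: "i < 3 \<Longrightarrow> i = 0 \<or> i = 1 \<or> i = (2::nat)" for i by auto
  show ?thesis
  proof (rule K33_of_intervals[of N bag Y a b a' f])
    show "ring N bag" using t unfolding triple_def by blast
    show "bridge N bag (Y k)" for k using t unfolding triple_def Y_def by auto
    show "fst (Y k) \<inter> fst (Y l) = {}" if "k < 3" "l < 3" "k \<noteq> l" for k l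
      using t lt3[OF that(1)] lt3[OF that(2)] that(3) unfolding triple_def Y_def by (auto simp: Int_commute)
    show "\<exists>m\<in>snd (Y (f i)). b i < m \<and> m < a' i" if "i < 3" "f i < 3" for i
    proof -
      have f': "f i = 0 \<or> f i = 1 \<or> f i = 2" using lt3[OF that(2)] .
      have "hits (snd (Y (f i))) (b i + 1) (a' i - 1)" using lt3[OF that(1)]
      proof (elim disjE)
        assume i: "i = 0" show ?thesis using f' f(1-3) unfolding defs i by auto
      next
        assume i: "i = 1" show ?thesis using f' f(4-6) unfolding defs i by auto
      next
        assume i: "i = 2" show ?thesis using f' f(7-9) unfolding defs i by auto
      qed
      then show ?thesis by (metis add1_zle_eq zle_diff1_eq)
    qed
    show "(\<exists>m\<in>snd (Y k). a j \<le> m \<and> m \<le> b j) \<or> f j = k \<or> f ((j + 2) mod 3) = k" if "j < 3" "k < 3" for j k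
    proof -
      have m: "(0 + 2) mod 3 = (2::nat)" "(1 + 2) mod 3 = (0::nat)" "(2 + 2) mod 3 = (1::nat)" by simp_all
      show ?thesis using lt3[OF that(1)] lt3[OF that(2)]
      proof (elim disjE)
        assume e: "j = 0" "k = 0" show ?thesis using S(1) unfolding defs e m by simp
      next
        assume e: "j = 0" "k = 1" show ?thesis using U(1) unfolding defs e m by simp
      next
        assume e: "j = 0" "k = 2" show ?thesis using V(1) unfolding defs e m by simp
      next
        assume e: "j = 1" "k = 0" show ?thesis using S(2) unfolding defs e m by auto
      next
        assume e: "j = 1" "k = 1" show ?thesis using U(2) unfolding defs e m by auto
      next
        assume e: "j = 1" "k = 2" show ?thesis using V(2) unfolding defs e m by auto
      next
        assume e: "j = 2" "k = 0" show ?thesis using S(3) unfolding defs e m by auto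
      next
        assume e: "j = 2" "k = 1" show ?thesis using U(3) unfolding defs e m by auto
      next
        assume e: "j = 2" "k = 2" show ?thesis using V(3) unfolding defs e m by auto
      qed
    qed
  qed (use o in \<open>simp_all add: defs\<close>)
qed

lemma K33_three:
  assumes "triple N bag S U V" "a0 \<le> b0" "b0 < a1" "a1 \<le> b1" "b1 < a2" "a2 \<le> b2" "b2 < a0 + N"
    and "hits (snd S) a0 b0" "hits (snd S) a1 b1" "hits (snd S) a2 b2"
    and "hits (snd U) a0 b0" "hits (snd U) a1 b1" "hits (snd U) a2 b2"
    and "hits (snd V) a0 b0" "hits (snd V) a1 b1" "hits (snd V) a2 b2"
  shows K33_model
  by (rule K33_triple[OF assms(1-7), of 3 3 3]) (use assms(8-) in auto)

text \<open>\<open>V\<close> need not meet the second and third interval: it swallows the arc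
  between them and so becomes adjacent to both.\<close>

lemma K33_absorb1:
  assumes "triple N bag S U V" "a0 \<le> b0" "b0 < a1" "a1 \<le> b1" "b1 < a2" "a2 \<le> b2" "b2 < a0 + N"
    and "hits (snd S) a0 b0" "hits (snd S) a1 b1" "hits (snd S) a2 b2"
    and "hits (snd U) a0 b0" "hits (snd U) a1 b1" "hits (snd U) a2 b2"
    and "hits (snd V) a0 b0" "m \<in> snd V" "b1 < m" "m < a2"
  shows K33_model
proof -
  have "hits (snd V) (b1 + 1) (a2 - 1)" using assms(15-17) by (intro bexI[of _ m]) auto
  then show ?thesis by (intro K33_triple[OF assms(1-7), of 3 2 3]) (use assms(8-14) in simp_all)
qed

lemma hits_self: "hits X i i \<longleftrightarrow> i \<in> X"
  by (metis order_antisym order_refl)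

lemma hitsI: "m \<in> X \<Longrightarrow> a < m \<Longrightarrow> m < b \<Longrightarrow> hits X (a + 1) (b - 1)"
  by (intro bexI[of _ m]) auto

text \<open>\<open>K33\<close> as a hexagon with its three long diagonals, the bridges. The points
  \<open>i0\<close>, \<open>i2\<close>, \<open>i4\<close> form one class; the bridges, each
  swallowing one of \<open>i1\<close>, \<open>i3\<close>, \<open>i5\<close>, form the other.\<close>

lemma K33_hex:
  assumes "triple N bag S U V" "i0 < i1" "i1 < i2" "i2 < i3" "i3 < i4" "i4 < i5" "i5 < i0 + N"
    and "i0 \<in> snd S" "i3 \<in> snd S" "i1 \<in> snd U" "i4 \<in> snd U" "i2 \<in> snd V" "i5 \<in> snd V"
  shows K33_model
proof -
  have o: "i0 \<le> i0" "i0 < i2" "i2 \<le> i2" "i2 < i4" "i4 \<le> i4" "i4 < i0 + N" using assms by linarith+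
  show ?thesis
    by (rule K33_triple[OF assms(1) o, of 1 0 2])
      (use assms(8-13) hitsI[OF assms(10,2,3)] hitsI[OF assms(9,4,5)] hitsI[OF assms(13,6,7)] in \<open>simp_all add: hits_self\<close>)
qed

text \<open>\<open>S\<close> swallows both open arcs next to \<open>w\<close>, so it needs no foot
  at \<open>w\<close>, \<open>b\<close> or \<open>b'\<close>. \<open>U\<close> has all three, and
  \<open>V\<close> reaches \<open>b\<close> and \<open>b'\<close> directly or through the arc
  between them.\<close>

lemma K33_absorb3:
  assumes "triple N bag S U V" "w < b" "b < b'" "b' < w + N"
    and "y \<in> snd S" "w < y" "y < b" "x \<in> snd S" "b' < x" "x < w + N"
    and "w \<in> snd U" "b \<in> snd U" "b' \<in> snd U" "w \<in> snd V"
    and "b \<in> snd V \<and> b' \<in> snd V \<or> (\<exists>m\<in>snd V. b < m \<and> m < b')"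
  shows K33_model
proof -
  have o: "w \<le> w" "w < b" "b \<le> b" "b < b'" "b' \<le> b'" "b' < w + N" using assms by linarith+
  note h = hitsI[OF assms(5-7)] hitsI[OF assms(8-10)] assms(11-14)
  show ?thesis
  proof (cases "b \<in> snd V \<and> b' \<in> snd V")
    case True
    then show ?thesis by (intro K33_triple[OF assms(1) o, of 0 3 0]) (use h in \<open>simp_all add: hits_self\<close>)
  next
    case False
    then obtain m where m: "m \<in> snd V" "b < m" "m < b'" using assms(15) by blast
    show ?thesis by (rule K33_triple[OF assms(1) o, of 0 2 0]) (use h hitsI[OF m] in \<open>simp_all add: hits_self\<close>)
  qed
qed


text \<open>Reversing the orientation reduces a case to its mirror image, here for one end of a gap
  in \<open>K33_separated\<close>.\<close>

lemma ring_reflect: assumes r: "ring N bag" shows "ring N (\<lambda>i. bag (- i))"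
proof -
  have 1: "bag (- i - N) = bag (- i)" for i using ringD(2)[OF r, of "- i - N"] by simp
  have 2: "bag (- i) \<inter> bag (- j) = {}" if "i < j" "j < i + N" for i j
    using ringD(4)[OF r, of "- j" "- i"] that by auto
  have 3: "adj (bag (- i)) (bag (- j))"
    if ij: "i < j" "j < i + N" "bag (- i) \<noteq> {}" "bag (- j) \<noteq> {}" and e: "\<forall>k. i < k \<and> k < j \<longrightarrow> bag (- k) = {}" for i j
  proof -
    have "bag k = {}" if "- j < k" "k < - i" for k using e[rule_format, of "- k"] that by simp
    then show ?thesis using ringD(5)[OF r, of "- j" "- i"] ij adj_sym by auto
  qed
  show ?thesis unfolding ring_def using ringD(1,3)[OF r] 1 2 3 by auto
qed

lemma bridge_reflect: assumes b: "bridge N bag (B, X)" shows "bridge N (\<lambda>i. bag (- i)) (B, uminus ` X)"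
proof -
  have "i + N \<in> uminus ` X \<longleftrightarrow> i \<in> uminus ` X" for i
  proof -
    have *: "j \<in> uminus ` X \<longleftrightarrow> - j \<in> X" for j by (force simp: image_iff)
    have "- (i + N) = - i - N" by simp
    then show ?thesis using bridge_sub[OF b, of "- i"] unfolding * by simp
  qed
  then show ?thesis using bridgeD[OF b] unfolding bridge_def by auto
qed

definition reflect :: "'a set \<times> int set \<Rightarrow> 'a set \<times> int set" where "reflect S = (fst S, uminus ` snd S)"

lemma triple_reflect: "triple N bag S U V \<Longrightarrow> triple N (\<lambda>i. bag (- i)) (reflect S) (reflect U) (reflect V)"
  using bridge_reflect[of N bag "fst S" "snd S"] bridge_reflect[of N bag "fst U" "snd U"]
    bridge_reflect[of N bag "fst V" "snd V"] ring_reflect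
  unfolding triple_def reflect_def by simp

lemma reflect_mem: "i \<in> snd (reflect S) \<longleftrightarrow> - i \<in> snd S"
  unfolding reflect_def by (force simp: image_iff)

lemma big_reflect: assumes "big N X" shows "big N (uminus ` X)"
  unfolding big_def
proof
  fix p
  obtain x y z where "x \<in> X" "y \<in> X" "z \<in> X" "- p - N + 1 \<le> x" "x < y" "y < z" "z < - p - N + 1 + N"
    using bigD[OF assms, of "- p - N + 1"] .
  then show "\<exists>x\<in>uminus ` X. \<exists>y\<in>uminus ` X. \<exists>z\<in>uminus ` X. p \<le> x \<and> x < y \<and> y < z \<and> z < p + N"
    by (intro bexI[of _ "- z"] bexI[of _ "- y"] bexI[of _ "- x"]) auto
qed

text \<open>Meant for a gap of \<open>S\<close> from \<open>x\<close> to \<open>y\<close> inside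
  which \<open>U\<close> and \<open>V\<close> offer only the common foot \<open>w\<close>. As
  \<open>U\<close> also has a foot at \<open>x\<close>, this end can stand in for the missing one:
  \<open>x\<close>, \<open>w\<close>, \<open>y\<close>, \<open>b\<close>, \<open>D\<close>,
  \<open>s\<close> is a hexagon as long as the last foot \<open>D\<close> of \<open>V\<close> comes
  before \<open>s\<close>.\<close>

lemma K33_corner:
  assumes t: "triple N bag S U V" and big: "big N (snd V)"
    and xw: "x < w" "w < y" and x: "x \<in> snd S" "x \<in> snd U" and w: "w \<in> snd U" "w \<in> snd V" and y: "y \<in> snd S"
    and V: "\<And>i. i \<in> snd V \<Longrightarrow> x \<le> i \<Longrightarrow> i \<le> y \<Longrightarrow> i = w \<or> i = y"
    and s: "s \<in> snd S" "y < s" "s < x + N"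
    and b: "b \<in> snd U" "y < b" and bd: "b < d" and d: "d \<in> snd V" "d < x + N"
  shows K33_model
proof -
  let ?D = "{i \<in> {y<..<x + N}. i \<in> snd V}"
  have fD: "finite ?D" by (rule finite_subset[of _ "{y<..<x + N}"]) auto
  have dD: "d \<in> ?D" using b bd d by simp
  define D where "D = Max ?D"
  have "D \<in> ?D" using Max_in[OF fD] dD D_def by blast
  then have D: "D \<in> snd V" "y < D" "D < x + N" by simp_all
  have Dmax: "i \<le> D" if "i \<in> snd V" "y < i" "i < x + N" for i using Max_ge[OF fD, of i] that D_def by simp
  have bD: "b < D" using Dmax[OF d(1)] b bd d by linarith
  have per: "x + N \<in> snd S" "x + N \<in> snd U" using x triple_periodic[OF t] periodicD(1) by blast+
  consider "D < s" | "s < D" | "s = D" by linarith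
  then show ?thesis
  proof cases
    case 1
    show ?thesis by (rule K33_hex[OF triple_perm(4)[OF t], of x w y b D s]) (use 1 xw x w y b bD D s in auto)
  next
    case 2
    have h: "hits (snd U) (min b s) (max b s)" "hits (snd S) (min b s) (max b s)"
      using b(1) s(1) by (meson max.cobounded1 max.cobounded2 min.cobounded1 min.cobounded2)+
    show ?thesis
      by (rule K33_absorb1[OF triple_perm(1)[OF t], of w y "min b s" "max b s" "x + N" "x + N" D])
        (use 2 xw x w y b bD D s per h in \<open>auto intro: bexI[of _ w] bexI[of _ y]\<close>)
  next
    case 3
    \<comment> \<open>Now \<open>D\<close> is a common foot of \<open>S\<close> and
      \<open>V\<close>, so a foot \<open>e\<close> of \<open>V\<close> other than \<open>w\<close>
      and \<open>D\<close> is needed. It lies from \<open>y\<close> on and before \<open>D\<close>;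
      its position relative to \<open>b\<close> decides.\<close>
    then have DS: "D \<in> snd S" using s by simp
    obtain e1 e2 e3 where e: "e1 \<in> snd V" "e2 \<in> snd V" "e3 \<in> snd V" "x \<le> e1" "e1 < e2" "e2 < e3" "e3 < x + N"
      using bigD[OF big, of x] .
    obtain e where e: "e \<in> snd V" "x \<le> e" "e < x + N" "e \<noteq> w" "e \<noteq> D"
    proof -
      have "e1 \<noteq> w \<and> e1 \<noteq> D \<or> e2 \<noteq> w \<and> e2 \<noteq> D \<or> e3 \<noteq> w \<and> e3 \<noteq> D" using e by auto
      then show ?thesis using that[of e1] that[of e2] that[of e3] e by auto
    qed
    have ye: "y \<le> e" using V[OF e(1,2)] e(4) by linarith
    have eD: "e < D"
    proof (cases "e = y")
      case False
      then show ?thesis using Dmax[OF e(1)] ye e by linarith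
    qed (use D in simp)
    consider "e < b" | "e = b" | "b < e" by linarith
    then show ?thesis
    proof cases
      case 1
      show ?thesis
        by (rule K33_absorb1[OF triple_perm(2)[OF t], of x w y e D D b])
          (use 1 xw x w y b bD D DS ye e(1) in \<open>auto intro: bexI[of _ w] bexI[of _ e] bexI[of _ y] bexI[of _ x]\<close>)
    next
      case 2
      have DN: "D - N \<in> snd V" using D triple_periodic(3)[OF t] periodicD(2) by blast
      show ?thesis
        by (rule K33_absorb1[OF triple_perm(4)[OF t], of "D - N" x w w b b y])
          (use 2 xw x w y b bD D DN e(1) in \<open>auto intro: bexI[of _ "D - N"] bexI[of _ x]\<close>)
    next
      case 3
      show ?thesis by (rule K33_hex[OF triple_perm(4)[OF t], of x w y b e D]) (use 3 xw x w y b e(1) eD D DS in auto)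
    qed
  qed
qed

text \<open>Because \<open>U\<close> and \<open>V\<close> overlap although they are separated in the
  gap, a foot \<open>b\<close> of \<open>U\<close> precedes a foot \<open>d\<close> of
  \<open>V\<close> outside it. With feet \<open>u < v\<close> inside, \<open>x\<close>,
  \<open>u\<close>, \<open>v\<close>, \<open>y\<close>, \<open>b\<close>, \<open>d\<close> is a
  hexagon. Otherwise \<open>U\<close> and \<open>V\<close> share their only foot inside the open
  gap, and the ends of the gap or the extreme feet outside decide.\<close>

lemma K33_separated:
  assumes t: "triple N bag S U V" and bigs: "big N (snd S)" "big N (snd U)" "big N (snd V)"
    and ov: "\<not> non_overlapping N (snd S) (snd U)" "\<not> non_overlapping N (snd S) (snd V)" "\<not> non_overlapping N (snd U) (snd V)"
    and g: "gap (snd S) x y"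
    and u0: "u0 \<in> snd U" "x < u0" "u0 < y" and v0: "v0 \<in> snd V" "x < v0" "v0 < y"
    and sep: "\<And>u v. u \<in> snd U \<Longrightarrow> v \<in> snd V \<Longrightarrow> x \<le> u \<Longrightarrow> u \<le> y \<Longrightarrow> x \<le> v \<Longrightarrow> v \<le> y \<Longrightarrow> u \<le> v"
  shows K33_model
proof -
  have xy: "x < y" "x \<in> snd S" "y \<in> snd S" "\<forall>i. x < i \<and> i < y \<longrightarrow> i \<notin> snd S" using g unfolding gap_def by auto
  obtain s where s: "s \<in> snd S" "y < s" "s < x + N" using gap_lt[OF bigs(1) g] .
  have per: "i + N \<in> snd S \<longleftrightarrow> i \<in> snd S" "i + N \<in> snd U \<longleftrightarrow> i \<in> snd U" "i + N \<in> snd V \<longleftrightarrow> i \<in> snd V"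
    "i - N \<in> snd U \<longleftrightarrow> i \<in> snd U" "i - N \<in> snd V \<longleftrightarrow> i \<in> snd V" for i
    using triple_periodic[OF t] periodicD(1,2) by blast+
  have yN: "y \<le> x + N" using s by simp
  \<comment> \<open>If no foot of \<open>A\<close> preceded one of \<open>B\<close> outside the gap,
    the last foot \<open>m\<close> of \<open>A\<close> in the closed gap and the last foot
    \<open>e\<close> of \<open>B\<close> outside it would be cuts separating the two sets.\<close>
  have key: "\<exists>b d. b \<in> A \<and> d \<in> B \<and> y < b \<and> b < d \<and> d < x + N"
    if ovAB: "\<not> non_overlapping N A B" and ovS: "\<not> non_overlapping N (snd S) A" "\<not> non_overlapping N (snd S) B" and pA: "periodic N A" and pB: "periodic N B"
      and sep': "\<And>u v. u \<in> A \<Longrightarrow> v \<in> B \<Longrightarrow> x \<le> u \<Longrightarrow> u \<le> y \<Longrightarrow> x \<le> v \<Longrightarrow> v \<le> y \<Longrightarrow> u \<le> v"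
      and a: "a \<in> A" "x < a" "a < y" for A B a
  proof (rule ccontr)
    assume no: "\<not> ?thesis"
    let ?M = "{i \<in> {x..y}. i \<in> A}" and ?E = "{i \<in> {y<..<x + N}. i \<in> B}"
    have fM: "finite ?M" by (rule finite_subset[of _ "{x..y}"]) auto
    have fE: "finite ?E" by (rule finite_subset[of _ "{y<..<x + N}"]) auto
    define m e where "m = Max ?M" and "e = Max ?E"
    have "a \<in> ?M" using a by simp
    then have "m \<in> ?M" unfolding m_def by (intro Max_in[OF fM]) blast
    then have m: "m \<in> A" "x \<le> m" "m \<le> y" by simp_all
    have mmax: "i \<le> m" if "i \<in> A" "x \<le> i" "i \<le> y" for i using Max_ge[OF fM, of i] that m_def by simp
    obtain e0 where "y < e0" "e0 < x + N" "e0 \<in> B" using overlapD[OF ovS(2) _ yN xy(4)] xy(1) by auto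
    then have "e \<in> ?E" unfolding e_def by (intro Max_in[OF fE]) auto
    then have e: "e \<in> B" "y < e" "e < x + N" by simp_all
    have emax: "i \<le> e" if "i \<in> B" "y < i" "i < x + N" for i using Max_ge[OF fE, of i] that e_def by simp
    have "i \<notin> A" if i: "m < i" "i < e" for i
    proof
      assume iA: "i \<in> A"
      show False
      proof (cases "i \<le> y")
        case True then show False using mmax[OF iA] i m by simp
      next
        case False
        then show False using no iA e i by (meson linorder_not_le)
      qed
    qed
    then obtain i where i: "e < i" "i < m + N" "i \<in> B" using overlapD[OF ovAB, of m e] m e by auto
    show False
    proof (cases "i < x + N")
      case True then show False using emax[OF i(3)] i e by simp
    next
      case False
      have "i - N \<in> B" using i(3) periodicD(2)[OF pB] by blast
      then show False using sep'[OF m(1), of "i - N"] i m False by simp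
    qed
  qed
  obtain b d where bd: "b \<in> snd U" "d \<in> snd V" "y < b" "b < d" "d < x + N"
    using key[OF ov(3,1,2) triple_periodic(2,3)[OF t] sep u0] by auto
  show ?thesis
  proof (cases "\<exists>u v. u \<in> snd U \<and> v \<in> snd V \<and> x < u \<and> u < v \<and> v < y")
    case True
    then obtain u v where uv: "u \<in> snd U" "v \<in> snd V" "x < u" "u < v" "v < y" by blast
    show ?thesis by (rule K33_hex[OF t, of x u v y b d]) (use uv bd xy in auto)
  next
    case False
    have "u0 \<le> v0" using sep[OF u0(1) v0(1)] u0 v0 by simp
    then have uv: "u0 = v0" using False u0 v0 by (meson order_le_less)
    have Uw: "u = x \<or> u = u0" if "u \<in> snd U" "x \<le> u" "u \<le> y" for u
    proof -
      have "u \<le> u0" using sep[OF that(1) v0(1)] that v0 uv by simp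
      then show ?thesis using False that v0 uv by (metis order_le_less)
    qed
    have Vw: "v = u0 \<or> v = y" if "v \<in> snd V" "x \<le> v" "v \<le> y" for v
    proof -
      have "u0 \<le> v" using sep[OF u0(1) that(1)] that u0 by simp
      then show ?thesis using False that u0 by (metis order_le_less)
    qed
    have wV: "u0 \<in> snd V" using v0 uv by simp
    consider "x \<in> snd U" | "y \<in> snd V" | "x \<notin> snd U" "y \<notin> snd V" by blast
    then show ?thesis
    proof cases
      case 1
      show ?thesis by (rule K33_corner[OF t bigs(3), of x u0 y s b d]) (use u0 xy 1 wV Vw s bd in auto)
    next
      case 2
      \<comment> \<open>The mirror image of the previous case: after reflection \<open>y\<close> is
        the left end, and \<open>U\<close> and \<open>V\<close> exchange roles.
        \<open>N - b\<close>, \<open>N - d\<close>, \<open>N - s\<close> are the reflected feet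
        moved into the window after \<open>- x\<close>.\<close>
      have bigU: "big N (snd (reflect U))" unfolding reflect_def using big_reflect[OF bigs(2)] by simp
      have pb: "- (N - b) \<in> snd U" "- (N - d) \<in> snd V" "- (N - s) \<in> snd S"
        using per[of "b - N"] per[of "d - N"] per[of "s - N"] bd s by simp_all
      have Ur: "i = - u0 \<or> i = - x" if "i \<in> snd (reflect U)" "- y \<le> i" "i \<le> - x" for i
        using Uw[of "- i"] that unfolding reflect_mem by auto
      show ?thesis
        by (rule K33_corner[OF triple_reflect[OF triple_perm(2)[OF t]] bigU, of "- y" "- u0" "- x" "N - s" "N - d" "N - b"])
          (use u0 xy 2 wV Ur s bd pb in \<open>simp_all add: reflect_mem\<close>)
    next
      case 3
      \<comment> \<open>Neither \<open>U\<close> at \<open>x\<close> nor \<open>V\<close> at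
        \<open>y\<close> has a foot, so both meet the closed gap in \<open>u0\<close> only. They are
        then separated in either order, and \<open>key\<close> also applies with \<open>U\<close>
        and \<open>V\<close> exchanged.\<close>
      have Uw': "u = u0" if "u \<in> snd U" "x \<le> u" "u \<le> y" for u using Uw[OF that] 3 that by blast
      have Vw': "v = u0" if "v \<in> snd V" "x \<le> v" "v \<le> y" for v using Vw[OF that] 3 that by blast
      have ovVU: "\<not> non_overlapping N (snd V) (snd U)" using ov(3) non_overlapping_sym triple_periodic(3)[OF t] by blast
      obtain b2 d2 where bd2: "b2 \<in> snd V" "d2 \<in> snd U" "y < b2" "b2 < d2" "d2 < x + N"
        using key[OF ovVU ov(2,1) triple_periodic(3,2)[OF t], of v0] Uw' Vw' v0 by blast
      let ?U = "{i \<in> {y<..<x + N}. i \<in> snd U}" and ?V = "{i \<in> {y<..<x + N}. i \<in> snd V}"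
      have fU: "finite ?U" and fV: "finite ?V" by (rule finite_subset[of _ "{y<..<x + N}"]; auto)+
      have mem: "b \<in> ?U" "d2 \<in> ?U" "d \<in> ?V" "b2 \<in> ?V" using bd bd2 by simp_all
      define u1 u2 v1 v2 where "u1 = Min ?U" and "u2 = Max ?U" and "v1 = Min ?V" and "v2 = Max ?V"
      have "u1 \<in> ?U" "u2 \<in> ?U" "v1 \<in> ?V" "v2 \<in> ?V"
        unfolding u1_def u2_def v1_def v2_def by (rule Min_in Max_in; use fU fV mem in blast)+
      then have in1: "u1 \<in> snd U" "u2 \<in> snd U" "v1 \<in> snd V" "v2 \<in> snd V" and
        in2: "y < u1" "u2 < x + N" "y < v1" "v2 < x + N" by simp_all
      have le: "u1 \<le> b" "d2 \<le> u2" "d \<le> v2" "v1 \<le> b2"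
        unfolding u1_def u2_def v1_def v2_def using Min_le[OF fU mem(1)] Max_ge[OF fU mem(2)] Max_ge[OF fV mem(3)] Min_le[OF fV mem(4)] by simp_all
      have m1: "K33_model" if "p \<in> snd U" "q \<in> snd U" "y < p" "p < q" "q < x + N" "p \<in> snd V \<and> q \<in> snd V \<or> (\<exists>m\<in>snd V. p < m \<and> m < q)" for p q
        by (rule K33_absorb3[OF t, of u0 p q y "x + N"]) (use that u0 xy wV per in auto)
      have m2: "K33_model" if "p \<in> snd V" "q \<in> snd V" "y < p" "p < q" "q < x + N" "\<exists>m\<in>snd U. p < m \<and> m < q" for p q
        by (rule K33_absorb3[OF triple_perm(2)[OF t], of u0 p q y "x + N"]) (use that u0 xy wV per in auto)
      \<comment> \<open>The set that starts strictly earlier or ends strictly later outside the gap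
        encloses a foot of the other set. If both extremes agree, they are two common feet.\<close>
      consider "u1 < v1" | "v1 < u1" | "u1 = v1" "u2 < v2" | "u1 = v1" "v2 < u2" | "u1 = v1" "u2 = v2" by linarith
      then show ?thesis
      proof cases
        case 1
        show ?thesis by (rule m1[of u1 u2]) (use 1 in1 in2 le bd bd2 in \<open>auto intro!: bexI[of _ v1]\<close>)
      next
        case 2
        show ?thesis by (rule m2[of v1 v2]) (use 2 in1 in2 le bd bd2 in \<open>auto intro!: bexI[of _ u1]\<close>)
      next
        case 3
        show ?thesis by (rule m2[of v1 v2]) (use 3 in1 in2 le bd bd2 in \<open>auto intro!: bexI[of _ u2]\<close>)
      next
        case 4
        have "\<exists>m\<in>snd V. u1 < m \<and> m < u2" by (rule bexI[of _ v2]) (use 4 in1 in2 le bd bd2 in auto)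
        then show ?thesis by (intro m1[of u1 u2]) (use 4 in1 in2 le bd bd2 in auto)
      next
        case 5
        show ?thesis by (rule m1[of u1 u2]) (use 5 in1 in2 le bd bd2 in auto)
      qed
    qed
  qed
qed

text \<open>If neither order separates \<open>U\<close> from \<open>V\<close> in the gap, there are
  feet \<open>v < u\<close> and \<open>u' < v'\<close>. Either three of them alternate between the
  two sets, and the bridge of the middle one swallows the arc around it, or \<open>u' = v\<close>
  and the gap splits into two intervals met by all three bridges.\<close>

lemma K33_gap:
  assumes t: "triple N bag S U V" and bigs: "big N (snd S)" "big N (snd U)" "big N (snd V)"
    and ov: "\<not> non_overlapping N (snd S) (snd U)" "\<not> non_overlapping N (snd S) (snd V)" "\<not> non_overlapping N (snd U) (snd V)"
    and g: "gap (snd S) x y"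
    and u0: "u0 \<in> snd U" "x < u0" "u0 < y" and v0: "v0 \<in> snd V" "x < v0" "v0 < y"
  shows K33_model
proof (rule ccontr)
  assume nK: "\<not> K33_model"
  have xy: "x < y" "x \<in> snd S" "y \<in> snd S" "\<forall>i. x < i \<and> i < y \<longrightarrow> i \<notin> snd S" using g unfolding gap_def by auto
  obtain s where s: "s \<in> snd S" "y < s" "s < x + N" using gap_lt[OF bigs(1) g] .
  have yN: "y \<le> x + N" using s by simp
  obtain p where p: "y < p" "p < x + N" "p \<in> snd U" using overlapD[OF ov(1) _ yN xy(4)] xy(1) by auto
  obtain q where q: "y < q" "q < x + N" "q \<in> snd V" using overlapD[OF ov(2) _ yN xy(4)] xy(1) by auto
  have per: "s - N \<in> snd S" "p - N \<in> snd U" "q - N \<in> snd V"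
    using triple_periodic[OF t] periodicD(2) s p q by blast+
  have A: False if "triple N bag S U' V'" "p' \<in> snd U'" "q' \<in> snd V'" "y - N < p'" "p' < x" "y - N < q'" "q' < x"
    "u \<in> snd U'" "v \<in> snd V'" "u' \<in> snd U'" "x \<le> u" "u < v" "v < u'" "u' \<le> y" for U' V' p' q' u v u'
  proof -
    have h: "hits (snd S) (y - N + 1) (x - 1)" by (rule bexI[of _ "s - N"]) (use per s in auto)
    have h': "hits (snd U') (y - N + 1) (x - 1)" by (rule bexI[of _ p']) (use that in auto)
    have h'': "hits (snd V') (y - N + 1) (x - 1)" by (rule bexI[of _ q']) (use that in auto)
    have hx: "hits (snd S) x u" "hits (snd S) u' y" "hits (snd U') x u" "hits (snd U') u' y" using that xy by auto
    show False
      by (rule nK[THEN notE], rule K33_absorb1[OF that(1), of "y - N + 1" "x - 1" x u u' y v])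
        (use h h' h'' hx that xy yN in auto)
  qed
  have sepU: "\<not> (\<forall>u v. u \<in> snd U \<longrightarrow> v \<in> snd V \<longrightarrow> x \<le> u \<longrightarrow> u \<le> y \<longrightarrow> x \<le> v \<longrightarrow> v \<le> y \<longrightarrow> u \<le> v)"
    using K33_separated[OF t bigs ov g u0 v0] nK by blast
  have ovVU: "\<not> non_overlapping N (snd V) (snd U)" using ov(3) non_overlapping_sym triple_periodic(3)[OF t] by blast
  have sepV: "\<not> (\<forall>u v. u \<in> snd U \<longrightarrow> v \<in> snd V \<longrightarrow> x \<le> u \<longrightarrow> u \<le> y \<longrightarrow> x \<le> v \<longrightarrow> v \<le> y \<longrightarrow> v \<le> u)"
    using K33_separated[OF triple_perm(2)[OF t] bigs(1,3,2) ov(2,1) ovVU g v0 u0] nK by blast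
  obtain u v where uv: "u \<in> snd U" "v \<in> snd V" "x \<le> u" "u \<le> y" "x \<le> v" "v \<le> y" "v < u" using sepU by force
  obtain u' v' where uv': "u' \<in> snd U" "v' \<in> snd V" "x \<le> u'" "u' \<le> y" "x \<le> v'" "v' \<le> y" "u' < v'" using sepV by force
  consider "v < u'" | "u' < v" | "u' = v" by linarith
  then show False
  proof cases
    case 1
    show False by (rule A[OF triple_perm(2)[OF t], of "q - N" "p - N" v u' v']) (use 1 uv uv' per p q in auto)
  next
    case 2
    show False by (rule A[OF t, of "p - N" "q - N" u' v u]) (use 2 uv uv' per p q in auto)
  next
    case 3
    have h: "hits (snd S) x v" "hits (snd S) (v + 1) y" "hits (snd S) (y + 1) (x + N - 1)"
      "hits (snd U) x v" "hits (snd U) (v + 1) y" "hits (snd U) (y + 1) (x + N - 1)"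
      "hits (snd V) x v" "hits (snd V) (v + 1) y" "hits (snd V) (y + 1) (x + N - 1)"
      using 3 uv uv' s p q xy by (auto intro: bexI[of _ s] bexI[of _ y] bexI[of _ u'] bexI[of _ u] bexI[of _ v'] bexI[of _ p] bexI[of _ q])
    show False
      by (rule nK[THEN notE], rule K33_three[OF t, of x v "v + 1" y "y + 1" "x + N - 1"]) (use h 3 uv uv' s in auto)
  qed
qed

text \<open>By \<open>K33_gap\<close> no gap of one set contains feet of both others. So a foot
  common to two sets belongs to the third, and by \<open>K33_three\<close> there are at most two
  common feet per period. A foot \<open>v\<close> of \<open>V\<close> alone lies in gaps of
  \<open>S\<close> and \<open>U\<close> that must coincide, which makes their ends common feet. The
  same argument around a further foot \<open>s\<close> of \<open>S\<close> shows that the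
  complementary arc is a gap of \<open>U\<close>, although \<open>U\<close> has the foot
  \<open>u\<close> there.\<close>

lemma K33_triangle:
  assumes t: "triple N bag S U V" and bigs: "big N (snd S)" "big N (snd U)" "big N (snd V)"
    and ov: "\<not> non_overlapping N (snd S) (snd U)" "\<not> non_overlapping N (snd S) (snd V)" "\<not> non_overlapping N (snd U) (snd V)"
  shows K33_model
proof (rule ccontr)
  assume nK: "\<not> K33_model"
  note pS = triple_periodic(1)[OF t] and pU = triple_periodic(2)[OF t] and pV = triple_periodic(3)[OF t]
  have ov': "\<not> non_overlapping N (snd U) (snd S)" "\<not> non_overlapping N (snd V) (snd S)" "\<not> non_overlapping N (snd V) (snd U)"
    using ov non_overlapping_sym pS pU pV by blast+
  have gS: False if "gap (snd S) x y" "u \<in> snd U" "x < u" "u < y" "v \<in> snd V" "x < v" "v < y" for x y u v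
    using K33_gap[OF t bigs ov that] nK by blast
  have gU: False if "gap (snd U) x y" "u \<in> snd S" "x < u" "u < y" "v \<in> snd V" "x < v" "v < y" for x y u v
    using K33_gap[OF triple_perm(1)[OF t] bigs(2,1,3) ov'(1) ov(3,2) that] nK by blast
  have gV: False if "gap (snd V) x y" "u \<in> snd S" "x < u" "u < y" "v \<in> snd U" "x < v" "v < y" for x y u v
    using K33_gap[OF triple_perm(5)[OF t] bigs(3,1,2) ov'(2,3) ov(1) that] nK by blast
  have cV: "i \<in> snd V" if i: "i \<in> snd S" "i \<in> snd U" for i
  proof (rule ccontr)
    assume "i \<notin> snd V"
    then obtain x y where "gap (snd V) x y" "x < i" "i < y" using gap_ex[OF pV bigs(3)] by blast
    then show False using gV i by blast
  qed
  have cU: "i \<in> snd U" if i: "i \<in> snd S" "i \<in> snd V" for i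
  proof (rule ccontr)
    assume "i \<notin> snd U"
    then obtain x y where "gap (snd U) x y" "x < i" "i < y" using gap_ex[OF pU bigs(2)] by blast
    then show False using gU i by blast
  qed
  have cS: "i \<in> snd S" if i: "i \<in> snd U" "i \<in> snd V" for i
  proof (rule ccontr)
    assume "i \<notin> snd S"
    then obtain x y where "gap (snd S) x y" "x < i" "i < y" using gap_ex[OF pS bigs(1)] by blast
    then show False using gS i by blast
  qed
  have c3: False if "p < q" "q < r" "r < p + N" "p \<in> snd S" "p \<in> snd U" "q \<in> snd S" "q \<in> snd U" "r \<in> snd S" "r \<in> snd U" for p q r
    by (rule nK[THEN notE], rule K33_three[OF t, of p p q q r r]) (use that cV in auto)
  have "\<exists>v. v \<in> snd V \<and> v \<notin> snd U"
  proof (rule ccontr)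
    assume no: "\<not> ?thesis"
    obtain a b c where "a \<in> snd V" "b \<in> snd V" "c \<in> snd V" "0 \<le> a" "a < b" "b < c" "c < 0 + N" using bigD[OF bigs(3), of 0] .
    moreover have "i \<in> snd U \<and> i \<in> snd S" if "i \<in> snd V" for i using no that cS by blast
    ultimately show False using c3[of a b c] by auto
  qed
  then obtain v where v: "v \<in> snd V" "v \<notin> snd U" by blast
  have vS: "v \<notin> snd S" using cU v by blast
  obtain x y where g: "gap (snd S) x y" "x < v" "v < y" using gap_ex[OF pS bigs(1) vS] by blast
  obtain x' y' where g': "gap (snd U) x' y'" "x' < v" "v < y'" using gap_ex[OF pU bigs(2) v(2)] by blast
  have m: "x \<in> snd S" "y \<in> snd S" "x' \<in> snd U" "y' \<in> snd U" using g g' unfolding gap_def by auto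
  have o: "x' < y" "x < y'" using g g' by linarith+
  have "x' \<le> x" "y \<le> y'" "x \<le> x'" "y' \<le> y"
    using gS[OF g(1) m(3) _ o(1) v(1) g(2,3)] gS[OF g(1) m(4) o(2) _ v(1) g(2,3)]
      gU[OF g'(1) m(1) _ o(2) v(1) g'(2,3)] gU[OF g'(1) m(2) o(1) _ v(1) g'(2,3)] linorder_not_less by blast+
  then have e: "x' = x" "y' = y" by auto
  then have mU: "x \<in> snd U" "y \<in> snd U" using m by auto
  have mN: "x + N \<in> snd S" "x + N \<in> snd U" using m mU periodicD(1) pS pU by blast+
  have xy: "x < y" using g by simp
  obtain s where s: "s \<in> snd S" "y < s" "s < x + N" using gap_lt[OF bigs(1) g(1)] .
  obtain u where u: "u \<in> snd U" "y < u" "u < x + N" using gap_lt[OF bigs(2) g'(1)] e by auto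
  have sU: "s \<notin> snd U" using c3[OF xy s(2,3) m(1) mU(1) m(2) mU(2) s(1)] by blast
  then have sV: "s \<notin> snd V" using cU s by blast
  obtain x2 y2 where g2: "gap (snd U) x2 y2" "x2 < s" "s < y2" using gap_ex[OF pU bigs(2) sU] by blast
  obtain x3 y3 where g3: "gap (snd V) x3 y3" "x3 < s" "s < y3" using gap_ex[OF pV bigs(3) sV] by blast
  have m2: "x2 \<in> snd U" "y2 \<in> snd U" "x3 \<in> snd V" "y3 \<in> snd V" using g2 g3 unfolding gap_def by auto
  have o: "x2 < y3" "x3 < y2" using g2 g3 by linarith+
  have "x2 \<le> x3" "y3 \<le> y2" "x3 \<le> x2" "y2 \<le> y3"
    using gV[OF g3(1) s(1) g3(2,3) m2(1) _ o(1)] gV[OF g3(1) s(1) g3(2,3) m2(2) o(2)]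
      gU[OF g2(1) s(1) g2(2,3) m2(3) _ o(2)] gU[OF g2(1) s(1) g2(2,3) m2(4) o(1)] linorder_not_less by blast+
  then have e2: "x3 = x2" "y3 = y2" by auto
  have mS: "x2 \<in> snd S" "y2 \<in> snd S" using cS m2 e2 by auto
  have o: "x2 < x + N" "y < y2" using g2(2,3) s by linarith+
  have "i \<notin> snd U" if "x2 < i" "i < y2" for i using g2(1) that unfolding gap_def by blast
  then have "y \<le> x2" "y2 \<le> x + N" using mU(2) mN(2) o linorder_not_le by blast+
  moreover have "\<not> y < x2" using c3[OF xy _ o(1) m(1) mU(1) m(2) mU(2) mS(1) m2(1)] by blast
  moreover have "\<not> y2 < x + N" using c3[OF xy o(2) _ m(1) mU(1) m(2) mU(2) mS(2) m2(2)] by blast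
  ultimately have "x2 = y" "y2 = x + N" by auto
  then show False using g2(1) u unfolding gap_def by auto
qed

end

section \<open>Relative position of periodic sets\<close>

lemma periodic_mult: assumes "periodic N X" shows "i + k * N \<in> X \<longleftrightarrow> i \<in> X"
proof -
  have *: "i + int m * N \<in> X \<longleftrightarrow> i \<in> X" for i m
  proof (induction m)
    case (Suc m)
    have e: "i + int (Suc m) * N = i + int m * N + N" by (simp add: algebra_simps)
    show ?case unfolding e periodicD(1)[OF assms] by (rule Suc)
  qed simp
  show ?thesis
  proof (cases "0 \<le> k")
    case True then show ?thesis using *[of i "nat k"] by simp
  next
    case False then show ?thesis using *[of "i + k * N" "nat (- k)"] by simp
  qed
qed

lemma shift_window: assumes "(0::int) < N" obtains k where "a \<le> i + k * N" "i + k * N < a + N"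
proof -
  have "i + (- ((i - a) div N)) * N = a + (i - a) mod N" by (simp add: minus_div_mult_eq_mod[symmetric] algebra_simps)
  then show ?thesis using that[of "- ((i - a) div N)"] assms by simp
qed

text \<open>Each element is moved by whole periods into the window; the differences are below
  \<open>N\<close>, so the three copies stay distinct.\<close>

lemma bigI:
  assumes p: "periodic N X" and abc: "a \<in> X" "b \<in> X" "c \<in> X" "a < b" "b < c" "c < a + N"
  shows "big N X"
  unfolding big_def
proof
  fix q
  note N = periodicD(3)[OF p]
  obtain i where i: "q \<le> a + i * N" "a + i * N < q + N" using shift_window[OF N] .
  obtain j where j: "q \<le> b + j * N" "b + j * N < q + N" using shift_window[OF N] .
  obtain k where k: "q \<le> c + k * N" "c + k * N < q + N" using shift_window[OF N] .
  have ne: "x + i * N \<noteq> y + j * N" if "x < y" "y < x + N" for x y i j :: int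
  proof
    assume "x + i * N = y + j * N"
    then have e: "y - x = (i - j) * N" by (simp add: algebra_simps)
    show False
    proof (cases "i - j \<le> 0")
      case True then show False using e that N by (smt (verit) mult_nonneg_nonneg mult_minus_left)
    next
      case False
      then have "1 * N \<le> (i - j) * N" using N by (intro mult_right_mono) auto
      then show False using e that unfolding e[symmetric] by linarith
    qed
  qed
  define A B C where "A = a + i * N" and "B = b + j * N" and "C = c + k * N"
  have d: "A \<noteq> B" "A \<noteq> C" "B \<noteq> C" unfolding A_def B_def C_def using ne[of a b] ne[of a c] ne[of b c] abc by auto
  have m: "A \<in> X" "B \<in> X" "C \<in> X" unfolding A_def B_def C_def using abc periodic_mult[OF p] by auto
  have w: "q \<le> A" "A < q + N" "q \<le> B" "B < q + N" "q \<le> C" "C < q + N" unfolding A_def B_def C_def using i j k by auto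
  have "A < B \<and> B < C \<or> A < C \<and> C < B \<or> B < A \<and> A < C \<or> B < C \<and> C < A \<or> C < A \<and> A < B \<or> C < B \<and> B < A"
    using d by linarith
  then show "\<exists>x\<in>X. \<exists>y\<in>X. \<exists>z\<in>X. q \<le> x \<and> x < y \<and> y < z \<and> z < q + N" using m w by blast
qed

lemma non_overlapping_inside:
  assumes B: "big N B" and pq: "p \<le> q" "q \<le> p + N" "\<forall>i. q < i \<and> i < p + N \<longrightarrow> i \<notin> B"
  obtains e where "e \<in> B" "p < e" "e < q"
proof -
  obtain x y z where e: "x \<in> B" "y \<in> B" "z \<in> B" "p \<le> x" "x < y" "y < z" "z < p + N" using bigD[OF B, of p] .
  have "z \<le> q" using pq(3) e by force
  then show ?thesis using that[OF e(2)] e by linarith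
qed

text \<open>The cuts can be widened to a gap of \<open>A\<close>: some element of \<open>B\<close>
  lies strictly between them and hence off \<open>A\<close>, and the gap of \<open>A\<close> around
  it contains both cuts.\<close>

lemma non_overlapping_gap:
  assumes A: "periodic N A" "big N A" and B: "big N B" and n: "non_overlapping N A B"
  obtains c' c where "gap A c' c" "\<And>i. c < i \<Longrightarrow> i < c' + N \<Longrightarrow> i \<notin> B"
proof -
  obtain p q where pq: "p \<le> q" "q \<le> p + N" "\<forall>i. p < i \<and> i < q \<longrightarrow> i \<notin> A" "\<forall>i. q < i \<and> i < p + N \<longrightarrow> i \<notin> B"
    using n unfolding non_overlapping_def by blast
  obtain e where e: "e \<in> B" "p < e" "e < q" using non_overlapping_inside[OF B pq(1,2,4)] .
  then have "e \<notin> A" using pq(3) by blast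
  then obtain c' c where c: "gap A c' c" "c' < e" "e < c" using gap_ex[OF A] by blast
  have cA: "c' \<in> A" "c \<in> A" using c unfolding gap_def by auto
  have "\<not> (p < c' \<and> c' < q)" "\<not> (p < c \<and> c < q)" using pq(3) cA by blast+
  then have "c' \<le> p" "q \<le> c" using c e by linarith+
  then show ?thesis using that[OF c(1)] pq(4) by auto
qed

lemma gap_le: "big N A \<Longrightarrow> gap A c' c \<Longrightarrow> c + 1 < c' + N"
  using gap_lt[of N A c' c] by force

lemma gap_shift: assumes "periodic N A" "gap A x y" shows "gap A (x + k * N) (y + k * N)"
proof -
  have "i \<notin> A" if "x + k * N < i" "i < y + k * N" for i
    using assms(2) periodic_mult[OF assms(1), of i "- k"] that unfolding gap_def by auto
  then show ?thesis using assms periodic_mult[OF assms(1)] unfolding gap_def by auto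
qed

lemma gap_unique: "gap A x y \<Longrightarrow> gap A x' y' \<Longrightarrow> x < t \<Longrightarrow> t < y \<Longrightarrow> x' < t \<Longrightarrow> t < y' \<Longrightarrow> x = x' \<and> y = y'"
  unfolding gap_def by (smt (verit))

text \<open>\<open>B'\<close> has a foot strictly inside the gap that holds \<open>B\<close>, as
  otherwise \<open>c'\<close> and \<open>c\<close> would be cuts between \<open>B'\<close> and
  \<open>B\<close>. Since \<open>B'\<close> does not overlap \<open>A\<close>, it also lies in a
  single gap of \<open>A\<close>, which must be this one.\<close>

lemma non_overlapping_propagate:
  assumes A: "periodic N A" "big N A" and B: "\<And>i. c < i \<Longrightarrow> i < c' + N \<Longrightarrow> i \<notin> B"
    and B': "periodic N B'" "big N B'" and g: "gap A c' c" and n: "non_overlapping N A B'" and o: "\<not> non_overlapping N B' B"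
  shows "c < i \<Longrightarrow> i < c' + N \<Longrightarrow> i \<notin> B'"
proof -
  assume i: "c < i" "i < c' + N"
  have cc: "c' \<le> c" "c \<le> c' + N" using g gap_le[OF A(2) g] unfolding gap_def by auto
  obtain t where t: "c' < t" "t < c" "t \<in> B'" using o cc B unfolding non_overlapping_def by blast
  have tA: "t \<notin> A" using t g unfolding gap_def by blast
  obtain d' d where d: "gap A d' d" "\<And>i. d < i \<Longrightarrow> i < d' + N \<Longrightarrow> i \<notin> B'" using non_overlapping_gap[OF A B'(2) n] by blast
  obtain k where k: "d' \<le> t + k * N" "t + k * N < d' + N" using shift_window[OF periodicD(3)[OF A(1)]] .
  have "t + k * N \<in> B'" "t + k * N \<notin> A" using t tA periodic_mult A(1) B'(1) by blast+
  then have "d' < t + k * N" "t + k * N < d" using d k unfolding gap_def by (smt (verit))+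
  then have "c' = d' - k * N \<and> c = d - k * N"
    using gap_unique[OF g _ t(1,2), of "d' - k * N" "d - k * N"] gap_shift[OF A(1) d(1), of "- k"] by auto
  then have "i + k * N \<notin> B'" using d(2)[of "i + k * N"] i by auto
  then show "i \<notin> B'" using periodic_mult[OF B'(1)] by blast
qed

section \<open>Odd closed walks in the overlap relation\<close>

context sym_rel begin

definition crosses :: "int \<Rightarrow> 'a set \<times> int set \<Rightarrow> 'a set \<times> int set \<Rightarrow> bool" where
  "crosses N S T \<longleftrightarrow> S \<noteq> T \<and> \<not> non_overlapping N (snd S) (snd T)"

definition bridge_system :: "int \<Rightarrow> (int \<Rightarrow> 'a set) \<Rightarrow> ('a set \<times> int set) set \<Rightarrow> bool" where
  "bridge_system N bag \<S> \<longleftrightarrow> ring N bag \<and> (\<forall>S\<in>\<S>. bridge N bag S \<and> big N (snd S)) \<and>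
     (\<forall>S\<in>\<S>. \<forall>T\<in>\<S>. S \<noteq> T \<longrightarrow> fst S \<inter> fst T = {})"

text \<open>Bridges may repeat. Splitting a closed walk at a repetition or at an additional crossing
  then yields closed walks again with nothing to check but parity.\<close>

definition closed_walk :: "int \<Rightarrow> ('a set \<times> int set) list \<Rightarrow> bool" where
  "closed_walk N xs \<longleftrightarrow> xs \<noteq> [] \<and> successively (crosses N) (xs @ [hd xs])"

lemma bridge_periodic: "ring N bag \<Longrightarrow> bridge N bag S \<Longrightarrow> periodic N (snd S)"
  unfolding periodic_def using bridgeD(4) ringD(1) by blast

lemma bag_mult: assumes "ring N bag" shows "bag (i + k * N) = bag i"
proof -
  have *: "bag (i + int m * N) = bag i" for i m
  proof (induction m)
    case (Suc m)
    have e: "i + int (Suc m) * N = i + int m * N + N" by (simp add: algebra_simps)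
    show ?case unfolding e ringD(2)[OF assms] by (rule Suc)
  qed simp
  show ?thesis
  proof (cases "0 \<le> k")
    case True then show ?thesis using *[of i "nat k"] by simp
  next
    case False then show ?thesis using *[of "i + k * N" "nat (- k)"] by simp
  qed
qed

lemma bag_subset_arc: "a \<le> i \<Longrightarrow> i \<le> b \<Longrightarrow> bag i \<subseteq> arc bag a b"
  unfolding arc_def by (rule UN_upper) simp

lemma successively_split:
  assumes "successively P (xs @ y # ys)"
  shows "successively P (xs @ [y])" "successively P (y # ys)"
  using assms by (auto simp: successively_append_iff successively_Cons)

text \<open>The ring is rerouted through the bridge \<^term>\<open>a\<close>, which replaces the open arc from \<^term>\<open>c\<close> to \<^term>\<open>c' + N\<close>.\<close>

definition reroute :: "int \<Rightarrow> (int \<Rightarrow> 'a set) \<Rightarrow> 'a set \<Rightarrow> int \<Rightarrow> int \<Rightarrow> int \<Rightarrow> 'a set" where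
  "reroute N bag a c' c i = (let w = (i - c') mod N in if w \<le> c - c' then bag i else if w = c - c' + 1 then a else {})"

lemma ring_reroute:
  assumes r: "ring N bag" and a: "bridge N bag a" and g: "gap (snd a) c' c" and cN: "c + 1 < c' + N"
  shows "ring N (reroute N bag (fst a) c' c)"
    "c' \<le> i \<Longrightarrow> i \<le> c \<Longrightarrow> reroute N bag (fst a) c' c i = bag i"
    "reroute N bag (fst a) c' c (c + 1) = fst a"
proof -
  let ?b = "reroute N bag (fst a) c' c"
  note N = ringD(1)[OF r]
  have cc: "c' < c" "c' \<in> snd a" "c \<in> snd a" using g unfolding gap_def by auto
  have v: "(c' + w - c') mod N = w" if "0 \<le> w" "w < N" for w using that by simp
  have b1: "?b i = bag i" if "c' \<le> i" "i \<le> c" for i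
    using v[of "i - c'"] that cN unfolding reroute_def by (simp add: Let_def)
  have b2: "?b (c + 1) = fst a"
    using v[of "c + 1 - c'"] cN cc unfolding reroute_def by (simp add: Let_def)
  have b3: "?b i = {}" if "c + 1 < i" "i < c' + N" for i
    using v[of "i - c'"] that cN cc unfolding reroute_def by (simp add: Let_def)
  have per: "?b (i + k * N) = ?b i" for i k
  proof -
    have "(i + k * N - c') mod N = (i - c') mod N" by (metis (no_types, opaque_lifting) add_diff_eq diff_add_eq mod_mult_self1)
    then show ?thesis unfolding reroute_def bag_mult[OF r] by simp
  qed
  show "c' \<le> i \<Longrightarrow> i \<le> c \<Longrightarrow> ?b i = bag i" for i by (rule b1)
  show "?b (c + 1) = fst a" by (rule b2)
  have ne: "bag c' \<noteq> {}" "bag c \<noteq> {}" "fst a \<noteq> {}" using bridgeD(3)[OF a] cc unfolding adj_def by blast+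
  have win: "(\<And>i. c' \<le> i \<Longrightarrow> i < c' + N \<Longrightarrow> Q i) \<Longrightarrow> (\<And>i k. Q (i + k * N) \<Longrightarrow> Q i) \<Longrightarrow> Q i" for Q i
    using shift_window[OF N, of c' i] by blast
  have cn: "conn (?b i)" for i
    unfolding reroute_def Let_def using ringD(3)[OF r] bridgeD(1)[OF a] conn_empty by auto
  have disj: "?b i \<inter> ?b j = {}" if ij: "i < j" "j < i + N" for i j
  proof -
    have "(i - c') mod N \<noteq> (j - c') mod N"
    proof
      assume "(i - c') mod N = (j - c') mod N"
      then have "N dvd (i - c') - (j - c')" by (simp add: mod_eq_dvd_iff)
      then have "N dvd j - i" by (simp add: dvd_diff_commute)
      then show False using ij zdvd_imp_le[of N "j - i"] by simp
    qed
    then show ?thesis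
      unfolding reroute_def Let_def using ringD(4)[OF r ij] bridgeD(2)[OF a] by (auto simp: Int_commute)
  qed
  have adjw: "adj (?b i) (?b j)" if w: "c' \<le> i" "i < c' + N" and ij: "i < j" "j < i + N" "?b i \<noteq> {}" "?b j \<noteq> {}"
    and e: "\<forall>k. i < k \<and> k < j \<longrightarrow> ?b k = {}" for i j
  proof -
    consider "i < c" | "i = c" | "i = c + 1" | "c + 1 < i" by linarith
    then show ?thesis
    proof cases
      case 1
      have "j \<le> c" using e[rule_format, of c] b1[of c] ne 1 cc by force
      then have "\<forall>k. i < k \<and> k < j \<longrightarrow> bag k = {}" using e b1 w by force
      then show ?thesis using ringD(5)[OF r ij(1,2)] ij b1[of i] b1[of j] w 1 \<open>j \<le> c\<close> by simp
    next
      case 2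
      have "\<not> c + 1 < j" using e[rule_format, of "c + 1"] b2 ne 2 by auto
      then have "j = c + 1" using ij 2 by simp
      then show ?thesis using 2 b1[of c] b2 cc adj_sym[OF bridgeD(3)[OF a cc(3)]] by simp
    next
      case 3
      have bN: "?b (c' + N) = bag c'" using per[of c' 1] b1[of c'] cc by simp
      have "\<not> c' + N < j" using e[rule_format, of "c' + N"] bN ne 3 cN by auto
      moreover have "\<not> j < c' + N" using b3[of j] ij 3 by auto
      ultimately have "j = c' + N" by simp
      then show ?thesis using 3 b2 bN bridgeD(3)[OF a cc(2)] by simp
    next
      case 4 then show ?thesis using b3 w ij by blast
    qed
  qed
  have adj: "adj (?b i) (?b j)" if ij: "i < j" "j < i + N" "?b i \<noteq> {}" "?b j \<noteq> {}"
    and e: "\<forall>k. i < k \<and> k < j \<longrightarrow> ?b k = {}" for i j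
  proof -
    obtain k where k: "c' \<le> i + k * N" "i + k * N < c' + N" using shift_window[OF N] .
    have "?b m = {}" if "i + k * N < m" "m < j + k * N" for m
      using e[rule_format, of "m - k * N"] per[of "m - k * N" k] that by simp
    then have "adj (?b (i + k * N)) (?b (j + k * N))"
      by (intro adjw[OF k]) (use ij in \<open>auto simp: per\<close>)
    then show ?thesis unfolding per .
  qed
  show "ring N ?b" unfolding ring_def using N cn disj adj per[of _ 1] by auto
qed

text \<open>Shorter odd closed walks are excluded by induction. Hence \<open>a\<close> neither
  recurs among the inner bridges \<open>ys\<close> nor crosses one of them: either would split the
  walk into two shorter ones, one of them odd. So the \<open>ys\<close> lie in one gap of
  \<open>a\<close>. After rerouting the ring through \<open>a\<close>, the arc given up merges with
  the neighbours \<open>s1\<close> and \<open>s3\<close> of \<open>a\<close> into a single bridge,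
  which replaces these three and shortens the walk by two.\<close>

lemma K33_odd_walk:
  assumes "bridge_system N bag (set xs)" "closed_walk N xs" "odd (length xs)"
  shows K33_model
proof (rule ccontr)
  assume nK: "\<not> K33_model"
  from assms show False
  proof (induction "length xs" arbitrary: N bag xs rule: less_induct)
    case less
    have r: "ring N bag" and br: "\<And>S. S \<in> set xs \<Longrightarrow> bridge N bag S" and bg: "\<And>S. S \<in> set xs \<Longrightarrow> big N (snd S)"
      and dj: "\<And>S T. S \<in> set xs \<Longrightarrow> T \<in> set xs \<Longrightarrow> S \<noteq> T \<Longrightarrow> fst S \<inter> fst T = {}"
      using less(2) unfolding bridge_system_def by blast+
    have pe: "\<And>S. S \<in> set xs \<Longrightarrow> periodic N (snd S)" using bridge_periodic r br by blast
    have no: False if "set ys \<subseteq> set xs" "closed_walk N ys" "odd (length ys)" "length ys < length xs" for ys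
    proof -
      have "bridge_system N bag (set ys)" using less(2) that(1) unfolding bridge_system_def by blast
      then show False using less(1)[OF that(4)] that(2,3) by blast
    qed
    have walkI: "closed_walk N (x # ys)" if "successively (crosses N) (x # ys @ [x])" for x ys
      using that unfolding closed_walk_def by simp
    have walkI2: "closed_walk N (x # ys)" if "successively (crosses N) (x # ys)" "crosses N (last (x # ys)) x" for x ys
    proof -
      have "successively (crosses N) ((x # ys) @ [x])" unfolding successively_append_iff using that by simp
      then show ?thesis unfolding closed_walk_def by simp
    qed
    have cs: "crosses N S T \<Longrightarrow> S \<in> set xs \<Longrightarrow> T \<in> set xs \<Longrightarrow> crosses N T S" for S T
      unfolding crosses_def using non_overlapping_sym pe by blast
    obtain a zs where xs1: "xs = a # zs" using less(3) unfolding closed_walk_def by (cases xs) auto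
    have "zs \<noteq> []" using less(3) xs1 unfolding closed_walk_def crosses_def by auto
    then obtain s3 zs' where zs: "zs = s3 # zs'" by (cases zs) auto
    have "zs' \<noteq> []" using less(4) xs1 zs by auto
    then obtain ys s1 where zs': "zs' = ys @ [s1]" by (cases zs' rule: rev_cases) auto
    have xs: "xs = a # s3 # ys @ [s1]" using xs1 zs zs' by simp
    have "successively (crosses N) ([a] @ ((s3 # ys @ [s1]) @ [a]))" using less(3) unfolding closed_walk_def xs by simp
    then have w: "crosses N a s3" "successively (crosses N) (s3 # ys @ [s1])" "crosses N s1 a"
      unfolding successively_append_iff by simp_all
    have ev: "even (length ys)" using less(4) xs by simp
    have in_xs: "a \<in> set xs" "s3 \<in> set xs" "s1 \<in> set xs" and sub: "set ys \<subseteq> set xs" using xs by auto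
    show False
    proof (cases "ys = []")
      case True
      have c: "crosses N s3 s1" "crosses N a s1" using w True cs in_xs by auto
      have "triple N bag a s3 s1" unfolding triple_def using r br in_xs dj w(1) c unfolding crosses_def by auto
      then have K33_model
        by (rule K33_triangle) (use bg in_xs w(1) c in \<open>auto simp: crosses_def\<close>)
      then show False using nK by blast
    next
      case False
      have y_a: "y \<noteq> a \<and> non_overlapping N (snd a) (snd y)" if y: "y \<in> set ys" for y
      proof -
        obtain p q where pq: "ys = p @ y # q" using split_list[OF y] by blast
        have s: "successively (crosses N) (s3 # p @ [y])" "successively (crosses N) (y # q @ [s1])"
          using w(2) successively_split[of "crosses N" "s3 # p" y "q @ [s1]"] unfolding pq by simp_all
        have par: "odd (length p + length q)" "length p + length q + 1 = length ys" using ev pq by auto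
        have "y \<noteq> a"
        proof
          assume ya: "y = a"
          have w1: "closed_walk N (a # s3 # p)" by (rule walkI) (use w s ya in \<open>simp add: successively_append_iff successively_Cons\<close>)
          have w2: "closed_walk N (a # q @ [s1])" by (rule walkI2) (use w s ya in simp_all)
          show False using no[OF _ w1] no[OF _ w2] par sub pq xs by (auto simp del: One_nat_def)
        qed
        moreover have "\<not> crosses N a y"
        proof
          assume ay: "crosses N a y"
          have ya: "crosses N y a" using cs[OF ay] in_xs sub y by blast
          have w1: "closed_walk N (a # s3 # p @ [y])" by (rule walkI2) (use w s ya in simp_all)
          have w2: "closed_walk N (a # y # q @ [s1])" by (rule walkI2) (use w s ay in simp_all)
          show False using no[OF _ w1] no[OF _ w2] par sub pq xs by (auto simp del: One_nat_def)
        qed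
        ultimately show ?thesis unfolding crosses_def by auto
      qed
      have s1y: "s1 \<notin> set ys"
      proof
        assume y: "s1 \<in> set ys"
        obtain p q where pq: "ys = p @ s1 # q" using split_list[OF y] by blast
        have s: "successively (crosses N) (s3 # p @ [s1])" "successively (crosses N) (s1 # q @ [s1])"
          using w(2) successively_split[of "crosses N" "s3 # p" s1 "q @ [s1]"] unfolding pq by simp_all
        have w1: "closed_walk N (s1 # q)" by (rule walkI) (use s in simp)
        have w2: "closed_walk N (a # s3 # p @ [s1])" by (rule walkI2) (use w s in simp_all)
        show False using no[OF _ w1] no[OF _ w2] ev pq xs by auto
      qed
      have s3y: "s3 \<notin> set ys"
      proof
        assume y: "s3 \<in> set ys"
        obtain p q where pq: "ys = p @ s3 # q" using split_list[OF y] by blast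
        have s: "successively (crosses N) (s3 # p @ [s3])" "successively (crosses N) (s3 # q @ [s1])"
          using w(2) successively_split[of "crosses N" "s3 # p" s3 "q @ [s1]"] unfolding pq by simp_all
        have w1: "closed_walk N (s3 # p)" by (rule walkI) (use s in simp)
        have w2: "closed_walk N (a # s3 # q @ [s1])" by (rule walkI2) (use w s in simp_all)
        show False using no[OF _ w1] no[OF _ w2] ev pq xs by auto
      qed
      obtain y0 ys' where ys: "ys = y0 # ys'" using False by (cases ys) auto
      have "successively (crosses N) ([s3] @ (ys @ [s1]))" using w(2) by simp
      then have wys: "successively (crosses N) ys" and wys': "crosses N s3 (hd ys)" "crosses N (last ys) s1"
        unfolding successively_append_iff using False by simp_all
      have yx: "y \<in> set xs" if "y \<in> set ys" for y using that sub by blast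
      note pa = pe[OF in_xs(1)] and ba = bg[OF in_xs(1)]
      obtain c' c where g: "gap (snd a) c' c" and y0: "\<And>i. c < i \<Longrightarrow> i < c' + N \<Longrightarrow> i \<notin> snd y0"
        using non_overlapping_gap[OF pa ba bg] y_a[of y0] yx ys by (metis list.set_intros(1))
      have cN: "c + 1 < c' + N" using gap_le[OF ba g] .
      have cc: "c' < c" "c' \<in> snd a" "c \<in> snd a" "\<forall>i. c' < i \<and> i < c \<longrightarrow> i \<notin> snd a" using g unfolding gap_def by auto
      \<comment> \<open>Consecutive inner bridges cross each other but not \<open>a\<close>, so
        avoiding the arc given up is inherited along \<open>ys\<close>.\<close>
      have "\<forall>y\<in>set (y # l). \<forall>i. c < i \<and> i < c' + N \<longrightarrow> i \<notin> snd y"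
        if "successively (crosses N) (y # l)" "set (y # l) \<subseteq> set ys" "\<forall>i. c < i \<and> i < c' + N \<longrightarrow> i \<notin> snd y" for y l
        using that
      proof (induction l arbitrary: y)
        case (Cons z l)
        have z: "z \<in> set ys" "crosses N y z" using Cons.prems by auto
        have zy: "crosses N z y" using cs[OF z(2)] yx z(1) Cons.prems(2) by auto
        have "\<forall>i. c < i \<and> i < c' + N \<longrightarrow> i \<notin> snd z"
          using non_overlapping_propagate[OF pa ba _ pe bg g, of "snd y" z] Cons.prems(3) yx[OF z(1)] y_a[OF z(1)] zy unfolding crosses_def by blast
        then have "\<forall>y\<in>set (z # l). \<forall>i. c < i \<and> i < c' + N \<longrightarrow> i \<notin> snd y"
          by (intro Cons.IH) (use Cons.prems in simp_all)
        then show ?case using Cons.prems(3) by simp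
      qed simp
      moreover have "successively (crosses N) (y0 # ys')" using wys unfolding ys .
      ultimately have yw: "i \<notin> snd y" if "y \<in> set ys" "c < i" "i < c' + N" for y i using ys y0 that by blast
      have sw: "\<exists>i. c < i \<and> i < c' + N \<and> i \<in> snd s" if "crosses N a s" for s
        using overlapD[of N "snd a" "snd s" c' c] that cc cN unfolding crosses_def by auto
      obtain i1 where i1: "c < i1" "i1 < c' + N" "i1 \<in> snd s1" using sw cs[OF w(3)] in_xs by blast
      obtain i3 where i3: "c < i3" "i3 < c' + N" "i3 \<in> snd s3" using sw w(1) by blast
      note rr = ring_reroute[OF r br[OF in_xs(1)] g cN]
      let ?b = "reroute N bag (fst a) c' c"
      let ?A = "arc bag (c + 1) (c' + N - 1)"
      define B where "B = ?A \<union> \<Union>{fst s1, fst s3}"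
      \<comment> \<open>Known feet of the new bridge \<open>B\<close>: the ends \<open>c'\<close>
        and \<open>c\<close> of the part kept, the bag \<open>c + 1\<close> that now holds
        \<open>a\<close>, and the old feet of \<open>s1\<close> and \<open>s3\<close> on the part
        kept. The first three already make \<open>X\<close> big; \<open>k\<close> makes it
        periodic.\<close>
      define X where "X = {i. \<exists>k. i + k * N = c' \<or> i + k * N = c \<or> i + k * N = c + 1 \<or>
         c' \<le> i + k * N \<and> i + k * N \<le> c \<and> (i \<in> snd s1 \<or> i \<in> snd s3)}"
      have a1: "adj (fst s1) ?A" by (rule adj_mono[OF bridgeD(3)[OF br[OF in_xs(3)] i1(3)]]) (use bag_subset_arc[of "c + 1" i1 "c' + N - 1" bag] i1 in simp_all)
      have a3: "adj (fst s3) ?A" by (rule adj_mono[OF bridgeD(3)[OF br[OF in_xs(2)] i3(3)]]) (use bag_subset_arc[of "c + 1" i3 "c' + N - 1" bag] i3 in simp_all)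
      have Ane: "?A \<noteq> {}" using a1 unfolding adj_def by blast
      have cB: "conn B" unfolding B_def
        by (rule conn_star[OF arc_conn[OF r] Ane]) (use bridgeD(1)[OF br[OF in_xs(2)]] bridgeD(1)[OF br[OF in_xs(3)]] adj_sym[OF a1] adj_sym[OF a3] cc in auto)
      have arcY: "fst S \<inter> ?A = {}" if "S \<in> set xs" for S unfolding arc_def using bridgeD(2)[OF br[OF that]] by blast
      have bN: "?b (i + k * N) = ?b i" for i k using bag_mult[OF rr(1)] .
      have pX: "periodic N X"
      proof -
        have "i + N \<in> X \<longleftrightarrow> i \<in> X" for i
        proof
          assume "i + N \<in> X"
          then obtain k where "i + (k + 1) * N = c' \<or> i + (k + 1) * N = c \<or> i + (k + 1) * N = c + 1 \<or>
            c' \<le> i + (k + 1) * N \<and> i + (k + 1) * N \<le> c \<and> (i \<in> snd s1 \<or> i \<in> snd s3)"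
            unfolding X_def using periodicD(1) pe in_xs by (auto simp: algebra_simps)
          then show "i \<in> X" unfolding X_def by blast
        next
          assume "i \<in> X"
          then obtain k where "i + N + (k - 1) * N = c' \<or> i + N + (k - 1) * N = c \<or> i + N + (k - 1) * N = c + 1 \<or>
            c' \<le> i + N + (k - 1) * N \<and> i + N + (k - 1) * N \<le> c \<and> (i + N \<in> snd s1 \<or> i + N \<in> snd s3)"
            unfolding X_def using periodicD(1) pe in_xs by (auto simp: algebra_simps)
          then show "i + N \<in> X" unfolding X_def by blast
        qed
        then show ?thesis unfolding periodic_def using ringD(1)[OF r] by blast
      qed
      have XI: "c' \<in> X" "c \<in> X" "c + 1 \<in> X" "\<And>i. c' \<le> i \<Longrightarrow> i \<le> c \<Longrightarrow> i \<in> snd s1 \<or> i \<in> snd s3 \<Longrightarrow> i \<in> X"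
        unfolding X_def by (rule CollectI, rule exI[of _ 0], simp)+
      have bgX: "big N X" by (rule bigI[OF pX XI(1,2,3)]) (use cc cN in auto)
      have Bb: "B \<inter> ?b i = {}" for i
      proof -
        obtain k where k: "c' \<le> i + k * N" "i + k * N < c' + N" using shift_window[OF ringD(1)[OF r]] .
        have "B \<inter> ?b j = {}" if "c' \<le> j" "j < c' + N" for j
        proof -
          consider "j \<le> c" | "j = c + 1" | "c + 1 < j" by linarith
          then show ?thesis
          proof cases
            case 1
            have "?A \<inter> bag j = {}" using arc_disj[OF r, of j "c + 1" "c' + N - 1" j] that 1 unfolding arc_def by auto
            moreover have "fst s1 \<inter> bag j = {}" "fst s3 \<inter> bag j = {}" using bridgeD(2)[OF br] in_xs by blast+
            ultimately show ?thesis using rr(2)[OF that(1) 1] unfolding B_def by auto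
          next
            case 2
            have "fst s1 \<inter> fst a = {}" "fst s3 \<inter> fst a = {}" using dj in_xs w unfolding crosses_def by blast+
            then show ?thesis using rr(3) arcY[OF in_xs(1)] 2 unfolding B_def by auto
          next
            case 3
            have "(j - c') mod N = j - c'" using that by simp
            then show ?thesis unfolding reroute_def Let_def using 3 by simp
          qed
        qed
        then show ?thesis using k bN[of i k] by metis
      qed
      have aB: "adj B (?b i)" if "i \<in> X" for i
      proof -
        obtain k where k: "i + k * N = c' \<or> i + k * N = c \<or> i + k * N = c + 1 \<or>
         c' \<le> i + k * N \<and> i + k * N \<le> c \<and> (i \<in> snd s1 \<or> i \<in> snd s3)" using \<open>i \<in> X\<close> unfolding X_def by blast
        define j where "j = i + k * N"
        have bj: "?b i = ?b j" unfolding j_def bN ..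
        have jm: "j \<in> snd s1 \<longleftrightarrow> i \<in> snd s1" "j \<in> snd s3 \<longleftrightarrow> i \<in> snd s3" unfolding j_def using periodic_mult pe in_xs by blast+
        have ne: "bag c' \<noteq> {}" "bag c \<noteq> {}" "fst a \<noteq> {}" using bridgeD(3)[OF br[OF in_xs(1)]] cc unfolding adj_def by blast+
        have sA: "?A \<subseteq> B" "fst s1 \<subseteq> B" "fst s3 \<subseteq> B" unfolding B_def by auto
        consider "j = c'" | "j = c" | "j = c + 1" | "c' \<le> j" "j \<le> c" "j \<in> snd s1" | "c' \<le> j" "j \<le> c" "j \<in> snd s3"
          using k jm unfolding j_def by blast
        then have "adj B (?b j)"
        proof cases
          case 1
          have "adj ?A (arc bag (c' + N - 1 + 1) (c' + N))"
            by (rule arc_adj[OF r Ane]) (use ne cc ringD(2)[OF r] in \<open>auto simp: arc_def\<close>)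
          then have "adj ?A (bag c')" unfolding arc_def using ringD(2)[OF r] by simp
          then show ?thesis using adj_mono[OF _ sA(1) subset_refl] rr(2)[of c'] cc 1 by simp
        next
          case 2
          have "adj (arc bag c c) ?A"
            by (rule arc_adj[OF r]) (use ne cc Ane in \<open>auto simp: arc_def\<close>)
          then have "adj ?A (bag c)" using adj_sym unfolding arc_def by simp
          then show ?thesis using adj_mono[OF _ sA(1) subset_refl] rr(2)[of c] cc 2 by simp
        next
          case 3
          \<comment> \<open>The bag at \<open>c + 1\<close> is reached because \<open>a\<close> has
            a third foot, strictly inside the arc given up.\<close>
          obtain t where t: "t \<in> snd a" "c < t" "t < c' + N" using gap_lt[OF ba g] .
          have "adj (bag t) (fst a)" using bridgeD(3)[OF br[OF in_xs(1)] t(1)] adj_sym by blast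
          moreover have "bag t \<subseteq> B" using bag_subset_arc[of "c + 1" t "c' + N - 1" bag] t sA(1) by auto
          ultimately show ?thesis using adj_mono rr(3) 3 by blast
        next
          case 4
          then show ?thesis using adj_mono[OF bridgeD(3)[OF br[OF in_xs(3)]] sA(2) subset_refl] rr(2) by simp
        next
          case 5
          then show ?thesis using adj_mono[OF bridgeD(3)[OF br[OF in_xs(2)]] sA(3) subset_refl] rr(2) by simp
        qed
        then show ?thesis unfolding bj .
      qed
      have brB: "bridge N ?b (B, X)" unfolding bridge_def using cB Bb aB periodicD(1)[OF pX] by auto
      have bry: "bridge N ?b y" if y: "y \<in> set ys" for y
      proof -
        note by' = br[OF yx[OF y]]
        have "fst y \<inter> fst a = {}" using dj[OF yx[OF y] in_xs(1)] y_a[OF y] by blast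
        then have "fst y \<inter> ?b i = {}" for i unfolding reroute_def Let_def using bridgeD(2)[OF by'] by auto
        moreover have "adj (fst y) (?b i)" if i: "i \<in> snd y" for i
        proof -
          obtain k where k: "c' \<le> i + k * N" "i + k * N < c' + N" using shift_window[OF ringD(1)[OF r]] .
          have m: "i + k * N \<in> snd y" using i periodic_mult[OF pe[OF yx[OF y]]] by blast
          then have "i + k * N \<le> c" using yw[OF y] k by force
          then have "?b i = bag i" using rr(2)[OF k(1)] bN[of i k] bag_mult[OF r, of i k] by simp
          then show ?thesis using bridgeD(3)[OF by' i] by simp
        qed
        ultimately show ?thesis using bridgeD(1,4)[OF by'] unfolding bridge_def by auto
      qed
      have dB: "fst y \<inter> B = {}" if y: "y \<in> set ys" for y
      proof -
        have "y \<noteq> s1" "y \<noteq> s3" using y s1y s3y by blast+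
        then have "fst y \<inter> fst s1 = {}" "fst y \<inter> fst s3 = {}" using dj yx[OF y] in_xs by blast+
        then show ?thesis using arcY[OF yx[OF y]] unfolding B_def by auto
      qed
      have neB: "y \<noteq> (B, X)" if y: "y \<in> set ys" for y
        using dB[OF y] Ane unfolding B_def by auto
      have sys: "bridge_system N ?b (set ((B, X) # ys))"
        unfolding bridge_system_def using rr(1) brB bry bgX bg yx dB dj by (auto simp: Int_commute)
      \<comment> \<open>The new bridge inherits the crossings of \<open>s1\<close> and
        \<open>s3\<close> with inner bridges. Cuts between \<open>X\<close> and \<open>y\<close>
        must lie, up to a period, between \<open>c'\<close> and \<open>c\<close>, as both belong to
        \<open>X\<close>. On that part \<open>X\<close> contains the feet of \<open>s\<close>, so
        the same cuts would separate \<open>s\<close> from \<open>y\<close>.\<close>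
      have nX: "\<not> non_overlapping N X (snd y)" if y: "y \<in> set ys" and s: "s = s1 \<or> s = s3" "crosses N s y" for s y
      proof
        assume "non_overlapping N X (snd y)"
        then obtain p q where pq: "p \<le> q" "q \<le> p + N" "\<forall>i. p < i \<and> i < q \<longrightarrow> i \<notin> X" "\<forall>i. q < i \<and> i < p + N \<longrightarrow> i \<notin> snd y"
          unfolding non_overlapping_def by blast
        obtain e where e: "e \<in> snd y" "p < e" "e < q" using non_overlapping_inside[OF bg[OF yx[OF y]] pq(1,2,4)] .
        obtain k where k: "c' \<le> e + k * N" "e + k * N < c' + N" using shift_window[OF ringD(1)[OF r]] .
        have py: "i + k * N \<in> snd y \<longleftrightarrow> i \<in> snd y" for i k using periodic_mult[OF pe[OF yx[OF y]]] by blast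
        have ec: "e + k * N \<le> c" using yw[OF y, of "e + k * N"] py e k by force
        have pX': "i + k * N \<notin> X" if "p < i" "i < q" for i using pq(3) that periodic_mult[OF pX] by blast
        have "c' \<le> p + k * N"
        proof (rule ccontr)
          assume "\<not> ?thesis"
          then show False using pX'[of "c' - k * N"] XI(1) k(1) e by simp
        qed
        moreover have "q + k * N \<le> c"
        proof (rule ccontr)
          assume "\<not> ?thesis"
          then show False using pX'[of "c - k * N"] XI(2) ec e by simp
        qed
        ultimately have cq: "c' \<le> p + k * N" "q + k * N \<le> c" by auto
        have "i \<notin> snd s" if "p + k * N < i" "i < q + k * N" for i
          using pX'[of "i - k * N"] XI(4)[of i] cq that s(1) by auto
        moreover have "i \<notin> snd y" if "q + k * N < i" "i < p + k * N + N" for i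
          using pq(4)[rule_format, of "i - k * N"] py[of "i - k * N" k] that by auto
        ultimately have "non_overlapping N (snd s) (snd y)"
          unfolding non_overlapping_def using pq(1,2) by (intro exI[of _ "p + k * N"] exI[of _ "q + k * N"]) auto
        then show False using s(2) unfolding crosses_def by blast
      qed
      have l: "last ys \<in> set ys" "y0 \<in> set ys" using ys by auto
      have w0: "crosses N s3 y0" "successively (crosses N) ys" "crosses N (last ys) s1"
        using wys wys' ys by simp_all
      have x0: "crosses N (B, X) y0" unfolding crosses_def using nX[OF l(2) _ w0(1)] neB[OF l(2)] by auto
      have "\<not> non_overlapping N X (snd (last ys))" using nX[OF l(1) _ cs[OF w0(3) yx[OF l(1)] in_xs(3)]] by blast
      then have xl: "crosses N (last ys) (B, X)"
        unfolding crosses_def using neB[OF l(1)] non_overlapping_sym[OF pe[OF yx[OF l(1)]], of X] by auto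
      have "closed_walk N ((B, X) # ys)"
        by (rule walkI2) (use w0(2) x0 xl ys in simp_all)
      then show False using less(1)[OF _ sys] ev xs by auto
    qed
  qed
qed

end

section \<open>Discharging\<close>

text \<open>
  \<open>P K i\<close> says that the bridge \<open>K\<close> has a foot at position \<open>i\<close>, and \<open>sd\<close> gives its side. The assumptions \<open>nc\<close> and
  \<open>nsub\<close> express that bridges on one side do not overlap, while \<open>m0\<close>, \<open>m2\<close>, \<open>m3\<close>, \<open>m4l\<close> and \<open>m4r\<close> say that exchanging
  one, two, three or four segments of the longest circuit does not lengthen it.
\<close>

locale cycle_bridges =
  fixes n :: int and W :: "'w set" and P :: "'w \<Rightarrow> int \<Rightarrow> bool" and sd :: "'w \<Rightarrow> bool"
  assumes n_pos: "0 < n"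
    and fin: "finite W"
    and per: "P K (i + n) \<longleftrightarrow> P K i"
    and cov: "\<exists>K\<in>W. P K i"
    and card3: "K \<in> W \<Longrightarrow> 3 \<le> card {i \<in> {0..<n}. P K i}"
    and nc: "\<lbrakk>K \<in> W; L \<in> W; K \<noteq> L; sd K = sd L; P K a; P K b; \<forall>i. a < i \<and> i < b \<longrightarrow> \<not> P K i;
        P L x; a < x; x < b; P L y; a \<le> y; y < a + n\<rbrakk> \<Longrightarrow> y \<le> b"
    and nsub: "\<lbrakk>K \<in> W; L \<in> W; K \<noteq> L; sd K = sd L\<rbrakk> \<Longrightarrow> \<exists>x. P L x \<and> \<not> P K x"
    and m0: "K \<in> W \<Longrightarrow> P K i \<Longrightarrow> \<not> P K (i + 1)"
    and m2: "\<lbrakk>K \<in> W; L \<in> W; K \<noteq> L; u1 < v1; v1 \<le> u2; u2 < v2; v2 \<le> u1 + n;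
        P K u1; P K u2; P L v1; P L v2\<rbrakk> \<Longrightarrow> 4 \<le> (v1 - u1) + (v2 - u2)"
    and m3: "\<lbrakk>K \<in> W; L \<in> W; M \<in> W; K \<noteq> L; K \<noteq> M; L \<noteq> M; u1 < v1; v1 \<le> u2; u2 < v2; v2 \<le> u3; u3 < v3;
        v3 \<le> u1 + n; P K u1; P K v2; P L v1; P L v3; P M u2; P M u3\<rbrakk>
        \<Longrightarrow> 6 \<le> (v1 - u1) + (v2 - u2) + (v3 - u3)"
    and m4l: "\<lbrakk>K \<in> W; L \<in> W; L' \<in> W; M \<in> W; distinct [K, L, L', M]; P M (p - 1); P M (p + 1); P K p; P K (p + 4);
        P L (p + 2); P L' (p + 3); P L' y; P L (y + 3); p + 4 \<le> y; y + 4 \<le> p + n\<rbrakk> \<Longrightarrow> False"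
    and m4r: "\<lbrakk>K \<in> W; L \<in> W; L' \<in> W; M \<in> W; distinct [K, L, L', M]; P M (p + 3); P M (p + 5); P K p; P K (p + 4);
        P L (p + 1); P L' (p + 2); P L' y; P L (y + 3); p + 5 \<le> y; y + 3 \<le> p + n\<rbrakk> \<Longrightarrow> False"
begin

section \<open>Feet and gaps of a single bridge\<close>

lemma per_nat: "P K (i + int k * n) \<longleftrightarrow> P K i"
proof (induction k)
  case (Suc k)
  have "i + int (Suc k) * n = (i + int k * n) + n" by (simp add: algebra_simps)
  then show ?case by (simp only: per Suc)
qed simp

lemma per_mult: "P K (i + k * n) \<longleftrightarrow> P K i"
proof (cases "k \<ge> 0")
  case True then show ?thesis using per_nat[of K i "nat k"] by simp
next
  case False
  then show ?thesis using per_nat[of K "i + k * n" "nat (- k)"] by simp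
qed

lemma per_sub: "P K (i - n) \<longleftrightarrow> P K i"
  using per[of K "i - n"] by simp

lemma per_mod: "P K (i mod n) \<longleftrightarrow> P K i"
proof -
  have "i mod n + (i div n) * n = i" by simp
  then show ?thesis using per_mult[of K "i mod n" "i div n"] by simp
qed

lemma win_eq: "a + (x - a) mod n = x + (- ((x - a) div n)) * n"
  by (simp add: minus_div_mult_eq_mod[symmetric] algebra_simps)

definition feet :: "'w \<Rightarrow> int set" where "feet K = {i \<in> {0..<n}. P K i}"

lemma finite_feet: "finite (feet K)" unfolding feet_def by (rule finite_subset[of _ "{0..<n}"]) auto

lemma card_window: "card {i \<in> {a..<a + n}. P K i} = card (feet K)"
proof -
  let ?f = "\<lambda>x. a + (x - a) mod n"
  have "inj_on ?f (feet K)"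
  proof (rule inj_onI)
    fix x y assume xy: "x \<in> feet K" "y \<in> feet K" "?f x = ?f y"
    then have "(x - a) mod n = (y - a) mod n" by simp
    then have "(x - a + a) mod n = (y - a + a) mod n" by (rule mod_add_cong) simp
    then have "x mod n = y mod n" by simp
    then show "x = y" using xy unfolding feet_def by simp
  qed
  moreover have "?f ` feet K = {i \<in> {a..<a + n}. P K i}"
  proof (intro set_eqI iffI)
    fix i assume "i \<in> ?f ` feet K"
    then obtain x where x: "x \<in> feet K" "i = a + (x - a) mod n" by auto
    have "a + (x - a) mod n = x + (- ((x - a) div n)) * n"
      by (rule win_eq)
    then have "P K i" using x per_mult[of K x "- ((x - a) div n)"] unfolding feet_def by simp
    then show "i \<in> {i \<in> {a..<a + n}. P K i}" using x n_pos by simp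
  next
    fix i assume i: "i \<in> {i \<in> {a..<a + n}. P K i}"
    have "i mod n \<in> feet K" using i n_pos per_mod unfolding feet_def by auto
    moreover have "i = ?f (i mod n)"
    proof -
      have "(i mod n - a) mod n = (i - a) mod n" by (simp add: mod_diff_left_eq)
      also have "\<dots> = i - a" using i by simp
      finally show ?thesis by simp
    qed
    ultimately show "i \<in> ?f ` feet K" by blast
  qed
  ultimately show ?thesis using card_image[of ?f "feet K"] by simp
qed

lemma three:
  assumes "K \<in> W" "P K a"
  obtains b c where "a < b" "b < c" "c < a + n" "P K b" "P K c"
proof -
  let ?S = "{i \<in> {a..<a + n}. P K i}"
  have "3 \<le> card ?S" using card_window card3 assms(1) unfolding feet_def by simp
  moreover have fS: "finite ?S" by (rule finite_subset[of _ "{a..<a + n}"]) auto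
  moreover have aS: "a \<in> ?S" using assms n_pos by auto
  ultimately have c0: "2 \<le> card (?S - {a})" by simp
  then have c2: "\<not> card (?S - {a}) \<le> Suc 0" by simp
  have "\<not> (\<forall>x\<in>?S - {a}. \<forall>y\<in>?S - {a}. x = y)"
    using c2 card_le_Suc0_iff_eq[of "?S - {a}"] fS by blast
  then obtain x y where xy: "x \<in> ?S - {a}" "y \<in> ?S - {a}" "x \<noteq> y" by blast
  have x: "a < x" "x < a + n" "P K x" and y: "a < y" "y < a + n" "P K y" using xy by auto
  show ?thesis
    using that[OF x(1) _ y(2) x(3) y(3)] that[OF y(1) _ x(2) y(3) x(3)] xy(3) by linarith
qed

definition cons where "cons K a b \<longleftrightarrow> a < b \<and> P K a \<and> P K b \<and> (\<forall>i. a < i \<and> i < b \<longrightarrow> \<not> P K i)"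

definition cn where "cn K a = Min {i \<in> {a<..a + n}. P K i}"

lemma consD: "cons K a b \<Longrightarrow> a < b" "cons K a b \<Longrightarrow> P K a" "cons K a b \<Longrightarrow> P K b"
  "cons K a b \<Longrightarrow> a < i \<Longrightarrow> i < b \<Longrightarrow> \<not> P K i"
  unfolding cons_def by auto

lemma cn_cons: assumes "P K a" shows "cons K a (cn K a)" "cn K a \<le> a + n"
proof -
  let ?S = "{i \<in> {a<..a + n}. P K i}"
  have f: "finite ?S" by (rule finite_subset[of _ "{a<..a + n}"]) auto
  have ne: "a + n \<in> ?S" using assms per n_pos by auto
  have m: "cn K a \<in> ?S" unfolding cn_def using Min_in[OF f] ne by blast
  then show "cn K a \<le> a + n" by auto
  have "\<not> P K i" if i: "a < i" "i < cn K a" for i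
  proof
    assume "P K i"
    then have "i \<in> ?S" using i m by auto
    then have "cn K a \<le> i" unfolding cn_def using Min_le[OF f] by blast
    then show False using i by simp
  qed
  then show "cons K a (cn K a)" unfolding cons_def using m assms by auto
qed

lemma cons_uniq: "cons K a b \<Longrightarrow> cons K a c \<Longrightarrow> b = c"
  unfolding cons_def using linorder_less_linear[of b c] by blast

lemma cons_shift: "cons K (a + n) (b + n) \<longleftrightarrow> cons K a b"
proof -
  have "(\<forall>i. a + n < i \<and> i < b + n \<longrightarrow> \<not> P K i) \<longleftrightarrow> (\<forall>i. a < i \<and> i < b \<longrightarrow> \<not> P K i)"
  proof (intro iffI allI impI)
    fix i assume "\<forall>i. a + n < i \<and> i < b + n \<longrightarrow> \<not> P K i" "a < i \<and> i < b"
    then have "\<not> P K (i + n)" by simp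
    then show "\<not> P K i" using per by blast
  next
    fix i assume "\<forall>i. a < i \<and> i < b \<longrightarrow> \<not> P K i" "a + n < i \<and> i < b + n"
    then have "\<not> P K (i - n)" by simp
    then show "\<not> P K i" using per_sub by blast
  qed
  then show ?thesis unfolding cons_def using per by auto
qed

lemma cons_ge2: assumes "K \<in> W" "cons K a b" shows "a + 2 \<le> b"
proof -
  have "b \<noteq> a + 1" using m0[OF assms(1)] consD(2,3)[OF assms(2)] by blast
  then show ?thesis using consD(1)[OF assms(2)] by simp
qed

lemma gap_around:
  assumes "K \<in> W" "\<not> P K x"
  obtains c d where "cons K c d" "c < x" "x < d"
proof -
  let ?S = "{i \<in> {x - n..<x}. P K i}"
  have f: "finite ?S" by (rule finite_subset[of _ "{x - n..<x}"]) auto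
  have "card ?S = card (feet K)" using card_window[of "x - n" K] by simp
  then have "0 < card ?S" using card3[OF assms(1)] unfolding feet_def by linarith
  then have "?S \<noteq> {}" by (metis card.empty less_irrefl)
  then have M: "Max ?S \<in> ?S" using Max_in[OF f] by blast
  let ?c = "Max ?S"
  have c: "cons K ?c (cn K ?c)" using M cn_cons by simp
  have "x < cn K ?c"
  proof (rule ccontr)
    assume "\<not> x < cn K ?c"
    moreover have "cn K ?c \<noteq> x" using consD(3)[OF c] assms(2) by metis
    ultimately have "cn K ?c < x" by simp
    then have "cn K ?c \<in> ?S" using consD(1,3)[OF c] M by auto
    then show False using Max_ge[OF f, of "cn K ?c"] consD(1)[OF c] by linarith
  qed
  then show ?thesis using that c M by auto
qed

text \<open>A foot of \<open>L\<close> strictly inside the gap is the case \<open>nc\<close>.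
  Otherwise \<open>a\<close> and \<open>b\<close> are the two feet of \<open>L\<close>, and by
  \<open>nsub\<close> a further foot \<open>w\<close> of \<open>L\<close> lies in another gap of
  \<open>K\<close>. Applied to that gap, \<open>nc\<close> forces it to run from \<open>b\<close> to
  \<open>a + n\<close>, which leaves \<open>K\<close> with two feet only.\<close>

lemma two_in:
  assumes "K \<in> W" "L \<in> W" "K \<noteq> L" "sd K = sd L" "cons K a b"
    and "P L x" "P L y" "a \<le> x" "x < y" "y \<le> b" "P L z" "a \<le> z" "z < a + n"
  shows "z \<le> b"
proof (rule ccontr)
  assume zb: "\<not> z \<le> b"
  have strict: "\<not> (a < w \<and> w < b \<and> P L w)" for w
    using nc[OF assms(1-4) consD(2,3)[OF assms(5)] _ _ _ _ assms(11-13)] zb assms(5) unfolding cons_def by blast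
  then have xa: "x = a" and yb: "y = b" using strict[of x] strict[of y] assms(6-10) by linarith+
  obtain x0 where x0: "P L x0" "\<not> P K x0" using nsub[OF assms(1-4)] by blast
  define w where "w = a + (x0 - a) mod n"
  have w: "a \<le> w" "w < a + n" unfolding w_def using n_pos by auto
  have we: "w = x0 + (- ((x0 - a) div n)) * n" unfolding w_def by (rule win_eq)
  have Pw: "P L w" "\<not> P K w" unfolding we using x0 per_mult by blast+
  obtain c d where cd: "cons K c d" "c < w" "w < d" using gap_around[OF assms(1) Pw(2)] by blast
  have Pa: "P K a" "P K b" "P K (a + n)" using assms(5) per unfolding cons_def by auto
  have "w \<noteq> a" using Pa Pw by auto
  then have ac: "a \<le> c" using cd(2,3) Pa(1) w consD(4)[OF cd(1), of a] by linarith
  have da: "d \<le> a + n" using cd(2,3) Pa(3) w consD(4)[OF cd(1), of "a + n"] by linarith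
  have "c \<noteq> a"
  proof
    assume "c = a"
    then have "d = b" using cons_uniq cd(1) assms(5) by blast
    then show False using strict[of w] Pw cd \<open>c = a\<close> by auto
  qed
  then have ac': "a < c" using ac by simp
  have bc: "b \<le> c" using consD(4)[OF assms(5), of c] consD(2)[OF cd(1)] ac' by linarith
  have i: "\<forall>i. c < i \<and> i < d \<longrightarrow> \<not> P K i" using cd(1) unfolding cons_def by blast
  have "P L (a + n)" using xa assms(6) per by simp
  then have "a + n \<le> d"
    using nc[OF assms(1-4) consD(2,3)[OF cd(1)] i Pw(1) cd(2,3), of "a + n"] da ac' cd w by linarith
  then have d: "d = a + n" using da by simp
  have cb: "c = b"
  proof (rule ccontr)
    assume "c \<noteq> b"
    then have "b < c" using bc by simp
    moreover have "P L (b + n)" using yb assms(7) per by simp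
    moreover have "c < b + n" using cd w consD(1)[OF assms(5)] by linarith
    ultimately have "b + n \<le> d"
      using nc[OF assms(1-4) consD(2,3)[OF cd(1)] i Pw(1) cd(2,3), of "b + n"] by linarith
    then show False using d consD(1)[OF assms(5)] by simp
  qed
  obtain p q where pq: "a < p" "p < q" "q < a + n" "P K p" "P K q" using three[OF assms(1) Pa(1)] by blast
  have "p = b" using consD(4)[OF assms(5), of p] consD(4)[OF cd(1), of p] pq d cb by linarith
  moreover have "q = b" using consD(4)[OF assms(5), of q] consD(4)[OF cd(1), of q] pq d cb by linarith
  ultimately show False using pq by simp
qed


section \<open>Leaves, requests and payments\<close>

definition att :: "bool \<Rightarrow> int \<Rightarrow> bool" where "att s i \<longleftrightarrow> (\<exists>L\<in>W. sd L = s \<and> P L i)"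

definition leaf :: "bool \<Rightarrow> 'w \<Rightarrow> int \<Rightarrow> int \<Rightarrow> bool" where
  "leaf s K a l \<longleftrightarrow> K \<in> W \<and> sd K = s \<and> 1 \<le> l \<and> P K a \<and> P K (a + l + 1) \<and>
     (\<forall>i. a < i \<and> i \<le> a + l \<longrightarrow> \<not> att s i)"

text \<open>
  A leaf \<open>(K, a, l)\<close> is a face with a single corner, which has \<open>l\<close> vertices of the circuit between its two feet and
  hence owns \<open>l + 1\<close> edges. It has charge \<open>4 - (l + 1)\<close>, which it passes to the faces on the other side of the
  circuit across the edges \<open>e\<close> with \<open>req\<close>: one unit across each of its two edges for \<open>l = 1\<close> and one across the middle
  edge for \<open>l = 2\<close>. For \<open>l = 3\<close> there is no charge to start with, but a unit received across an end edge is
  passed on across the inner edge next to the other end.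

  What remains positive is paid by vertices of the circuit: at \<open>two\<close>-sided vertices through \<open>iiR\<close> and \<open>iiL\<close>, at the
  \<open>centre\<close> of two adjacent leaves of distinct bridges, and at \<open>pinched\<close> corners, where another bridge of the same side
  separates the corner from the circuit. A pinched corner receives only one unit if it is \<open>relieved\<close>.
\<close>

definition req4 where "req4 s e \<longleftrightarrow> (\<exists>K. leaf s K e 1 \<or> leaf s K (e - 1) 1)"
definition req5 where "req5 s e \<longleftrightarrow> (\<exists>K. leaf s K (e - 1) 2)"
definition req6 where "req6 s e \<longleftrightarrow> (\<exists>K. leaf s K (e - 2) 3 \<and> req4 (\<not> s) (e - 2) \<or>
    leaf s K (e - 1) 3 \<and> req4 (\<not> s) (e + 2))"
definition req where "req s e \<longleftrightarrow> req4 s e \<or> req5 s e \<or> req6 s e"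
definition centre where "centre s v \<longleftrightarrow> (\<exists>K K'. K \<noteq> K' \<and> leaf s K (v - 2) 1 \<and> leaf s K' v 1)"
definition relieved where "relieved K v \<longleftrightarrow> leaf (sd K) K (v - 2) 1 \<and> centre (sd K) v"
definition iiR where "iiR s e \<longleftrightarrow> (\<exists>K. leaf (\<not> s) K e 1) \<and> att s e \<and> att s (e + 1)"
definition iiL where "iiL s e \<longleftrightarrow> (\<exists>K. leaf (\<not> s) K (e - 1) 1) \<and> att s e \<and> att s (e + 1)"
definition pinched where "pinched K v \<longleftrightarrow> (\<exists>L\<in>W. L \<noteq> K \<and> sd L = sd K \<and> P L v \<and> cn L v < cn K v)"

text \<open>What an edge adds to its face on side \<open>s\<close>: the -1 of the charge itself, one
  unit handed over to or received from the other side, and the units paid by vertices, which also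
  lower the sum. The payment for a \<open>centre\<close> is booked on the edge to its left
  only.\<close>

definition edge_weight :: "bool \<Rightarrow> int \<Rightarrow> int" where
  "edge_weight s e = - 1 - of_bool (req s e) + of_bool (req (\<not> s) e) - of_bool (iiR s e) - of_bool (iiL s e)
     - of_bool (centre (\<not> s) (e + 1))"

definition corner_charge :: "'w \<Rightarrow> int \<Rightarrow> int" where
  "corner_charge K v = (if pinched K v then 2 - of_bool (relieved K v) else 0)"

lemma attI: "K \<in> W \<Longrightarrow> P K i \<Longrightarrow> att (sd K) i" unfolding att_def by blast

lemma cov2: "att s i \<or> att (\<not> s) i"
  using cov[of i] unfolding att_def by (cases s) (metis (full_types))+

lemma att_per: "att s (i + n) \<longleftrightarrow> att s i" unfolding att_def using per by blast

lemma leafD: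
  assumes "leaf s K a l"
  shows "K \<in> W" "sd K = s" "1 \<le> l" "P K a" "P K (a + l + 1)" "a < i \<Longrightarrow> i \<le> a + l \<Longrightarrow> \<not> att s i"
    "att s a" "att s (a + l + 1)"
  using assms unfolding leaf_def att_def by blast+

lemma leaf_per: "leaf s K (a + n) l \<longleftrightarrow> leaf s K a l"
proof -
  have "P K (a + n + l + 1) \<longleftrightarrow> P K (a + l + 1)" using per[of K "a + l + 1"] by (simp add: algebra_simps)
  moreover have "(\<forall>i. a + n < i \<and> i \<le> a + n + l \<longrightarrow> \<not> att s i) \<longleftrightarrow> (\<forall>i. a < i \<and> i \<le> a + l \<longrightarrow> \<not> att s i)"
  proof (intro iffI allI impI)
    fix i assume "\<forall>i. a + n < i \<and> i \<le> a + n + l \<longrightarrow> \<not> att s i" "a < i \<and> i \<le> a + l"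
    then have "\<not> att s (i + n)" by simp
    then show "\<not> att s i" using att_per by blast
  next
    fix i assume "\<forall>i. a < i \<and> i \<le> a + l \<longrightarrow> \<not> att s i" "a + n < i \<and> i \<le> a + n + l"
    then have "\<not> att s (i - n)" by simp
    then show "\<not> att s i" using att_per[of s "i - n"] by simp
  qed
  ultimately show ?thesis unfolding leaf_def using per by blast
qed

lemma leaf_per_sub: "leaf s K (a + n - k) l \<longleftrightarrow> leaf s K (a - k) l"
  using leaf_per[of s K "a - k" l] by (simp add: algebra_simps)
lemma req4_per: "req4 s (e + n) \<longleftrightarrow> req4 s e" unfolding req4_def leaf_per leaf_per_sub ..
lemma req5_per: "req5 s (e + n) \<longleftrightarrow> req5 s e" unfolding req5_def leaf_per_sub ..
lemma req6_per: "req6 s (e + n) \<longleftrightarrow> req6 s e"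
  using req4_per[of "\<not> s" "e - 2"] req4_per[of "\<not> s" "e + 2"] unfolding req6_def leaf_per_sub by (simp add: algebra_simps)
lemma req_per: "req s (e + n) \<longleftrightarrow> req s e" unfolding req_def req4_per req5_per req6_per ..
lemma centre_per: "centre s (v + n) \<longleftrightarrow> centre s v" unfolding centre_def leaf_per leaf_per_sub ..
lemma relieved_per: "relieved K (v + n) \<longleftrightarrow> relieved K v" unfolding relieved_def leaf_per_sub centre_per ..
lemma att_per1: "att s (i + n + 1) \<longleftrightarrow> att s (i + 1)" using att_per[of s "i + 1"] by (simp add: algebra_simps)
lemma iiR_per: "iiR s (e + n) \<longleftrightarrow> iiR s e" unfolding iiR_def leaf_per att_per att_per1 ..
lemma iiL_per: "iiL s (e + n) \<longleftrightarrow> iiL s e" unfolding iiL_def leaf_per_sub att_per att_per1 ..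
lemma edge_weight_per: "edge_weight s (e + n) = edge_weight s e"
  using centre_per[of "\<not> s" "e + 1"] unfolding edge_weight_def req_per iiR_per iiL_per by (simp add: algebra_simps)

lemma cn_eq: "cons K a b \<Longrightarrow> cn K a = b"
  using cons_uniq cn_cons(1) consD(2) by blast

lemma cn_per: "P K v \<Longrightarrow> cn K (v + n) = cn K v + n"
  using cn_eq cons_shift cn_cons(1) by blast

lemma corner_charge_per: assumes "P K v" shows "corner_charge K (v + n) = corner_charge K v"
proof -
  have "pinched K (v + n) \<longleftrightarrow> pinched K v" unfolding pinched_def using per cn_per assms by auto
  then show ?thesis unfolding corner_charge_def relieved_per by simp
qed

lemma corner_charge_nonneg: "0 \<le> corner_charge K v" unfolding corner_charge_def by simp

lemma edge_weight_nonpos: "edge_weight s e \<le> 0" unfolding edge_weight_def by (auto simp: of_bool_def)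

lemma edge_weight_le: "\<not> req (\<not> s) e \<Longrightarrow> edge_weight s e \<le> - 1" unfolding edge_weight_def by (auto simp: of_bool_def)

lemma n_ge6: assumes "K \<in> W" "P K a" shows "6 \<le> n"
proof -
  obtain b c where bc: "a < b" "b < c" "c < a + n" "P K b" "P K c" using three[OF assms] by blast
  have "b \<noteq> a + 1" "c \<noteq> b + 1" "a + n \<noteq> c + 1" using m0[OF assms(1,2)] m0[OF assms(1) bc(4)] m0[OF assms(1) bc(5)] assms(2) bc per[of K a] by auto
  then show ?thesis using bc by linarith
qed

text \<open>Where side \<open>s\<close> has no foot, the other side has one, so the vertex
  \<open>e + 1\<close> is not inside a leaf of that side. Of all ways to request across
  \<open>e\<close>, only a leaf with l = 1 ending at \<open>e + 1\<close> remains.\<close>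

lemma req_right:
  assumes "req (\<not> s) e" "\<not> att s (e + 1)"
  obtains M where "leaf (\<not> s) M (e - 1) 1"
proof -
  have a: "att (\<not> s) (e + 1)" using cov2[of s "e + 1"] assms(2) by simp
  have no: "\<not> leaf (\<not> s) K c l" if "c < e + 1" "e + 1 \<le> c + l" for K c l
    using leafD(6)[of "\<not> s" K c l "e + 1"] that a by blast
  have "\<not> req5 (\<not> s) e" "\<not> req6 (\<not> s) e" unfolding req5_def req6_def using no by auto
  then have "req4 (\<not> s) e" using assms(1) unfolding req_def by blast
  then show ?thesis unfolding req4_def using no that by (metis less_add_one order_refl)
qed

lemma req_left:
  assumes "req (\<not> s) e" "\<not> att s e"
  obtains M where "leaf (\<not> s) M e 1"
proof -
  have a: "att (\<not> s) e" using cov2[of s e] assms(2) by simp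
  have no: "\<not> leaf (\<not> s) K c l" if "c < e" "e \<le> c + l" for K c l
    using leafD(6)[of "\<not> s" K c l e] that a by blast
  have "\<not> req5 (\<not> s) e" "\<not> req6 (\<not> s) e" unfolding req5_def req6_def using no by auto
  then have "req4 (\<not> s) e" using assms(1) unfolding req_def by blast
  moreover have "\<not> leaf (\<not> s) K (e - 1) 1" for K using no[of "e - 1" 1] by simp
  ultimately show ?thesis unfolding req4_def using that by blast
qed

lemma req_mid:
  assumes "\<not> att s e" "\<not> att s (e + 1)"
  shows "\<not> req (\<not> s) e"
proof
  assume "req (\<not> s) e"
  then obtain M where "leaf (\<not> s) M (e - 1) 1" using req_right assms(2) by blast
  then have "\<not> att (\<not> s) e" using leafD(6)[of "\<not> s" M "e - 1" 1 e] by simp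
  then show False using assms(1) cov2 by blast
qed

lemma sum4: "(\<Sum>i\<in>{0..<1::int}. f i) = (f 0 :: int)" "(\<Sum>i\<in>{0..<2::int}. f i) = (f 0 + f 1 :: int)"
  "(\<Sum>i\<in>{0..<3::int}. f i) = (f 0 + f 1 + f 2 :: int)"
  "(\<Sum>i\<in>{0..<4::int}. f i) = (f 0 + f 1 + f 2 + f 3 :: int)"
  "(\<Sum>i\<in>{0..<5::int}. f i) = (f 0 + f 1 + f 2 + f 3 + f 4 :: int)"
proof -
  have "{0..<1::int} = {0}" "{0..<2::int} = {0, 1}" "{0..<3::int} = {0, 1, 2}" "{0..<4::int} = {0, 1, 2, 3}"
    "{0..<5::int} = {0, 1, 2, 3, 4}" by auto
  then show "(\<Sum>i\<in>{0..<1::int}. f i) = (f 0 :: int)" "(\<Sum>i\<in>{0..<2::int}. f i) = (f 0 + f 1 :: int)"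
  "(\<Sum>i\<in>{0..<3::int}. f i) = (f 0 + f 1 + f 2 :: int)"
  "(\<Sum>i\<in>{0..<4::int}. f i) = (f 0 + f 1 + f 2 + f 3 :: int)"
  "(\<Sum>i\<in>{0..<5::int}. f i) = (f 0 + f 1 + f 2 + f 3 + f 4 :: int)" by (simp_all add: algebra_simps)
qed

lemma sum_mid_le:
  assumes "\<forall>i. 1 \<le> i \<and> i < k \<longrightarrow> edge_weight s (v + i) \<le> - 1" "1 \<le> k"
  shows "(\<Sum>i\<in>{0..<k + 1}. edge_weight s (v + i)) \<le> - (k - 1)"
proof -
  have "(\<Sum>i\<in>{0..<k + 1}. edge_weight s (v + i)) \<le> (\<Sum>i\<in>{0..<k + 1}. if i = 0 \<or> i = k then 0 else - 1)"
    by (rule sum_mono) (use assms edge_weight_nonpos in auto)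
  also have "\<dots> = (\<Sum>i\<in>{1..<k}. - 1)"
    by (rule sum.mono_neutral_cong_right) (use assms in auto)
  finally show ?thesis using assms(2) by simp
qed

text \<open>Of the 6 units of the face, 2 go to its corner and 4 must go to its edges. Only the two
  end edges can be requested from the other side, and only by a leaf with l = 1 straddling that end
  (\<open>f\<close>, \<open>g\<close>). For l = 1 and l = 2 this contradicts \<open>m2\<close>, and
  the leaf's own requests fill up the sum; for l = 3 the unit received is forwarded; for l = 4
  \<open>m2\<close> and \<open>m3\<close> keep one end free; from l = 5 on the inner edges
  suffice.\<close>

lemma leaf_bound:
  assumes K: "leaf s K v l"
  shows "(\<Sum>i\<in>{0..<l + 1}. edge_weight s (v + i)) \<le> - 4"
proof -
  note KW = leafD(1,2)[OF K] and Pv = leafD(4)[OF K] and Pq = leafD(5)[OF K] and un = leafD(6)[OF K]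
  have n6: "6 \<le> n" using n_ge6 KW Pv by blast
  have l1: "1 \<le> l" using leafD(3)[OF K] .
  have mid: "edge_weight s (v + i) \<le> - 1" if "1 \<le> i" "i < l" for i
    by (rule edge_weight_le[OF req_mid]) (use un that in auto)
  have f: "\<exists>M. leaf (\<not> s) M (v - 1) 1" if "\<not> edge_weight s v \<le> - 1"
    using req_right[of s v] edge_weight_le[of s v] that un[of "v + 1"] l1 by (metis less_add_one add_left_mono)
  have g: "\<exists>M. leaf (\<not> s) M (v + l) 1" if "\<not> edge_weight s (v + l) \<le> - 1"
    using req_left[of s "v + l"] edge_weight_le[of s "v + l"] that un[of "v + l"] l1 by (metis less_add_same_cancel1 order_refl zero_less_one_class.zero_less_one order_less_le_trans)
  have ne: "M \<noteq> K" if "leaf (\<not> s) M a b" for M a b using leafD(2)[OF that] KW by auto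
  consider "l = 1" | "l = 2" | "l = 3" | "l = 4" | "5 \<le> l" using l1 by linarith
  then show ?thesis
  proof cases
    case 1
    have r: "req s v" "req s (v + 1)" using K 1 unfolding req_def req4_def by auto
    have "\<not> leaf (\<not> s) M (v - 1) 1" for M
    proof
      assume M: "leaf (\<not> s) M (v - 1) 1"
      show False using m2[OF leafD(1)[OF M] KW(1) ne[OF M], of "v - 1" v "v + 1" "v + 2"] leafD(4,5)[OF M] Pv Pq 1 n6
        by (simp add: algebra_simps)
    qed
    moreover have "\<not> leaf (\<not> s) M (v + 1) 1" for M
    proof
      assume M: "leaf (\<not> s) M (v + 1) 1"
      show False using m2[OF KW(1) leafD(1)[OF M] ne[OF M, symmetric], of v "v + 1" "v + 2" "v + 3"] leafD(4,5)[OF M] Pv Pq 1 n6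
        by (simp add: algebra_simps)
    qed
    moreover have "edge_weight s e \<le> - 2" if "req s e" "\<not> req (\<not> s) e" for e using that unfolding edge_weight_def by (auto simp: of_bool_def)
    moreover have "\<not> req (\<not> s) v" using req_right[of s v] un[of "v + 1"] calculation(1) 1 by auto
    moreover have "\<not> req (\<not> s) (v + 1)" using req_left[of s "v + 1"] un[of "v + 1"] calculation(2) 1 by auto
    ultimately have "edge_weight s v \<le> - 2" "edge_weight s (v + 1) \<le> - 2" using r by blast+
    then show ?thesis using 1 sum4(2)[of "\<lambda>i. edge_weight s (v + i)"] by simp
  next
    case 2
    have r: "req s (v + 1)" using K 2 unfolding req_def req5_def by auto
    have "\<not> leaf (\<not> s) M (v - 1) 1" for M
    proof
      assume M: "leaf (\<not> s) M (v - 1) 1"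
      show False using m2[OF leafD(1)[OF M] KW(1) ne[OF M], of "v - 1" v "v + 1" "v + 3"] leafD(4,5)[OF M] Pv Pq 2 n6
        by (simp add: algebra_simps)
    qed
    then have a: "edge_weight s v \<le> - 1" using f by blast
    have "\<not> leaf (\<not> s) M (v + 2) 1" for M
    proof
      assume M: "leaf (\<not> s) M (v + 2) 1"
      show False using m2[OF KW(1) leafD(1)[OF M] ne[OF M, symmetric], of v "v + 2" "v + 3" "v + 4"] leafD(4,5)[OF M] Pv Pq 2 n6
        by (simp add: algebra_simps)
    qed
    then have c: "edge_weight s (v + 2) \<le> - 1" using g 2 by blast
    have "\<not> req (\<not> s) (v + 1)" using req_mid[of s "v + 1"] un[of "v + 1"] un[of "v + 2"] 2 by (simp add: add.commute)
    then have b: "edge_weight s (v + 1) \<le> - 2" using r unfolding edge_weight_def by (auto simp: of_bool_def)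
    show ?thesis using 2 a b c sum4(3)[of "\<lambda>i. edge_weight s (v + i)"] by simp
  next
    case 3
    have m: "\<not> req (\<not> s) (v + 1)" "\<not> req (\<not> s) (v + 2)"
      using req_mid[of s "v + 1"] req_mid[of s "v + 2"] un[of "v + 1"] un[of "v + 2"] un[of "v + 3"] 3 by (simp_all add: add.commute)
    \<comment> \<open>A request on the first edge makes up for itself: \<open>req6\<close> forwards
      the unit across the inner edge next to the other end.\<close>
    have a: "edge_weight s v + edge_weight s (v + 2) \<le> - 2"
    proof (cases "edge_weight s v \<le> - 1")
      case True then show ?thesis using edge_weight_le[OF m(2)] by simp
    next
      case False
      then obtain M where M: "leaf (\<not> s) M (v - 1) 1" using f by blast
      then have "req4 (\<not> s) v" unfolding req4_def by blast
      then have "req s (v + 2)" using K 3 unfolding req_def req6_def by auto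
      then have "edge_weight s (v + 2) \<le> - 2" using m unfolding edge_weight_def by (auto simp: of_bool_def)
      then show ?thesis using edge_weight_nonpos[of s v] by simp
    qed
    have b: "edge_weight s (v + 3) + edge_weight s (v + 1) \<le> - 2"
    proof (cases "edge_weight s (v + 3) \<le> - 1")
      case True then show ?thesis using edge_weight_le[OF m(1)] by simp
    next
      case False
      then obtain M where M: "leaf (\<not> s) M (v + 3) 1" using g 3 by blast
      then have "req4 (\<not> s) (v + 1 + 2)" unfolding req4_def by (simp add: algebra_simps) blast
      then have "req s (v + 1)" using K 3 unfolding req_def req6_def by auto
      then have "edge_weight s (v + 1) \<le> - 2" using m unfolding edge_weight_def by (auto simp: of_bool_def)
      then show ?thesis using edge_weight_nonpos[of s "v + 3"] by simp
    qed
    show ?thesis using 3 a b sum4(4)[of "\<lambda>i. edge_weight s (v + i)"] by simp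
  next
    case 4
    have ab: "edge_weight s v \<le> - 1 \<or> edge_weight s (v + 4) \<le> - 1"
    proof (rule ccontr)
      assume "\<not> ?thesis"
      then obtain M M' where M: "leaf (\<not> s) M (v - 1) 1" and M': "leaf (\<not> s) M' (v + 4) 1" using f g 4 by blast
      have p: "P M (v - 1)" "P M (v + 1)" "P M' (v + 4)" "P M' (v + 6)" "P K (v + 5)"
        using leafD(4,5)[OF M] leafD(4,5)[OF M'] Pq 4 by (simp_all add: algebra_simps)
      show False
      proof (cases "M = M'")
        case True
        then show False using m2[OF leafD(1)[OF M] KW(1) ne[OF M], of "v - 1" v "v + 4" "v + 5"] p Pv n6 by simp
      next
        case False
        \<comment> \<open>The exchange of three segments needs room for
          \<open>v + 6 \<le> v - 1 + n\<close>. For \<open>n = 6\<close> the feet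
          \<open>v + 5\<close> and \<open>v + n\<close> of \<open>K\<close> would be
          neighbours.\<close>
        have "n \<noteq> 6"
        proof
          assume "n = 6"
          then have "P K (v + 5 + 1)" using per[of K v] Pv by (simp add: add.commute)
          then show False using m0[OF KW(1) p(5)] by simp
        qed
        then have n7: "7 \<le> n" using n6 by simp
        have q: "P M (v - 1 + n)" "P M (v + 1 + n)" "P M' (v + 4 + n)" "P K (v + n)" using p Pv per by blast+
        show False
          using m3[OF KW(1) leafD(1)[OF M'] leafD(1)[OF M] ne[OF M', symmetric] ne[OF M, symmetric] False[symmetric],
             of "v + 5" "v + 6" "v - 1 + n" "v + n" "v + 1 + n" "v + 4 + n"] p q n7 by simp
      qed
    qed
    show ?thesis using 4 ab mid[of 1] mid[of 2] mid[of 3] edge_weight_nonpos[of s v] edge_weight_nonpos[of s "v + 4"] sum4(5)[of "\<lambda>i. edge_weight s (v + i)"] by auto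
  next
    case 5
    show ?thesis using sum_mid_le[of l s v] mid 5 by simp
  qed
qed


section \<open>Faces with two corners\<close>

definition net :: "'w \<Rightarrow> int \<Rightarrow> int \<Rightarrow> int" where
  "net K v t = (if t = 0 then - corner_charge K v else (\<Sum>i\<in>{0..<t}. edge_weight (sd K) (v + i)))"

text \<open>
  A face with two corners: walking around it one passes from \<open>K1\<close> to \<open>K2\<close> along the \<open>t1\<close> edges following \<open>v1\<close> and
  back along the \<open>t2\<close> edges following \<open>v2\<close>.
\<close>

definition trans2 where
  "trans2 K1 K2 v1 t1 v2 t2 \<longleftrightarrow> K1 \<in> W \<and> K2 \<in> W \<and> K1 \<noteq> K2 \<and> sd K1 = sd K2 \<and> 0 \<le> t1 \<and> 0 \<le> t2 \<and>
     v1 + t1 < v2 \<and> v2 + t2 < v1 + n \<and> cons K1 v1 (v2 + t2) \<and> cons K2 v2 (v1 + t1 + n) \<and>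
     (\<forall>i. v1 < i \<and> i < v1 + t1 \<longrightarrow> \<not> att (sd K1) i) \<and> (\<forall>i. v2 < i \<and> i < v2 + t2 \<longrightarrow> \<not> att (sd K1) i)"

lemma net_per: "P K v \<Longrightarrow> net K (v + n) t = net K v t"
proof -
  assume "P K v"
  moreover have "edge_weight (sd K) (v + n + i) = edge_weight (sd K) (v + i)" for i
    using edge_weight_per[of "sd K" "v + i"] by (simp add: algebra_simps)
  ultimately show ?thesis unfolding net_def by (simp add: corner_charge_per)
qed

lemma net_nonpos: "net K v t \<le> 0"
  unfolding net_def using corner_charge_nonneg edge_weight_nonpos by (auto intro: sum_nonpos)

lemma trans2D:
  assumes "trans2 K1 K2 v1 t1 v2 t2"
  shows "K1 \<in> W" "K2 \<in> W" "K1 \<noteq> K2" "sd K2 = sd K1" "0 \<le> t1" "0 \<le> t2"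
    "cons K1 v1 (v2 + t2)" "cons K2 v2 (v1 + t1 + n)"
    "v1 < i \<Longrightarrow> i < v1 + t1 \<Longrightarrow> \<not> att (sd K1) i" "v2 < i \<Longrightarrow> i < v2 + t2 \<Longrightarrow> \<not> att (sd K1) i"
    "P K1 v1" "P K1 (v2 + t2)" "P K2 v2" "P K2 (v1 + t1)" "v1 + t1 < v2" "v2 + t2 < v1 + n"
  using assms per[of K2 "v1 + t1"] unfolding trans2_def cons_def by auto

text \<open>All feet of \<open>K2\<close> lie between \<open>v1 + t1\<close> and \<open>v2\<close>,
  and three feet at distances of at least 2 span at least 4.\<close>

lemma trans2_gap1:
  assumes "trans2 K1 K2 v1 t1 v2 t2"
  shows "v1 + t1 + 4 \<le> v2"
proof -
  note t = trans2D[OF assms]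
  obtain b c where bc: "v1 + t1 < b" "b < c" "c < v1 + t1 + n" "P K2 b" "P K2 c" using three[OF t(2) t(14)] by blast
  have "c \<le> v2" using consD(4)[OF t(8), of c] bc by linarith
  moreover have "b \<noteq> v1 + t1 + 1" "c \<noteq> b + 1" using m0[OF t(2) t(14)] m0[OF t(2) bc(4)] bc by auto
  ultimately show ?thesis using bc by linarith
qed

lemma trans2_swap:
  assumes "trans2 K1 K2 v1 t1 v2 t2"
  shows "trans2 K2 K1 v2 t2 (v1 + n) t1"
proof -
  note t = trans2D[OF assms]
  have "cons K1 (v1 + n) (v2 + t2 + n)" using t(7) cons_shift by blast
  moreover have "\<not> att (sd K1) i" if "v1 + n < i" "i < v1 + n + t1" for i
    using t(9)[of "i - n"] att_per[of "sd K1" "i - n"] that by simp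
  ultimately show ?thesis using t unfolding trans2_def by (auto simp: algebra_simps)
qed

lemma trans2_gap2: "trans2 K1 K2 v1 t1 v2 t2 \<Longrightarrow> v2 + t2 + 4 \<le> v1 + n"
  using trans2_gap1[OF trans2_swap] .

lemma trans2_pinched:
  assumes "trans2 K1 K2 v1 0 v2 t2"
  shows "pinched K1 v1"
proof -
  note t = trans2D[OF assms]
  obtain b c where bc: "v1 < b" "b < c" "c < v1 + n" "P K2 b" "P K2 c" using three[OF t(2)] t(14) by auto
  have "c \<le> v2" using consD(4)[OF t(8), of c] bc by linarith
  have "cn K2 v1 \<le> b" using consD(4)[OF cn_cons(1), of K2 v1 b] t(14) bc by force
  moreover have "cn K1 v1 = v2 + t2" using cn_eq t(7) by blast
  ultimately have "cn K2 v1 < cn K1 v1" using bc t(6) \<open>c \<le> v2\<close> by linarith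
  then show ?thesis unfolding pinched_def using t(2,3,4,14) by (intro bexI[of _ K2]) auto
qed

text \<open>The \<open>t - 2\<close> inner edges have no foot of this side at either end, so they
  cannot be requested.\<close>

lemma net_le2:
  assumes "att (sd K) v" "\<forall>i. v < i \<and> i < v + t \<longrightarrow> \<not> att (sd K) i" "4 \<le> t"
  shows "net K v t \<le> - 2"
proof -
  have "edge_weight (sd K) (v + i) \<le> - 1" if "1 \<le> i" "i < t - 1" for i
    by (rule edge_weight_le[OF req_mid]) (use assms(2) that in auto)
  then show ?thesis using sum_mid_le[of "t - 1" "sd K" v] assms(3) unfolding net_def by auto
qed

text \<open>On a stretch that contributes nothing, every edge is requested from the other side. For
  \<open>t = 1\<close> both ends are attached, so a leaf with l = 1 would have triggered
  \<open>iiR\<close> or \<open>iiL\<close>. For \<open>t = 2\<close> the two requesting leaves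
  belong to the same bridge, as otherwise \<open>centre\<close> would count. From
  \<open>t = 3\<close> on some inner edge cannot be requested.\<close>

lemma net_special:
  assumes A: "att s v" "att s (v + t)" and un: "\<forall>i. v < i \<and> i < v + t \<longrightarrow> \<not> att s i"
    and t: "1 \<le> t" and s: "sd K = s" and big: "\<not> net K v t \<le> - 1"
  obtains N where "N \<in> W" "sd N = (\<not> s)" "t \<le> 2" "P N (v - 1)" "P N (v + t + 1)"
    | N where "t = 1" "leaf (\<not> s) N (v - 2) 3" "req4 s (v - 2)"
    | N where "t = 1" "leaf (\<not> s) N (v - 1) 3" "req4 s (v + 2)"
proof -
  consider "t = 1" | "t = 2" | "t = 3" | "4 \<le> t" using t by linarith
  then show ?thesis
  proof cases
    case 1
    then have w: "\<not> edge_weight s v \<le> - 1" using big s sum4(1)[of "\<lambda>i. edge_weight s (v + i)"] unfolding net_def by auto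
    then have r: "req (\<not> s) v" using edge_weight_le by blast
    have "\<not> iiR s v" "\<not> iiL s v" using w unfolding edge_weight_def by (auto simp: of_bool_def split: if_splits)
    then have "\<not> req4 (\<not> s) v" using A 1 unfolding iiR_def iiL_def req4_def by blast
    then consider "req5 (\<not> s) v" | "req6 (\<not> s) v" using r unfolding req_def by blast
    then show ?thesis
    proof cases
      case 1
      then obtain N where N: "leaf (\<not> s) N (v - 1) 2" unfolding req5_def by blast
      show ?thesis using that(1)[OF leafD(1,2)[OF N]] leafD(4,5)[OF N] \<open>t = 1\<close> by (simp add: algebra_simps)
    next
      case 2
      then obtain N where "leaf (\<not> s) N (v - 2) 3 \<and> req4 s (v - 2) \<or> leaf (\<not> s) N (v - 1) 3 \<and> req4 s (v + 2)"
        unfolding req6_def by auto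
      then show ?thesis using that(2)[of N] that(3)[of N] 1 by blast
    qed
  next
    case 2
    then have w: "\<not> edge_weight s v + edge_weight s (v + 1) \<le> - 1" using big s sum4(2)[of "\<lambda>i. edge_weight s (v + i)"] unfolding net_def by auto
    then have "req (\<not> s) v" "req (\<not> s) (v + 1)" using edge_weight_le[of s v] edge_weight_le[of s "v + 1"] edge_weight_nonpos[of s v] edge_weight_nonpos[of s "v + 1"] by linarith+
    moreover have u: "\<not> att s (v + 1)" using un 2 by simp
    ultimately obtain N N' where N: "leaf (\<not> s) N (v - 1) 1" "leaf (\<not> s) N' (v + 1) 1"
      using req_right[of s v] req_left[of s "v + 1"] by metis
    have "\<not> centre (\<not> s) (v + 1)" using w edge_weight_nonpos[of s "v + 1"] unfolding edge_weight_def[of s v] by (auto simp: of_bool_def split: if_splits)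
    then have "N = N'" using N unfolding centre_def by auto
    then show ?thesis using that(1)[OF leafD(1,2)[OF N(1)]] leafD(4,5)[OF N(1)] leafD(4,5)[OF N(2)] 2 by (simp add: algebra_simps)
  next
    case 3
    have "edge_weight s (v + 1) \<le> - 1" by (rule edge_weight_le[OF req_mid]) (use un 3 in auto)
    then show ?thesis using big s 3 sum4(3)[of "\<lambda>i. edge_weight s (v + i)"] edge_weight_nonpos[of s v] edge_weight_nonpos[of s "v + 2"] unfolding net_def by auto
  next
    case 4
    then show ?thesis using net_le2[of K v t] A un big s by auto
  qed
qed

text \<open>Two corners leave 2 of the 6 units, so if the first stretch contributes nothing, the
  second must take both. \<open>net_special\<close> supplies a bridge \<open>N\<close> spanning the
  first stretch. By \<open>m3\<close> for \<open>N\<close>, \<open>K1\<close>, \<open>K2\<close>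
  this is possible only with \<open>t2 = 3\<close> and a span of \<open>t1 + 3\<close>, hence only
  for a leaf with l = 3; there the bridge \<open>M\<close> behind the forwarded unit completes an
  exchange of four segments.\<close>

lemma trans2_key:
  assumes T: "trans2 K1 K2 v1 t1 v2 t2" and big: "\<not> net K1 v1 t1 \<le> - 1"
  shows "net K2 v2 t2 \<le> - 2"
proof (rule ccontr)
  assume b2: "\<not> net K2 v2 t2 \<le> - 2"
  note t = trans2D[OF T] and g1 = trans2_gap1[OF T] and g2 = trans2_gap2[OF T]
  define s where "s = sd K1"
  have sK: "sd K1 = s" "sd K2 = s" using t(4) s_def by auto
  have "t1 \<noteq> 0"
  proof
    assume "t1 = 0"
    then have "pinched K1 v1" using trans2_pinched T by blast
    then show False using big \<open>t1 = 0\<close> unfolding net_def corner_charge_def by (auto simp: of_bool_def split: if_splits)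
  qed
  then have t1: "1 \<le> t1" using t(5) by simp
  have A: "att s v1" "att s (v1 + t1)" using attI[OF t(1) t(11)] attI[OF t(2) t(14)] sK by simp_all
  have un: "\<forall>i. v1 < i \<and> i < v1 + t1 \<longrightarrow> \<not> att s i" using t(9) sK by blast
  \<comment> \<open>\<open>m3\<close> requires the parts of \<open>N\<close> outside the first
    stretch, at most 3 in total, plus a third segment of length at most 3 to add up to 6.\<close>
  have spec: "N \<in> W \<and> sd N = (\<not> s) \<Longrightarrow> P N p \<Longrightarrow> P N q \<Longrightarrow> p < v1 \<Longrightarrow> v1 - 2 \<le> p \<Longrightarrow> v1 + t1 < q \<Longrightarrow> q \<le> v1 + t1 + 2 \<Longrightarrow>
      q - p \<le> t1 + 3 \<Longrightarrow> t2 = 3 \<and> q - p = t1 + 3" for N p q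
  proof -
    assume N: "N \<in> W \<and> sd N = (\<not> s)" and pq: "P N p" "P N q" "p < v1" "v1 - 2 \<le> p" "v1 + t1 < q" "q \<le> v1 + t1 + 2" "q - p \<le> t1 + 3"
    have ne: "N \<noteq> K1" "N \<noteq> K2" using N sK by auto
    have NW: "N \<in> W" using N by blast
    show ?thesis
    proof (cases "t2 = 0")
      case True
      \<comment> \<open>Without a second stretch the corner is pinched and, paying only one unit,
        relieved. The two steps from \<open>v2 - 2\<close> to \<open>v2\<close> then act as the
        third segment, which is too short.\<close>
      have "pinched K2 v2" using trans2_pinched trans2_swap[OF T] True by blast
      then have "relieved K2 v2" using b2 True unfolding net_def corner_charge_def by (auto simp: of_bool_def split: if_splits)
      then have "leaf s K2 (v2 - 2) 1" using sK unfolding relieved_def by simp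
      then have p2: "P K2 (v2 - 2)" using leafD(4) by blast
      show ?thesis
        using m3[OF NW t(1,2) ne t(3), of p v1 "v1 + t1" q "v2 - 2" v2] pq p2 t True g1 g2 t1 by simp
    next
      case False
      have "t2 < 4"
      proof (rule ccontr)
        assume "\<not> t2 < 4"
        then have "net K2 v2 t2 \<le> - 2" using net_le2[of K2 v2 t2] attI[OF t(2) t(13)] t(10) t(4) by auto
        then show False using b2 by simp
      qed
      then show ?thesis
        using m3[OF NW t(1,2) ne t(3), of p v1 "v1 + t1" q v2 "v2 + t2"] pq t False g1 g2 t1 by simp
    qed
  qed
  from A un t1 sK(1) big show False
  proof (cases rule: net_special)
    case (1 N)
    then show False using spec[of N "v1 - 1" "v1 + t1 + 1"] by simp
  next
    case (2 N)
    note N = leafD[OF 2(2)]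
    have N4: "P N (v1 + 2)" using N(5) by (simp add: algebra_simps)
    have t2: "t2 = 3" using spec[of N "v1 - 2" "v1 + 2"] N(1,2,4) N4 2(1) by simp
    obtain M where "leaf s M (v1 - 2) 1 \<or> leaf s M (v1 - 3) 1" using 2(3) unfolding req4_def by auto
    \<comment> \<open>This alternative would leave \<open>v1 - 1\<close> without a foot on either
      side.\<close>
    moreover have "\<not> leaf s M (v1 - 2) 1"
      using leafD(6)[of s M "v1 - 2" 1 "v1 - 1"] N(6)[of "v1 - 1"] cov2[of s "v1 - 1"] by auto
    ultimately have M: "leaf s M (v1 - 3) 1" by blast
    have PM: "P M (v1 - 3)" "P M (v1 - 1)" using leafD(4,5)[OF M] by (simp_all add: algebra_simps)
    have "M \<noteq> K1" using m0[of M "v1 - 1"] PM t(1,11) by auto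
    moreover have "M \<noteq> K2" using consD(4)[OF t(8), of "v1 - 1 + n"] PM per[of M "v1 - 1"] g2 t1 t(6) by auto
    moreover have "N \<noteq> M" "N \<noteq> K1" "N \<noteq> K2" using N(2) sK leafD(2)[OF M] by auto
    ultimately have d: "distinct [N, K1, K2, M]" using t(3) by auto
    have P: "P M (v1 - 2 - 1)" "P M (v1 - 2 + 1)" "P N (v1 - 2 + 4)" "P K1 (v1 - 2 + 2)" "P K2 (v1 - 2 + 3)" "P K1 (v2 + 3)"
      using PM N4 t(11,14,12) 2(1) t2 by (simp_all add: algebra_simps)
    show False
      by (rule m4l[OF N(1) t(1,2) leafD(1)[OF M] d P(1,2) N(4) P(3,4,5) t(13) P(6)]) (use g1 g2 t2 t1 in auto)
  next
    case (3 N)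
    note N = leafD[OF 3(2)]
    have N4: "P N (v1 + 3)" using N(5) by (simp add: algebra_simps)
    have t2: "t2 = 3" using spec[of N "v1 - 1" "v1 + 3"] N(1,2,4) N4 3(1) by simp
    obtain M where "leaf s M (v1 + 2) 1 \<or> leaf s M (v1 + 1) 1" using 3(3) unfolding req4_def by (auto simp: add.commute)
    moreover have "\<not> leaf s M (v1 + 1) 1"
      using leafD(6)[of s M "v1 + 1" 1 "v1 + 2"] N(6)[of "v1 + 2"] cov2[of s "v1 + 2"] by auto
    ultimately have M: "leaf s M (v1 + 2) 1" by blast
    have PM: "P M (v1 + 2)" "P M (v1 + 4)" using leafD(4,5)[OF M] by (simp_all add: algebra_simps)
    have K2': "P K2 (v1 + 1)" using t(14) 3(1) by simp
    have "M \<noteq> K2" using m0[of K2 "v1 + 1"] PM t(2) K2' by (auto simp: add.commute)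
    moreover have "M \<noteq> K1" using consD(4)[OF t(7), of "v1 + 2"] PM g1 t(5,6) by (auto simp: add.commute)
    moreover have "N \<noteq> M" "N \<noteq> K1" "N \<noteq> K2" using N(2) sK leafD(2)[OF M] by auto
    ultimately have d: "distinct [N, K1, K2, M]" using t(3) by auto
    have P: "P M (v1 - 1 + 3)" "P M (v1 - 1 + 5)" "P N (v1 - 1 + 4)" "P K1 (v1 - 1 + 1)" "P K2 (v1 - 1 + 2)" "P K1 (v2 + 3)"
      using PM N4 t(11,12) K2' t2 by (simp_all add: algebra_simps)
    show False
      by (rule m4r[OF N(1) t(1,2) leafD(1)[OF M] d P(1,2) N(4) P(3,4,5) t(13) P(6)]) (use g1 g2 t2 3(1) in auto)
  qed
qed

lemma trans2_bound:
  assumes T: "trans2 K1 K2 v1 t1 v2 t2"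
  shows "net K1 v1 t1 + net K2 v2 t2 \<le> - 2"
proof (cases "net K1 v1 t1 \<le> - 1 \<and> net K2 v2 t2 \<le> - 1")
  case False
  then consider "\<not> net K1 v1 t1 \<le> - 1" | "\<not> net K2 v2 t2 \<le> - 1" by blast
  then show ?thesis
  proof cases
    case 1 then show ?thesis using trans2_key[OF T 1] net_nonpos[of K1 v1 t1] by simp
  next
    case 2
    then show ?thesis using trans2_key[OF trans2_swap[OF T] 2] net_nonpos[of K2 v2 t2] net_per[OF trans2D(11)[OF T]] by simp
  qed
qed simp


section \<open>The nesting of gaps on one side\<close>

text \<open>
  Positions are now cut open to \<open>{0..<n}\<close>. A face is either \<open>None\<close>, the one containing the edge from \<open>n - 1\<close> to
  \<open>0\<close>, or a gap between consecutive feet of a bridge. Each edge belongs to the narrowest gap containing it, and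
  the corner at the last foot of a bridge to the narrowest gap of another bridge that contains the whole bridge.
\<close>

definition fst_att where "fst_att K = Min (feet K)"
definition lst_att where "lst_att K = Max (feet K)"
definition side where "side s = {K \<in> W. sd K = s}"
definition corners where "corners s = Sigma (side s) feet"
definition gaps where "gaps s = {(K, v) \<in> corners s. v < lst_att K}"
definition width where "width g = cn (fst g) (snd g) - snd g"
definition sel where "sel C = (if C = {} then None else Some (arg_min_on width C))"
definition candE where "candE s e = {(K, v) \<in> gaps s. v \<le> e \<and> e < cn K v}"
definition candK where "candK L = {(K, v) \<in> gaps (sd L). K \<noteq> L \<and> v \<le> fst_att L \<and> lst_att L \<le> cn K v}"
definition own where "own s e = sel (candE s e)"
definition par where "par L = sel (candK L)"
definition face where "face c = (if snd c < lst_att (fst c) then Some c else par (fst c))"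
definition faces where "faces s = insert None (Some ` gaps s)"
definition kids where "kids s f = {M \<in> side s. par M = f}"
definition inside where "inside f L \<longleftrightarrow> f = None \<or> (\<exists>g\<in>candK L. f = Some g)"

lemma feetD: "x \<in> feet K \<Longrightarrow> P K x \<and> 0 \<le> x \<and> x < n" unfolding feet_def by auto

lemma feetI: "P K x \<Longrightarrow> 0 \<le> x \<Longrightarrow> x < n \<Longrightarrow> x \<in> feet K" unfolding feet_def by auto

lemma feet_bounds: assumes "K \<in> W" shows "fst_att K \<in> feet K" "lst_att K \<in> feet K" "fst_att K + 4 \<le> lst_att K"
  "x \<in> feet K \<Longrightarrow> fst_att K \<le> x" "x \<in> feet K \<Longrightarrow> x \<le> lst_att K"
proof -
  have "feet K \<noteq> {}" using card3[OF assms] unfolding feet_def by (metis (no_types) card.empty not_numeral_le_zero)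
  then show f: "fst_att K \<in> feet K" and l: "lst_att K \<in> feet K"
    unfolding fst_att_def lst_att_def using finite_feet Min_in Max_in by blast+
  show a: "x \<in> feet K \<Longrightarrow> fst_att K \<le> x" and b: "x \<in> feet K \<Longrightarrow> x \<le> lst_att K" for x
    unfolding fst_att_def lst_att_def using finite_feet Min_le Max_ge by blast+
  have Pf: "P K (fst_att K)" "0 \<le> fst_att K" using f unfolding feet_def by auto
  obtain b c where bc: "fst_att K < b" "b < c" "c < fst_att K + n" "P K b" "P K c" using three[OF assms Pf(1)] by blast
  \<comment> \<open>A foot from \<open>n\<close> on would be the copy of a foot smaller than the
    first one.\<close>
  have "c < n"
  proof (rule ccontr)
    assume "\<not> c < n"
    then have "c - n \<in> feet K" using bc per_sub feetD[OF f] by (intro feetI) auto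
    then show False using a[of "c - n"] bc by simp
  qed
  then have "c \<in> feet K" using bc Pf unfolding feet_def by auto
  then have "c \<le> lst_att K" using b by blast
  moreover have "b \<noteq> fst_att K + 1" "c \<noteq> b + 1" using m0[OF assms Pf(1)] m0[OF assms bc(4)] bc by auto
  ultimately show "fst_att K + 4 \<le> lst_att K" using bc by linarith
qed

lemma fin_side: "finite (side s)" unfolding side_def using fin by simp
lemma fin_corners: "finite (corners s)" unfolding corners_def using fin_side finite_feet by blast
lemma fin_gaps: "finite (gaps s)" unfolding gaps_def by (rule finite_subset[OF _ fin_corners]) auto
lemma fin_cand: "finite (candE s e)" "finite (candK L)"
  unfolding candE_def candK_def by (rule finite_subset[OF _ fin_gaps]; auto)+

lemma sideD: "K \<in> side s \<Longrightarrow> K \<in> W \<and> sd K = s" unfolding side_def by auto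

lemma gapD:
  assumes "(K, v) \<in> gaps s"
  shows "K \<in> W" "sd K = s" "v \<in> feet K" "v < lst_att K" "cons K v (cn K v)" "cn K v \<le> lst_att K" "cn K v < n" "0 \<le> v"
    "v + 2 \<le> cn K v" "fst_att K \<le> v"
proof -
  show g: "K \<in> W" "sd K = s" "v \<in> feet K" "v < lst_att K" using assms unfolding gaps_def corners_def side_def by auto
  show c: "cons K v (cn K v)" using cn_cons g(3) feetD by blast
  show l: "cn K v \<le> lst_att K" using consD(4)[OF c, of "lst_att K"] g(4) feetD[OF feet_bounds(2)[OF g(1)]] by linarith
  then show "cn K v < n" using feetD[OF feet_bounds(2)[OF g(1)]] by linarith
  show "0 \<le> v" using feetD[OF g(3)] by simp
  show "v + 2 \<le> cn K v" using cons_ge2[OF g(1) c] .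
  show "fst_att K \<le> v" using feet_bounds(4)[OF g(1,3)] .
qed

lemma candK_iff: "(K, v) \<in> candK L \<longleftrightarrow> (K, v) \<in> gaps (sd L) \<and> K \<noteq> L \<and> v \<le> fst_att L \<and> lst_att L \<le> cn K v"
  unfolding candK_def by auto

lemma candE_iff: "(K, v) \<in> candE s e \<longleftrightarrow> (K, v) \<in> gaps s \<and> v \<le> e \<and> e < cn K v"
  unfolding candE_def by auto

lemma selD:
  assumes "finite C" "sel C = Some g"
  shows "g \<in> C" "h \<in> C \<Longrightarrow> width g \<le> width h"
proof -
  have C: "C \<noteq> {}" "g = arg_min_on width C" using assms unfolding sel_def by (auto split: if_splits)
  show "g \<in> C" using arg_min_if_finite(1)[OF assms(1) C(1)] C(2) by simp
  show "h \<in> C \<Longrightarrow> width g \<le> width h" using arg_min_least[OF assms(1) C(1)] C(2) by simp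
qed

lemma sel_None: "sel C = None \<longleftrightarrow> C = {}" unfolding sel_def by auto

text \<open>Noncrossing forces every foot of \<open>L\<close> from \<open>v\<close> to below
  \<open>v + n\<close> into the gap. A foot before \<open>v\<close> would reappear at or after
  \<open>n\<close>, whereas the gap ends before \<open>n\<close>; so cutting the circuit open at 0
  does not split \<open>L\<close>.\<close>

lemma L_in:
  assumes g: "(K, v) \<in> gaps s" and L: "L \<in> W" "sd L = s" "L \<noteq> K"
    and x: "P L x" "v < x \<and> x < cn K v \<or> v \<le> x \<and> x < y \<and> y \<le> cn K v \<and> P L y"
  shows "(K, v) \<in> candK L"
proof -
  note gd = gapD[OF g]
  have sd: "sd K = sd L" using gd L by simp
  have ub: "z \<le> cn K v" if "P L z" "v \<le> z" "z < v + n" for z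
    using x(2)
  proof
    assume "v < x \<and> x < cn K v"
    then show ?thesis using nc[OF gd(1) L(1) L(3)[symmetric] sd consD(2,3)[OF gd(5)] _ x(1) _ _ that] consD(4)[OF gd(5)] by blast
  next
    assume "v \<le> x \<and> x < y \<and> y \<le> cn K v \<and> P L y"
    then show ?thesis using two_in[OF gd(1) L(1) L(3)[symmetric] sd gd(5) x(1) _ _ _ _ that] by blast
  qed
  have *: "v \<le> z \<and> z \<le> cn K v" if z: "z \<in> feet L" for z
  proof -
    note zp = feetD[OF z]
    have "v \<le> z"
    proof (rule ccontr)
      assume "\<not> v \<le> z"
      moreover have "P L (z + n)" using zp per by blast
      ultimately have "z + n \<le> cn K v" using ub[of "z + n"] zp gd(7,8,9) by linarith
      then show False using gd(7) zp by simp
    qed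
    then show ?thesis using ub[of z] zp gd(8) by simp
  qed
  show ?thesis unfolding candK_iff using g L *[OF feet_bounds(1)[OF L(1)]] *[OF feet_bounds(2)[OF L(1)]] by auto
qed

text \<open>Overlapping gaps are nested: an end of the narrower one is strictly inside the wider
  one, or both ends coincide. Either way \<open>L_in\<close> places all of \<open>L\<close> in the
  gap of \<open>K\<close>.\<close>

lemma gap_cmp:
  assumes g: "(K, v) \<in> gaps s" and h: "(L, u) \<in> gaps s" and ne: "(L, u) \<noteq> (K, v)"
    and ov: "v < cn L u" "u < cn K v" and wd: "cn L u - u \<le> cn K v - v"
  shows "(K, v) \<in> candK L"
proof -
  note gd = gapD[OF g] and hd = gapD[OF h]
  have "L \<noteq> K"
  proof
    assume "L = K"
    then have "u \<noteq> v" using ne by simp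
    then show False using consD(4)[OF gd(5), of u] consD(4)[OF hd(5), of v] consD(2)[OF gd(5)] consD(2)[OF hd(5)] ov \<open>L = K\<close>
      by (cases "u < v") auto
  qed
  note in_ = L_in[OF g hd(1,2) this]
  consider "v < u" | "cn L u < cn K v" | "u \<le> v" "cn K v \<le> cn L u" by linarith
  then show ?thesis
  proof cases
    case 1 then show ?thesis using in_[OF consD(2)[OF hd(5)]] ov by blast
  next
    case 2 then show ?thesis using in_[OF consD(3)[OF hd(5)]] ov by blast
  next
    case 3
    then have "u = v" "cn L u = cn K v" using wd by linarith+
    then show ?thesis using in_[OF consD(2)[OF hd(5)], of "cn L u"] consD(3)[OF hd(5)] gd(9) by simp
  qed
qed

text \<open>The third foot makes a bridge wider than any of its gaps, so that passing to the
  enclosing bridge terminates.\<close>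

lemma span_strict: assumes "(K, v) \<in> gaps s" shows "cn K v - v < lst_att K - fst_att K"
proof (rule ccontr)
  note g = gapD[OF assms]
  assume "\<not> ?thesis"
  then have e: "v = fst_att K" "cn K v = lst_att K" using g(6,10) by linarith+
  have "feet K \<subseteq> {v, cn K v}"
  proof
    fix x assume x: "x \<in> feet K"
    then have "v \<le> x" "x \<le> cn K v" using feet_bounds(4,5)[OF g(1)] e by auto
    then show "x \<in> {v, cn K v}" using consD(4)[OF g(5), of x] feetD[OF x] by force
  qed
  then have "card (feet K) \<le> card {v, cn K v}" by (rule card_mono[rotated]) simp
  also have "\<dots> \<le> 2" by (simp add: card_insert_if)
  finally show False using card3[OF g(1)] unfolding feet_def by simp
qed

text \<open>Climbs from \<open>L\<close> to the bridge owning the narrowest gap around it until the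
  parent is \<open>f\<close>. The spans grow by \<open>span_strict\<close>, and by
  \<open>gap_cmp\<close> the climb stays inside \<open>f\<close>.\<close>

lemma kid_ex:
  assumes "L \<in> side s" "f \<in> faces s" "inside f L"
  shows "\<exists>M\<in>kids s f. fst_att M \<le> fst_att L \<and> lst_att L \<le> lst_att M"
  using assms
proof (induction "nat (n - (lst_att L - fst_att L))" arbitrary: L rule: less_induct)
  case less
  note L = sideD[OF less(2)]
  show ?case
  proof (cases "par L = f")
    case True then show ?thesis using less(2) unfolding kids_def by blast
  next
    case False
    have "candK L \<noteq> {}" using less(4) False unfolding inside_def par_def using sel_None[of "candK L"] by auto
    then obtain K u where Ku: "par L = Some (K, u)" using sel_None[of "candK L"] unfolding par_def by fastforce
    have c: "(K, u) \<in> candK L" and mn: "\<And>h. h \<in> candK L \<Longrightarrow> width (K, u) \<le> width h"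
      using selD[OF fin_cand(2)] Ku unfolding par_def by blast+
    have cg: "(K, u) \<in> gaps s" "u \<le> fst_att L" "lst_att L \<le> cn K u" using c L unfolding candK_iff by auto
    note g = gapD[OF cg(1)]
    have KS: "K \<in> side s" using g unfolding side_def by simp
    have ins: "inside f K"
    proof (cases f)
      case None then show ?thesis unfolding inside_def by simp
    next
      case (Some h)
      obtain K' v where h: "h = (K', v)" by force
      have ch: "(K', v) \<in> candK L" using less(4) Some h unfolding inside_def by auto
      have "(K', v) \<in> candK K"
        by (rule gap_cmp[of _ _ s]) (use ch cg mn[OF ch] c L Some h False Ku feet_bounds(3)[of L] in \<open>auto simp: candK_iff width_def\<close>)
      then show ?thesis unfolding inside_def using Some h by blast
    qed
    have "lst_att L - fst_att L < lst_att K - fst_att K" using span_strict[OF cg(1)] cg by linarith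
    moreover have "lst_att K - fst_att K < n" using feetD[OF feet_bounds(1)[OF g(1)]] feetD[OF feet_bounds(2)[OF g(1)]] by linarith
    ultimately have "nat (n - (lst_att K - fst_att K)) < nat (n - (lst_att L - fst_att L))" by linarith
    from less(1)[OF this KS less(3) ins] obtain M where M: "M \<in> kids s f" "fst_att M \<le> fst_att K" "lst_att K \<le> lst_att M" by blast
    then have "fst_att M \<le> fst_att L \<and> lst_att L \<le> lst_att M" using cg g by linarith
    then show ?thesis using M(1) by blast
  qed
qed

definition in_face where "in_face f e \<longleftrightarrow> (case f of None \<Rightarrow> True | Some g \<Rightarrow> snd g \<le> e \<and> e < cn (fst g) (snd g))"

text \<open>If another gap were the narrowest around \<open>e\<close>, its bridge would lie inside
  \<open>f\<close>, hence within the span of a child of \<open>f\<close>, and that span would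
  contain \<open>e\<close>.\<close>

lemma own_eq:
  assumes f: "f \<in> faces s" and e: "in_face f e" and nk: "\<And>M. M \<in> kids s f \<Longrightarrow> \<not> (fst_att M \<le> e \<and> e < lst_att M)"
  shows "own s e = f"
proof (rule ccontr)
  assume ne: "own s e \<noteq> f"
  have "candE s e \<noteq> {}"
  proof
    assume E: "candE s e = {}"
    then have "own s e = None" unfolding own_def sel_None by simp
    then obtain K v where Kv: "f = Some (K, v)" using ne by (cases f) auto
    then have "(K, v) \<in> candE s e" using f e unfolding faces_def in_face_def candE_iff by auto
    then show False using E by blast
  qed
  then obtain K u where Ku: "own s e = Some (K, u)" using sel_None[of "candE s e"] unfolding own_def by fastforce
  have c: "(K, u) \<in> candE s e" and mn: "\<And>h. h \<in> candE s e \<Longrightarrow> width (K, u) \<le> width h"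
    using selD[OF fin_cand(1)] Ku unfolding own_def by blast+
  have cg: "(K, u) \<in> gaps s" "u \<le> e" "e < cn K u" using c unfolding candE_iff by auto
  note g = gapD[OF cg(1)]
  have KS: "K \<in> side s" using g unfolding side_def by simp
  have "inside f K"
  proof (cases f)
    case None then show ?thesis unfolding inside_def by simp
  next
    case (Some h)
    obtain K' v where h: "h = (K', v)" by force
    have ch: "(K', v) \<in> candE s e" using f e Some h unfolding faces_def in_face_def candE_iff by auto
    have "(K', v) \<in> candK K"
      by (rule gap_cmp[of _ _ s]) (use ch cg mn[OF ch] Some h ne Ku in \<open>auto simp: candE_iff width_def\<close>)
    then show ?thesis unfolding inside_def using Some h by blast
  qed
  from kid_ex[OF KS f this] obtain M where M: "M \<in> kids s f" "fst_att M \<le> fst_att K" "lst_att K \<le> lst_att M" by blast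
  then show False using nk[OF M(1)] cg g by linarith
qed

lemma kids_gap:
  assumes "(K, v) \<in> gaps s" "M \<in> kids s (Some (K, v))"
  shows "M \<in> W" "sd M = s" "M \<noteq> K" "v \<le> fst_att M" "lst_att M \<le> cn K v"
proof -
  have "(K, v) \<in> candK M" using assms(2) selD(1)[OF fin_cand(2)] unfolding kids_def par_def by auto
  then show "M \<in> W" "sd M = s" "M \<noteq> K" "v \<le> fst_att M" "lst_att M \<le> cn K v"
    using assms(2) sideD unfolding candK_iff kids_def by auto
qed

lemma att_gap:
  assumes g: "(K, v) \<in> gaps s" and x: "att s x" "v < x" "x < cn K v"
  obtains M where "M \<in> kids s (Some (K, v))" "fst_att M \<le> x" "x \<le> lst_att M"
proof -
  note gd = gapD[OF g]
  obtain L where L: "L \<in> W" "sd L = s" "P L x" using x unfolding att_def by blast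
  have "L \<noteq> K" using consD(4)[OF gd(5)] x L by blast
  then have "inside (Some (K, v)) L" using L_in[OF g L(1,2) _ L(3)] x unfolding inside_def by blast
  then obtain M where M: "M \<in> kids s (Some (K, v))" "fst_att M \<le> fst_att L" "lst_att L \<le> lst_att M"
    using kid_ex[of L s "Some (K, v)"] g L unfolding faces_def side_def by auto
  have "x \<in> feet L" by (rule feetI) (use L x gd in auto)
  then show ?thesis using that[OF M(1)] M feet_bounds(4,5)[OF L(1)] by force
qed

lemma att_root:
  assumes "att s x"
  obtains M where "M \<in> kids s None" "fst_att M \<le> x mod n" "x mod n \<le> lst_att M"
proof -
  obtain L where L: "L \<in> W" "sd L = s" "P L x" using assms unfolding att_def by blast
  then obtain M where M: "M \<in> kids s None" "fst_att M \<le> fst_att L" "lst_att L \<le> lst_att M"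
    using kid_ex[of L s None] unfolding faces_def side_def inside_def by auto
  have "x mod n \<in> feet L" by (rule feetI) (use L n_pos per_mod in auto)
  then show ?thesis using that[OF M(1)] M feet_bounds(4,5)[OF L(1)] by force
qed

lemma cons_wrap: assumes "K \<in> W" shows "cons K (lst_att K) (fst_att K + n)"
proof -
  note b = feet_bounds[OF assms] and f = feetD[OF feet_bounds(1)[OF assms]] and l = feetD[OF feet_bounds(2)[OF assms]]
  have "\<not> P K i" if i: "lst_att K < i" "i < fst_att K + n" for i
  proof
    assume p: "P K i"
    show False
    proof (cases "i < n")
      case True
      then have "i \<in> feet K" using feetI[OF p] i l by linarith
      then show False using b(5) i by force
    next
      case False
      then have "i - n \<in> feet K" using feetI[of K "i - n"] per_sub p i f by auto
      then show False using b(4) i by force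
    qed
  qed
  then show ?thesis unfolding cons_def using f l per by auto
qed

text \<open>If the spans overlapped, \<open>L_in\<close> would put one bridge into a gap of the
  other, but no gap encloses a bridge whose parent is \<open>None\<close>.\<close>

lemma root_order:
  assumes "M1 \<in> kids s None" "M2 \<in> kids s None" "M1 \<noteq> M2" "fst_att M1 \<le> fst_att M2"
  shows "lst_att M1 \<le> fst_att M2"
proof (rule ccontr)
  assume no: "\<not> ?thesis"
  have W1: "M1 \<in> W" "sd M1 = s" and W2: "M2 \<in> W" "sd M2 = s" using assms sideD unfolding kids_def by auto
  have nn: "candK M1 = {}" "candK M2 = {}" using assms sel_None unfolding kids_def par_def by auto
  let ?S = "{x \<in> feet M1. x \<le> fst_att M2}"
  have fS: "finite ?S" using finite_feet by simp
  have "fst_att M1 \<in> ?S" using feet_bounds(1)[OF W1(1)] assms(4) by simp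
  then have aS: "Max ?S \<in> ?S" using Max_in[OF fS] by blast
  define a where "a = Max ?S"
  have a: "a \<in> feet M1" "a \<le> fst_att M2" using aS a_def by auto
  have g: "(M1, a) \<in> gaps s" using a W1 no unfolding gaps_def corners_def side_def by auto
  note gd = gapD[OF g]
  have b: "fst_att M2 < cn M1 a"
  proof (rule ccontr)
    assume "\<not> ?thesis"
    then have "cn M1 a \<in> ?S" using feetI[of M1 "cn M1 a"] consD(3)[OF gd(5)] gd by auto
    then show False using Max_ge[OF fS] gd(9) a_def by force
  qed
  have pf: "P M2 (fst_att M2)" using feetD[OF feet_bounds(1)[OF W2(1)]] by simp
  show False
  proof (cases "a = fst_att M2")
    case False
    then show False using L_in[OF g W2 assms(3)[symmetric] pf] a b nn by auto
  next
    case True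
    have h: "(M2, a) \<in> gaps s" using feet_bounds(1,3)[OF W2(1)] True W2 unfolding gaps_def corners_def side_def by auto
    note hd = gapD[OF h]
    show False
    proof (cases "cn M2 a \<le> cn M1 a")
      case True
      then show False using L_in[OF g W2 assms(3)[symmetric] consD(2)[OF hd(5)], of "cn M2 a"] consD(3)[OF hd(5)] hd(9) nn by auto
    next
      case False
      then show False using L_in[OF h W1 assms(3) consD(3)[OF gd(5)]] gd(9) nn by auto
    qed
  qed
qed


section \<open>Summing over the faces of one side\<close>

definition corner_sum where "corner_sum s f = (\<Sum>c\<in>{c \<in> corners s. face c = f}. - 2 - corner_charge (fst c) (snd c))"
definition edge_sum where "edge_sum s f = (\<Sum>e\<in>{e \<in> {0..<n}. own s e = f}. edge_weight s e)"

lemma edge_weight_mod: "edge_weight s (i mod n) = edge_weight s i"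
proof -
  have *: "edge_weight s (i + int k * n) = edge_weight s i" for i k
  proof (induction k)
    case (Suc k)
    have "edge_weight s (i + int (Suc k) * n) = edge_weight s (i + int k * n + n)" by (simp add: algebra_simps)
    then show ?case using edge_weight_per Suc by simp
  qed simp
  show ?thesis
  proof (cases "0 \<le> i div n")
    case True
    have "i mod n + int (nat (i div n)) * n = i" using True by simp
    then show ?thesis using *[of "i mod n" "nat (i div n)"] by simp
  next
    case False
    have "i + int (nat (- (i div n))) * n = i mod n" using False by (simp add: minus_div_mult_eq_mod[symmetric])
    then show ?thesis using *[of i "nat (- (i div n))"] by simp
  qed
qed

lemma inj_mod: "inj_on (\<lambda>i. i mod n) {a..<a + n}"
proof (rule inj_onI)
  fix x y assume xy: "x \<in> {a..<a + n}" "y \<in> {a..<a + n}" "x mod n = y mod n"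
  then have "n dvd x - y" by (simp add: mod_eq_dvd_iff)
  moreover have "\<bar>x - y\<bar> < n" using xy by auto
  ultimately show "x = y" using zdvd_imp_le[of n "\<bar>x - y\<bar>"] by force
qed

text \<open>Only an upper bound is needed, and weights are nonpositive, so any known part of the
  edges of a face will do.\<close>

lemma edge_sum_le:
  assumes I: "I \<subseteq> {a..<a + n}" and own: "\<And>i. i \<in> I \<Longrightarrow> own s (i mod n) = f"
  shows "edge_sum s f \<le> (\<Sum>i\<in>I. edge_weight s i)"
proof -
  have inj: "inj_on (\<lambda>i. i mod n) I" using inj_mod I by (rule inj_on_subset)
  let ?E = "{e \<in> {0..<n}. own s e = f}"
  have fE: "finite ?E" by (rule finite_subset[of _ "{0..<n}"]) auto
  have sub: "(\<lambda>i. i mod n) ` I \<subseteq> ?E" using own n_pos by auto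
  have "(\<Sum>e\<in>?E. edge_weight s e) = (\<Sum>e\<in>?E - (\<lambda>i. i mod n) ` I. edge_weight s e) + (\<Sum>e\<in>(\<lambda>i. i mod n) ` I. edge_weight s e)"
    using sum.subset_diff[OF sub fE] by simp
  also have "\<dots> \<le> (\<Sum>e\<in>(\<lambda>i. i mod n) ` I. edge_weight s e)"
    using sum_nonpos[of "?E - (\<lambda>i. i mod n) ` I" "edge_weight s"] edge_weight_nonpos by auto
  also have "\<dots> = (\<Sum>i\<in>I. edge_weight s i)" using sum.reindex[OF inj, of "edge_weight s"] by (simp add: o_def edge_weight_mod)
  finally show ?thesis unfolding edge_sum_def .
qed

lemma sum_shift: "(\<Sum>i\<in>{v..<v + t}. edge_weight s i) = (\<Sum>i\<in>{0..<t}. edge_weight s (v + i))"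
  by (rule sum.reindex_bij_witness[of _ "\<lambda>i. v + i" "\<lambda>i. i - v"]) auto

lemma corner_sum_le: "corner_sum s f \<le> - 2 * int (card {c \<in> corners s. face c = f})"
proof -
  have "corner_sum s f \<le> (\<Sum>c\<in>{c \<in> corners s. face c = f}. - 2)"
    unfolding corner_sum_def by (rule sum_mono) (use corner_charge_nonneg in auto)
  then show ?thesis by simp
qed

lemma edge_sum_nonpos: "edge_sum s f \<le> 0"
  unfolding edge_sum_def using edge_weight_nonpos by (intro sum_nonpos)

text \<open>A child turns the corner at its last foot towards the enclosing face, and a gap has its
  own corner in addition. So k children mean k + 1 corners for a gap and k for
  \<open>None\<close>.\<close>

lemma corners_face:
  "{c \<in> corners s. face c = f} =
     (\<lambda>M. (M, lst_att M)) ` kids s f \<union> (case f of None \<Rightarrow> {} | Some g \<Rightarrow> if g \<in> gaps s then {g} else {})"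
proof -
  have "c \<in> corners s \<and> face c = f \<longleftrightarrow> (c \<in> (\<lambda>M. (M, lst_att M)) ` kids s f) \<or> c \<in> gaps s \<and> f = Some c" for c
  proof (cases c)
    case (Pair K v)
    show ?thesis
    proof (cases "v < lst_att K")
      case True
      then show ?thesis unfolding Pair face_def gaps_def by auto
    next
      case False
      have "(K, v) \<in> corners s \<Longrightarrow> v = lst_att K" using False feet_bounds(5) unfolding corners_def side_def by force
      moreover have "K \<in> side s \<Longrightarrow> (K, lst_att K) \<in> corners s" using feet_bounds(2) unfolding corners_def side_def by auto
      ultimately show ?thesis unfolding Pair face_def kids_def gaps_def corners_def by auto
    qed
  qed
  then show ?thesis by (auto split: option.splits)
qed

lemma fin_kids: "finite (kids s f)" unfolding kids_def using fin_side by simp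

lemma card_kid_corners: "card ((\<lambda>M. (M, lst_att M)) ` kids s f) = card (kids s f)"
  by (rule card_image) (auto simp: inj_on_def)

lemma card_corners_gap:
  assumes "g \<in> gaps s"
  shows "card {c \<in> corners s. face c = Some g} = card (kids s (Some g)) + 1"
proof -
  obtain K v where g: "g = (K, v)" by force
  have "g \<notin> (\<lambda>M. (M, lst_att M)) ` kids s (Some g)" using gapD(4)[of K v s] assms g by auto
  then show ?thesis unfolding corners_face using card_kid_corners fin_kids assms by simp
qed

lemma card_corners_root: "card {c \<in> corners s. face c = None} = card (kids s None)"
  unfolding corners_face using card_kid_corners by simp

lemma trans2_sum:
  assumes T: "trans2 K1 K2 v1 t1 v2 t2" and s: "sd K1 = s"
    and own: "\<And>i. v1 \<le> i \<Longrightarrow> i < v1 + t1 \<Longrightarrow> own s (i mod n) = f" "\<And>i. v2 \<le> i \<Longrightarrow> i < v2 + t2 \<Longrightarrow> own s (i mod n) = f"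
    and c: "{c \<in> corners s. face c = f} = {(K1, v1), (K2, v2)}"
  shows "6 + corner_sum s f + edge_sum s f \<le> 0"
proof -
  note t = trans2D[OF T]
  have ne: "(K1, v1) \<noteq> (K2, v2)" using t(3) by simp
  have cs: "corner_sum s f = - 4 - corner_charge K1 v1 - corner_charge K2 v2" unfolding corner_sum_def c using ne by simp
  have "edge_sum s f \<le> (\<Sum>i\<in>{v1..<v1 + t1} \<union> {v2..<v2 + t2}. edge_weight s i)"
    by (rule edge_sum_le[of _ v1]) (use own t in auto)
  also have "\<dots> = (\<Sum>i\<in>{v1..<v1 + t1}. edge_weight s i) + (\<Sum>i\<in>{v2..<v2 + t2}. edge_weight s i)"
    by (rule sum.union_disjoint) (use t in auto)
  also have "\<dots> = (\<Sum>i\<in>{0..<t1}. edge_weight s (v1 + i)) + (\<Sum>i\<in>{0..<t2}. edge_weight s (v2 + i))" by (simp only: sum_shift)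
  finally have e: "edge_sum s f \<le> \<dots>" .
  have net: "- corner_charge K v + (\<Sum>i\<in>{0..<t}. edge_weight s (v + i)) \<le> net K v t" if "sd K = s" for K v t
    using that corner_charge_nonneg[of K v] unfolding net_def by auto
  show ?thesis using cs e net[OF s, of v1 t1] net[of K2 v2 t2] s t(4) trans2_bound[OF T] by linarith
qed

lemma leaf_sum:
  assumes "leaf s K v l" "v + l + 1 \<le> v + n" "\<And>i. v \<le> i \<Longrightarrow> i \<le> v + l \<Longrightarrow> own s (i mod n) = f"
    "card {c \<in> corners s. face c = f} = 1"
  shows "6 + corner_sum s f + edge_sum s f \<le> 0"
proof -
  have "edge_sum s f \<le> (\<Sum>i\<in>{v..<v + (l + 1)}. edge_weight s i)"
    by (rule edge_sum_le[of _ v]) (use assms in auto)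
  also have "\<dots> \<le> - 4" unfolding sum_shift using leaf_bound[OF assms(1)] .
  finally show ?thesis using corner_sum_le[of s f] assms(4) by simp
qed

text \<open>Without children the gap is a leaf, with one child it is a face as in
  \<open>trans2\<close>, and with two or more its three corners alone cancel the 6.\<close>

lemma face_ineq_gap:
  assumes g: "(K, v) \<in> gaps s"
  shows "6 + corner_sum s (Some (K, v)) + edge_sum s (Some (K, v)) \<le> 0"
proof -
  let ?f = "Some (K, v)"
  note gd = gapD[OF g]
  have fF: "?f \<in> faces s" using g unfolding faces_def by blast
  have own: "own s (i mod n) = ?f" if "v \<le> i" "i < cn K v" "\<And>M. M \<in> kids s ?f \<Longrightarrow> \<not> (fst_att M \<le> i \<and> i < lst_att M)" for i
  proof -
    have "i mod n = i" using that gd by simp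
    then show ?thesis using own_eq[OF fF, of i] that unfolding in_face_def by simp
  qed
  have blt: "cn K v < v + n" using gd by linarith
  consider "card (kids s ?f) = 0" | "card (kids s ?f) = 1" | "2 \<le> card (kids s ?f)" by linarith
  then show ?thesis
  proof cases
    case 1
    then have nk: "kids s ?f = {}" using fin_kids by simp
    have "\<not> att s i" if "v < i" "i < cn K v" for i using att_gap[OF g _ that] nk by blast
    then have "leaf s K v (cn K v - v - 1)"
      unfolding leaf_def using gd consD(2,3)[OF gd(5)] by auto
    then show ?thesis
      by (rule leaf_sum) (use own nk blt card_corners_gap[OF g] in auto)
  next
    case 2
    then obtain M where M: "kids s ?f = {M}" using card_1_singletonE by metis
    note Md = kids_gap[OF g, of M, unfolded M, simplified]
    note Mb = feet_bounds[OF Md(1)]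
    have un: "i \<ge> fst_att M \<and> i \<le> lst_att M" if "v < i" "i < cn K v" "att s i" for i using att_gap[OF g that(3,1,2)] M by auto
    show ?thesis
    proof (rule trans2_sum[of K M v "fst_att M - v" "lst_att M" "cn K v - lst_att M"])
      have "cons M (lst_att M) (v + (fst_att M - v) + n)" using cons_wrap[OF Md(1)] by simp
      then show "trans2 K M v (fst_att M - v) (lst_att M) (cn K v - lst_att M)"
        unfolding trans2_def using gd Md Mb(3) blt un by force
      show "{c \<in> corners s. face c = ?f} = {(K, v), (M, lst_att M)}" unfolding corners_face M using g by auto
    qed (use gd own M Mb(3) Md in auto)
  next
    case 3
    then show ?thesis using card_corners_gap[OF g] corner_sum_le[of s ?f] edge_sum_nonpos[of s ?f] by simp
  qed
qed

text \<open>\<open>None\<close> has no corner of its own, so the cases are shifted by one child. Its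
  stretches pass the edge from \<open>n - 1\<close> to 0, whence the reductions modulo
  \<open>n\<close>.\<close>

lemma face_ineq_root:
  assumes "side s \<noteq> {}"
  shows "6 + corner_sum s None + edge_sum s None \<le> 0"
proof -
  have fF: "None \<in> faces s" unfolding faces_def by blast
  have own: "own s (i mod n) = None" if "\<And>M. M \<in> kids s None \<Longrightarrow> \<not> (fst_att M \<le> i mod n \<and> i mod n < lst_att M)" for i
    using own_eq[OF fF, of "i mod n"] that unfolding in_face_def by simp
  have kd: "M \<in> W \<and> sd M = s" if "M \<in> kids s None" for M using that sideD unfolding kids_def by blast
  have md: "i mod n = (if i < n then i else i - n)" if "0 \<le> i" "i < 2 * n" for i
    using that mod_pos_pos_trivial[of "i - n" n] mod_add_self2[of "i - n" n] by auto
  have "kids s None \<noteq> {}"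
  proof -
    obtain L where "L \<in> side s" using assms by blast
    then show ?thesis using kid_ex[of L s None] fF unfolding inside_def by blast
  qed
  then have "card (kids s None) \<noteq> 0" using fin_kids by simp
  then consider "card (kids s None) = 1" | "card (kids s None) = 2" | "3 \<le> card (kids s None)" by linarith
  then show ?thesis
  proof cases
    case 1
    then obtain M where M: "kids s None = {M}" using card_1_singletonE by metis
    have Md: "M \<in> W" "sd M = s" using kd M by auto
    note Mb = feet_bounds[OF Md(1)] and lp = feetD[OF feet_bounds(2)[OF Md(1)]] and fp = feetD[OF feet_bounds(1)[OF Md(1)]]
    have c: "cons M (lst_att M) (fst_att M + n)" using cons_wrap Md by blast
    have un: "\<not> att s i" if "lst_att M < i" "i < fst_att M + n" for i
      using att_root[of s i] M md[of i] that lp fp Mb(3) by (auto split: if_splits)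
    have l2: "lst_att M + 2 \<le> fst_att M + n" using cons_ge2[OF Md(1) c] .
    have "leaf s M (lst_att M) (fst_att M + n - lst_att M - 1)"
      unfolding leaf_def using Md consD(2,3)[OF c] un l2 by auto
    then show ?thesis
    proof (rule leaf_sum)
      show "card {c \<in> corners s. face c = None} = 1" using 1 card_corners_root by simp
      show "own s (i mod n) = None" if "lst_att M \<le> i" "i \<le> lst_att M + (fst_att M + n - lst_att M - 1)" for i
        by (rule own) (use M md[of i] that lp fp Mb(3) in \<open>auto split: if_splits\<close>)
    qed (use Mb(3) in auto)
  next
    case 2
    then obtain M1 M2 where M: "kids s None = {M1, M2}" "M1 \<noteq> M2" by (meson card_2_iff)
    obtain K1 K2 where K: "kids s None = {K1, K2}" "K1 \<noteq> K2" "fst_att K1 \<le> fst_att K2"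
      using M that[of M1 M2] that[of M2 M1] by (cases "fst_att M1 \<le> fst_att M2") (auto simp: insert_commute)
    have ord: "lst_att K1 \<le> fst_att K2" using root_order[of K1 s K2] K by auto
    have d1: "K1 \<in> W" "sd K1 = s" and d2: "K2 \<in> W" "sd K2 = s" using kd K by auto
    note b1 = feet_bounds[OF d1(1)] and l1 = feetD[OF feet_bounds(2)[OF d1(1)]] and f1 = feetD[OF feet_bounds(1)[OF d1(1)]]
    note b2 = feet_bounds[OF d2(1)] and l2 = feetD[OF feet_bounds(2)[OF d2(1)]] and f2 = feetD[OF feet_bounds(1)[OF d2(1)]]
    have un: "\<not> att s i" if "lst_att K1 < i \<and> i < fst_att K2 \<or> lst_att K2 < i \<and> i < fst_att K1 + n" for i
    proof
      assume "att s i"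
      then obtain M where M: "M \<in> kids s None" "fst_att M \<le> i mod n" "i mod n \<le> lst_att M" by (rule att_root)
      have "0 \<le> i" "i < 2 * n" using that l1 l2 f1 f2 by linarith+
      define j where "j = i mod n"
      have m: "j = (if i < n then i else i - n)" unfolding j_def by (rule md) fact+
      have "M = K1 \<or> M = K2" using M(1) K by auto
      moreover have "j < fst_att K1 \<or> lst_att K1 < j" "j < fst_att K2 \<or> lst_att K2 < j"
        using m that l1 l2 f1 f2 b1(3) b2(3) ord by (smt (verit, best))+
      ultimately show False using M(2,3) unfolding j_def by fastforce
    qed
    have ow: "own s (i mod n) = None" if "lst_att K1 \<le> i \<and> i < fst_att K2 \<or> lst_att K2 \<le> i \<and> i < fst_att K1 + n" for i
    proof (rule own)
      fix M assume "M \<in> kids s None"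
      then have "M = K1 \<or> M = K2" using K by auto
      have "0 \<le> i" "i < 2 * n" using that l1 l2 f1 f2 by linarith+
      define j where "j = i mod n"
      have m: "j = (if i < n then i else i - n)" unfolding j_def by (rule md) fact+
      have "j < fst_att K1 \<or> lst_att K1 \<le> j" "j < fst_att K2 \<or> lst_att K2 \<le> j"
        using m that l1 l2 f1 f2 b1(3) b2(3) ord by (smt (verit, best))+
      then show "\<not> (fst_att M \<le> i mod n \<and> i mod n < lst_att M)" using \<open>M = K1 \<or> M = K2\<close> unfolding j_def by fastforce
    qed
    show ?thesis
    proof (rule trans2_sum[of K1 K2 "lst_att K1" "fst_att K2 - lst_att K1" "lst_att K2" "fst_att K1 + n - lst_att K2"])
      show "trans2 K1 K2 (lst_att K1) (fst_att K2 - lst_att K1) (lst_att K2) (fst_att K1 + n - lst_att K2)"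
        unfolding trans2_def using d1 d2 K(2) ord l1 l2 f1 f2 b1(3) b2(3) un cons_wrap[OF d1(1)] cons_wrap[OF d2(1)] by auto
      show "{c \<in> corners s. face c = None} = {(K1, lst_att K1), (K2, lst_att K2)}" unfolding corners_face K(1) by auto
    qed (use d1 ow in auto)
  next
    case 3
    then show ?thesis using card_corners_root[of s] corner_sum_le[of s None] edge_sum_nonpos[of s None] by simp
  qed
qed

text \<open>There is no corner and no request, so the sum is at most \<open>6 - n\<close>, and three
  feet of one bridge force \<open>n \<ge> 6\<close>.\<close>

lemma face_ineq_empty:
  assumes "side s = {}"
  shows "6 + corner_sum s None + edge_sum s None \<le> 0"
proof -
  have na: "\<not> att s i" for i using assms unfolding att_def side_def by auto
  then have r: "\<not> req (\<not> s) e" for e using req_mid by blast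
  have g: "gaps s = {}" unfolding gaps_def corners_def using assms by auto
  then have o: "own s e = None" for e unfolding own_def sel_None candE_def by auto
  have c: "corner_sum s None \<le> 0" using corner_sum_le[of s None] by simp
  have "{e \<in> {0..<n}. own s e = None} = {0..<n}" using o by auto
  then have "edge_sum s None = (\<Sum>e\<in>{0..<n}. edge_weight s e)" unfolding edge_sum_def by simp
  also have "\<dots> \<le> (\<Sum>e\<in>{0..<n}. - 1)" by (rule sum_mono) (use edge_weight_le r in auto)
  finally have "edge_sum s None \<le> - n" using n_pos by simp
  moreover obtain K where "K \<in> W" "P K 0" using cov by blast
  ultimately show ?thesis using n_ge6 c by force
qed

lemma face_ineq: "f \<in> faces s \<Longrightarrow> 6 + corner_sum s f + edge_sum s f \<le> 0"
  using face_ineq_gap face_ineq_root[of s] face_ineq_empty[of s] unfolding faces_def by (cases "side s = {}"; cases f) auto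

lemma side_total: "6 * int (card (faces s)) + (\<Sum>c\<in>corners s. - 2 - corner_charge (fst c) (snd c)) + (\<Sum>e\<in>{0..<n}. edge_weight s e) \<le> 0"
proof -
  have ff: "finite (faces s)" unfolding faces_def using fin_gaps by simp
  have "face ` corners s \<subseteq> faces s"
  proof
    fix f assume "f \<in> face ` corners s"
    then obtain K v where c: "(K, v) \<in> corners s" "f = face (K, v)" by force
    show "f \<in> faces s"
    proof (cases "v < lst_att K")
      case True then show ?thesis using c unfolding face_def faces_def gaps_def by auto
    next
      case False
      have K: "sd K = s" using c unfolding corners_def side_def by simp
      show ?thesis
      proof (cases "par K")
        case None then show ?thesis using c False unfolding face_def faces_def by simp
      next
        case (Some g)
        then have "g \<in> candK K" using selD(1)[OF fin_cand(2)] unfolding par_def by blast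
        then have "g \<in> gaps s" using K unfolding candK_def by auto
        then show ?thesis using c False Some unfolding face_def faces_def by simp
      qed
    qed
  qed
  then have 1: "(\<Sum>f\<in>faces s. corner_sum s f) = (\<Sum>c\<in>corners s. - 2 - corner_charge (fst c) (snd c))"
    unfolding corner_sum_def by (rule sum.group[OF fin_corners ff])
  have "own s ` {0..<n} \<subseteq> faces s"
  proof
    fix f assume "f \<in> own s ` {0..<n}"
    then obtain e where e: "f = own s e" by blast
    show "f \<in> faces s"
    proof (cases f)
      case None then show ?thesis unfolding faces_def by simp
    next
      case (Some g)
      then have "g \<in> candE s e" using e selD(1)[OF fin_cand(1)] unfolding own_def by metis
      then show ?thesis using Some unfolding candE_def faces_def by auto
    qed
  qed
  then have 2: "(\<Sum>f\<in>faces s. edge_sum s f) = (\<Sum>e\<in>{0..<n}. edge_weight s e)"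
    unfolding edge_sum_def by (rule sum.group[OF finite_atLeastLessThan_int ff])
  have "(\<Sum>f\<in>faces s. 6 + corner_sum s f + edge_sum s f) \<le> 0" by (rule sum_nonpos) (rule face_ineq)
  then show ?thesis using 1 2 by (simp add: sum.distrib algebra_simps)
qed

section \<open>The count over both sides\<close>

lemma int_card_remove: "finite S \<Longrightarrow> x \<in> S \<Longrightarrow> int (card (S - {x})) = int (card S) - 1"
  using card_Suc_Diff1[of S x] by simp

text \<open>Euler's formula for one side: a bridge with d feet has d - 1 gaps, and
  \<open>None\<close> is one further face.\<close>

lemma card_faces: "int (card (faces s)) = 1 + (\<Sum>K\<in>side s. int (card (feet K)) - 1)"
proof -
  have "gaps s = Sigma (side s) (\<lambda>K. feet K - {lst_att K})"
    unfolding gaps_def corners_def using feet_bounds(5) sideD by force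
  then have "card (gaps s) = (\<Sum>K\<in>side s. card (feet K - {lst_att K}))"
    using card_SigmaI[of "side s" "\<lambda>K. feet K - {lst_att K}"] fin_side finite_feet by simp
  moreover have "int (card (feet K - {lst_att K})) = int (card (feet K)) - 1" if "K \<in> side s" for K
    using int_card_remove[OF finite_feet feet_bounds(2)] that sideD by blast
  ultimately have "int (card (gaps s)) = (\<Sum>K\<in>side s. int (card (feet K)) - 1)" by simp
  moreover have "card (faces s) = 1 + card (gaps s)"
  proof -
    have "card (Some ` gaps s) = card (gaps s)" by (rule card_image) simp
    then show ?thesis unfolding faces_def using fin_gaps by (subst card_insert_disjoint) auto
  qed
  ultimately show ?thesis by simp
qed

definition two where "two v \<longleftrightarrow> att True v \<and> att False v"
definition deg where "deg s v = int (card {K \<in> side s. P K v})"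

text \<open>The bridge at \<open>v\<close> whose next foot comes first is not pinched, so at most
  all the others receive 2. At a \<open>centre\<close> the bridge \<open>K'\<close> of the right
  leaf plays this part, as its next foot has the least possible distance 2. The bridge
  \<open>K\<close> of the left leaf is relieved, and the unit saved there is the one spent on the
  centre.\<close>

lemma vertex_pay:
  assumes "att s v"
  shows "(\<Sum>K\<in>{K \<in> side s. P K v}. corner_charge K v) + of_bool (centre s v) \<le> 2 * (deg s v - 1)"
proof -
  let ?S = "{K \<in> side s. P K v}"
  have fS: "finite ?S" using fin_side by simp
  have ne: "?S \<noteq> {}" using assms unfolding att_def side_def by auto
  have cw2: "corner_charge K v \<le> 2" for K unfolding corner_charge_def by (auto simp: of_bool_def)
  have S0: "K \<in> W \<and> sd K = s \<and> P K v" if "K \<in> ?S" for K using that sideD by auto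
  show ?thesis
  proof (cases "centre s v")
    case False
    define K where "K = arg_min_on (\<lambda>K. cn K v) ?S"
    have K: "K \<in> ?S" "\<And>L. L \<in> ?S \<Longrightarrow> cn K v \<le> cn L v"
      using arg_min_if_finite(1)[OF fS ne, of "\<lambda>K. cn K v"] arg_min_least[OF fS ne, of _ "\<lambda>K. cn K v"] K_def by auto
    have "\<not> pinched K v" unfolding pinched_def using K S0[OF K(1)] unfolding side_def by force
    then have c0: "corner_charge K v = 0" unfolding corner_charge_def by simp
    have "(\<Sum>K\<in>?S. corner_charge K v) = corner_charge K v + (\<Sum>L\<in>?S - {K}. corner_charge L v)" by (rule sum.remove[OF fS K(1)])
    also have "\<dots> \<le> (\<Sum>L\<in>?S - {K}. 2)" unfolding c0 using cw2 by (simp add: sum_mono del: sum_constant)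
    also have "\<dots> = 2 * (deg s v - 1)" unfolding deg_def using int_card_remove[OF fS K(1)] by simp
    finally show ?thesis using False by simp
  next
    case True
    then obtain K K' where K: "K \<noteq> K'" "leaf s K (v - 2) 1" "leaf s K' v 1" unfolding centre_def by blast
    have KS: "K \<in> ?S" using leafD(1,2,5)[OF K(2)] unfolding side_def by simp
    have KS': "K' \<in> ?S" using leafD(1,2,4)[OF K(3)] unfolding side_def by simp
    have cn': "cn K' v \<le> v + 2"
      using consD(4)[OF cn_cons(1), of K' v "v + 2"] S0[OF KS'] leafD(5)[OF K(3)] by (force simp: add.commute)
    have "v + 2 \<le> cn L v" if "L \<in> ?S" for L using cons_ge2 cn_cons(1) S0[OF that] by blast
    then have "\<not> pinched K' v" unfolding pinched_def using cn' S0[OF KS'] unfolding side_def by force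
    then have c0: "corner_charge K' v = 0" unfolding corner_charge_def by simp
    have "relieved K v" unfolding relieved_def using True K(2) leafD(2)[OF K(2)] by simp
    then have c1: "corner_charge K v \<le> 1" unfolding corner_charge_def by simp
    have "(\<Sum>K\<in>?S. corner_charge K v) = corner_charge K' v + (\<Sum>L\<in>?S - {K'}. corner_charge L v)" by (rule sum.remove[OF fS KS'])
    also have "(\<Sum>L\<in>?S - {K'}. corner_charge L v) = corner_charge K v + (\<Sum>L\<in>?S - {K'} - {K}. corner_charge L v)"
      by (rule sum.remove) (use fS KS K(1) in auto)
    also have "(\<Sum>L\<in>?S - {K'} - {K}. corner_charge L v) \<le> (\<Sum>L\<in>?S - {K'} - {K}. 2)" by (rule sum_mono) (rule cw2)
    finally have "(\<Sum>K\<in>?S. corner_charge K v) \<le> 1 + 2 * int (card (?S - {K'} - {K}))" using c0 c1 by simp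
    moreover have "int (card (?S - {K'} - {K})) = deg s v - 2"
    proof -
      have "{K, K'} \<subseteq> ?S" using KS KS' by auto
      moreover have "card {K, K'} = 2" using K(1) by simp
      moreover have "?S - {K'} - {K} = ?S - {K, K'}" by auto
      ultimately show ?thesis unfolding deg_def using card_Diff_subset[of "{K, K'}" ?S] card_mono[OF fS, of "{K, K'}"]
        by (simp add: of_nat_diff)
    qed
    ultimately show ?thesis using True by simp
  qed
qed

lemma sum_shift1:
  fixes h :: "int \<Rightarrow> int"
  assumes "\<And>i. h (i + n) = h i"
  shows "(\<Sum>e\<in>{0..<n}. h (e + 1)) = (\<Sum>e\<in>{0..<n}. h e)"
proof -
  have "(\<Sum>e\<in>{0..<n}. h (e + 1)) = (\<Sum>e\<in>{1..<n + 1}. h e)"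
    by (rule sum.reindex_bij_witness[of _ "\<lambda>i. i - 1" "\<lambda>i. i + 1"]) auto
  also have "{1..<n + 1} = insert n {1..<n}" using n_pos by auto
  also have "(\<Sum>e\<in>insert n {1..<n}. h e) = h n + (\<Sum>e\<in>{1..<n}. h e)" by (subst sum.insert) auto
  also have "h n = h 0" using assms[of 0] by simp
  also have "h 0 + (\<Sum>e\<in>{1..<n}. h e) = (\<Sum>e\<in>insert 0 {1..<n}. h e)" by (subst sum.insert) auto
  also have "insert 0 {1..<n} = {0..<n}" using n_pos by auto
  finally show ?thesis .
qed

text \<open>If \<open>vertex_pay\<close> is used on both sides of a vertex with d feet, two of its
  2(d - 1) units are left. One is spent on the edge after it through \<open>iiR\<close>, the other
  on the edge before it through \<open>iiL\<close>. Two sides cannot claim the same unit, since each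
  claim requires the far end of the edge to be off the other side.\<close>

lemma iiR_two: "of_bool (iiR True e) + of_bool (iiR False e) \<le> (of_bool (two e) :: int)"
proof -
  have "iiR s e \<Longrightarrow> two e \<and> \<not> att (\<not> s) (e + 1)" for s
  proof -
    assume "iiR s e"
    then obtain K where K: "leaf (\<not> s) K e 1" "att s e" unfolding iiR_def by blast
    have "two e" using leafD(7)[OF K(1)] K(2) unfolding two_def by (cases s) auto
    then show ?thesis using leafD(6)[OF K(1), of "e + 1"] by simp
  qed
  note this[of True] this[of False]
  moreover have "iiR s e \<Longrightarrow> att s (e + 1)" for s unfolding iiR_def by blast
  note this[of True] this[of False]
  ultimately show ?thesis by (auto simp: of_bool_def)
qed

lemma iiL_two: "of_bool (iiL True e) + of_bool (iiL False e) \<le> (of_bool (two (e + 1)) :: int)"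
proof -
  have "iiL s e \<Longrightarrow> two (e + 1) \<and> \<not> att (\<not> s) e" for s
  proof -
    assume "iiL s e"
    then obtain K where K: "leaf (\<not> s) K (e - 1) 1" "att s (e + 1)" unfolding iiL_def by blast
    have "two (e + 1)" using leafD(8)[OF K(1)] K(2) unfolding two_def by (cases s) auto
    then show ?thesis using leafD(6)[OF K(1), of e] by simp
  qed
  note this[of True] this[of False]
  moreover have "iiL s e \<Longrightarrow> att s e" for s unfolding iiL_def by blast
  note this[of True] this[of False]
  ultimately show ?thesis by (auto simp: of_bool_def)
qed

lemma corners_swap: "(\<Sum>c\<in>corners s. h (fst c) (snd c)) = (\<Sum>v\<in>{0..<n}. \<Sum>K\<in>{K \<in> side s. P K v}. h K v)"
proof -
  have "(\<Sum>c\<in>corners s. h (fst c) (snd c)) = (\<Sum>K\<in>side s. \<Sum>v\<in>feet K. h K v)"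
    unfolding corners_def using sum.Sigma[of "side s" feet h] fin_side finite_feet by (simp add: case_prod_beta)
  also have "\<dots> = (\<Sum>v\<in>{0..<n}. \<Sum>K\<in>{K \<in> side s. P K v}. h K v)"
    unfolding feet_def by (rule sum.swap_restrict) (use fin_side in auto)
  finally show ?thesis .
qed

lemma contradiction: False
proof -
  define D where "D s = (\<Sum>K\<in>side s. int (card (feet K)))" for s
  define N where "N s = (\<Sum>v\<in>{0..<n}. of_bool (att s v) :: int)" for s
  define Z where "Z s = int (card (side s))" for s
  have Dc: "int (card (corners s)) = D s" for s
    unfolding corners_def D_def using card_SigmaI[of "side s" feet] fin_side finite_feet by simp
  have Dv: "D s = (\<Sum>v\<in>{0..<n}. deg s v)" for s
    using corners_swap[of "\<lambda>_ _. 1 :: int" s] Dc[of s] unfolding deg_def by simp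
  have cf: "int (card (faces s)) = 1 + D s - Z s" for s unfolding card_faces D_def Z_def by (simp add: sum_subtractf)
  have D3: "3 * Z s \<le> D s" for s
  proof -
    have "(\<Sum>K\<in>side s. 3) \<le> D s" unfolding D_def by (rule sum_mono) (use card3 sideD feet_def in fastforce)
    then show ?thesis unfolding Z_def by simp
  qed
  have cwle: "(\<Sum>c\<in>corners s. corner_charge (fst c) (snd c)) + (\<Sum>v\<in>{0..<n}. of_bool (centre s v)) \<le> 2 * (D s - N s)" for s
  proof -
    have "(\<Sum>K\<in>{K \<in> side s. P K v}. corner_charge K v) + of_bool (centre s v) \<le> 2 * (deg s v - of_bool (att s v))" for v
    proof (cases "att s v")
      case True then show ?thesis using vertex_pay by simp
    next
      case False
      then have "{K \<in> side s. P K v} = {}" unfolding att_def side_def by auto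
      moreover have "\<not> centre s v" using False leafD(7) unfolding centre_def by blast
      ultimately show ?thesis using False unfolding deg_def by (simp only:) simp
    qed
    then have "(\<Sum>v\<in>{0..<n}. (\<Sum>K\<in>{K \<in> side s. P K v}. corner_charge K v) + of_bool (centre s v)) \<le> (\<Sum>v\<in>{0..<n}. 2 * (deg s v - of_bool (att s v)))"
      by (rule sum_mono)
    then show ?thesis unfolding corners_swap Dv N_def by (simp add: sum.distrib sum_subtractf sum_distrib_left[symmetric])
  qed
  have tot: "6 * (1 + D s - Z s) - 2 * D s - (\<Sum>c\<in>corners s. corner_charge (fst c) (snd c)) + (\<Sum>e\<in>{0..<n}. edge_weight s e) \<le> 0" for s
    using side_total[of s] unfolding cf by (simp add: sum_subtractf Dc)
  have wsum: "edge_weight True e + edge_weight False e \<ge> - 2 - of_bool (two e) - of_bool (two (e + 1)) - of_bool (centre True (e + 1)) - of_bool (centre False (e + 1))" for e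
    using iiR_two[of e] iiL_two[of e] unfolding edge_weight_def by simp
  have "(\<Sum>e\<in>{0..<n}. - 2 - of_bool (two e) - of_bool (two (e + 1)) - of_bool (centre True (e + 1)) - of_bool (centre False (e + 1)))
      \<le> (\<Sum>e\<in>{0..<n}. edge_weight True e + edge_weight False e)" by (rule sum_mono) (rule wsum)
  moreover have "(\<Sum>e\<in>{0..<n}. of_bool (two (e + 1)) :: int) = (\<Sum>e\<in>{0..<n}. of_bool (two e))"
    by (rule sum_shift1) (simp add: two_def att_per)
  moreover have "(\<Sum>e\<in>{0..<n}. of_bool (centre s (e + 1)) :: int) = (\<Sum>e\<in>{0..<n}. of_bool (centre s e))" for s
    by (rule sum_shift1) (simp add: centre_per)
  ultimately have W: "- 2 * n - 2 * (\<Sum>e\<in>{0..<n}. of_bool (two e)) - (\<Sum>e\<in>{0..<n}. of_bool (centre True e)) - (\<Sum>e\<in>{0..<n}. of_bool (centre False e))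
      \<le> (\<Sum>e\<in>{0..<n}. edge_weight True e) + (\<Sum>e\<in>{0..<n}. edge_weight False e)"
    using n_pos by (simp add: sum.distrib sum_subtractf)
  have "N True + N False = (\<Sum>v\<in>{0..<n}. 1 + of_bool (two v))"
    unfolding N_def sum.distrib[symmetric] by (rule sum.cong) (use cov2[of True] in \<open>auto simp: two_def of_bool_def\<close>)
  then have "N True + N False = n + (\<Sum>v\<in>{0..<n}. of_bool (two v))" using n_pos by (simp add: sum.distrib)
  note N12 = this
  \<comment> \<open>The final combination, over plain integers in place of the sums. It amounts to
    \<open>12 + 2 * (D1 + D2) \<le> 6 * (Z1 + Z2)\<close>, against three feet per bridge.\<close>
  have "N1 + N2 = n + t \<Longrightarrow> - 2 * n - 2 * t - c1 - c2 \<le> W1 + W2 \<Longrightarrow>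
      6 * (1 + D1 - Z1) - 2 * D1 - C1 + W1 \<le> 0 \<Longrightarrow> 6 * (1 + D2 - Z2) - 2 * D2 - C2 + W2 \<le> 0 \<Longrightarrow>
      C1 + c1 \<le> 2 * (D1 - N1) \<Longrightarrow> C2 + c2 \<le> 2 * (D2 - N2) \<Longrightarrow> 3 * Z1 \<le> D1 \<Longrightarrow> 3 * Z2 \<le> D2 \<Longrightarrow> False"
    for N1 N2 t c1 c2 W1 W2 D1 D2 Z1 Z2 C1 C2 :: int
  proof -
    assume h: "N1 + N2 = n + t" "- 2 * n - 2 * t - c1 - c2 \<le> W1 + W2"
      "6 * (1 + D1 - Z1) - 2 * D1 - C1 + W1 \<le> 0" "6 * (1 + D2 - Z2) - 2 * D2 - C2 + W2 \<le> 0"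
      "C1 + c1 \<le> 2 * (D1 - N1)" "C2 + c2 \<le> 2 * (D2 - N2)" "3 * Z1 \<le> D1" "3 * Z2 \<le> D2"
    have "12 + 4 * (D1 + D2) - 6 * (Z1 + Z2) + (W1 + W2) \<le> C1 + C2" using h(3,4) by (simp add: algebra_simps)
    moreover have "C1 + C2 + c1 + c2 + 2 * (n + t) \<le> 2 * (D1 + D2)" using h(1,5,6) by (simp add: algebra_simps)
    ultimately have "12 + 2 * (D1 + D2) - 6 * (Z1 + Z2) \<le> 0" using h(2) by (simp add: algebra_simps)
    then show False using h(7,8) by (simp add: algebra_simps)
  qed
  from this[OF N12 W tot[of True] tot[of False] cwle[of True] cwle[of False] D3[of True] D3[of False]] show False .
qed

end

section \<open>Minors from branch sets\<close>

lemma pair_graph_sym_rel: "pair_graph G \<Longrightarrow> sym_rel (parcs G)"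
proof -
  assume "pair_graph G"
  then interpret pair_graph G .
  show ?thesis by unfold_locales (use pair_sym_arcs in \<open>simp add: symmetric_def\<close>)
qed

lemma pair_graphI:
  assumes "finite (pverts G)" "parcs G \<subseteq> pverts G \<times> pverts G" "sym (parcs G)" "irrefl (parcs G)"
  shows "pair_graph G"
proof unfold_locales
  show "finite (parcs G)" using assms(1,2) by (meson finite_SigmaI finite_subset)
  show "symmetric (with_proj G)" using assms(3) by (simp add: symmetric_def)
qed (use assms in \<open>auto simp: irrefl_def\<close>)

lemma pair_graphD:
  assumes "pair_graph G"
  shows "finite (pverts G)" "finite (parcs G)" "parcs G \<subseteq> pverts G \<times> pverts G" "sym (parcs G)" "irrefl (parcs G)"
proof -
  interpret pair_graph G by fact
  show "finite (pverts G)" "finite (parcs G)" by (rule pair_finite_verts, rule pair_finite_arcs)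
  show "parcs G \<subseteq> pverts G \<times> pverts G" using in_arcsD1 in_arcsD2 by auto
  show "sym (parcs G)" using pair_sym_arcs by (simp add: symmetric_def)
  show "irrefl (parcs G)" using pair_no_loops by (force simp: irrefl_def)
qed

text \<open>Indices below 3 are one class, 3 to 5 the other. The sets are confined to
  \<open>pverts G\<close>, so that they can be followed through the minor operations.\<close>

definition branch_sets :: "'a pair_pre_digraph \<Rightarrow> (nat \<Rightarrow> 'a set) \<Rightarrow> bool" where
  "branch_sets G B \<longleftrightarrow> (\<forall>i<6. sym_rel.conn (parcs G) (B i) \<and> B i \<noteq> {} \<and> B i \<subseteq> pverts G) \<and>
     (\<forall>i<6. \<forall>j<6. i \<noteq> j \<longrightarrow> B i \<inter> B j = {}) \<and> (\<forall>i<3. \<forall>j. 3 \<le> j \<and> j < 6 \<longrightarrow> sym_rel.adj (parcs G) (B i) (B j))"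

lemma branch_setsD:
  assumes "branch_sets G B"
  shows "i < 6 \<Longrightarrow> sym_rel.conn (parcs G) (B i)" "i < 6 \<Longrightarrow> B i \<noteq> {}" "i < 6 \<Longrightarrow> B i \<subseteq> pverts G"
    "i < 6 \<Longrightarrow> j < 6 \<Longrightarrow> i \<noteq> j \<Longrightarrow> B i \<inter> B j = {}" "i < 3 \<Longrightarrow> 3 \<le> j \<Longrightarrow> j < 6 \<Longrightarrow> sym_rel.adj (parcs G) (B i) (B j)"
  using assms unfolding branch_sets_def by simp_all

lemma has_K33_minor_step: "minor_step G H \<Longrightarrow> has_K33_minor H \<Longrightarrow> has_K33_minor G"
  unfolding has_K33_minor_def graph_minor_def by (meson converse_rtranclp_into_rtranclp)

text \<open>Each operation shrinks the graph and keeps the branch sets: a vertex outside them is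
  deleted, an edge inside one is contracted, and once they are singletons covering the graph, an
  edge within a class is deleted. When no operation is left, the graph is
  \<open>K33\<close>.\<close>

lemma branch_sets_imp_minor:
  assumes "pair_graph G" "branch_sets G B"
  shows "has_K33_minor G"
  using assms
proof (induction "card (pverts G) + card (parcs G)" arbitrary: G B rule: less_induct)
  case less
  note g = pair_graphD[OF less(2)] and b = branch_setsD[OF less(3)]
  interpret G: sym_rel "parcs G" using pair_graph_sym_rel[OF less(2)] .
  have step: ?case if "minor_step G H" "pair_graph H" "branch_sets H B'" "card (pverts H) + card (parcs H) < card (pverts G) + card (parcs G)" for H B'
    using less(1)[OF that(4,2,3)] has_K33_minor_step[OF that(1)] by blast
  consider v where "v \<in> pverts G" "\<forall>i<6. v \<notin> B i"
    | i x y where "i < 6" "x \<in> B i" "y \<in> B i" "x \<noteq> y"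
    | "pverts G \<subseteq> (\<Union>i<6. B i)" "\<forall>i<6. \<forall>x\<in>B i. \<forall>y\<in>B i. x = y" by blast
  then show ?case
  proof cases
    case 1
    let ?H = "delete_vertex G v"
    have pv: "pverts ?H = pverts G - {v}" and pa: "parcs ?H = {(x, y) \<in> parcs G. x \<noteq> v \<and> y \<noteq> v}"
      unfolding delete_vertex_def by simp_all
    have sub: "parcs ?H \<subseteq> parcs G" unfolding pa by blast
    have pg: "pair_graph ?H"
    proof (rule pair_graphI)
      show "sym (parcs ?H)" using g(4) unfolding pa by (auto simp: sym_def)
      show "irrefl (parcs ?H)" using g(5) sub by (auto simp: irrefl_def)
    qed (use g in \<open>auto simp: pv pa\<close>)
    interpret H: sym_rel "parcs ?H" using pair_graph_sym_rel[OF pg] .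
    have "H.conn (B i)" if "i < 6" for i
    proof -
      have "parcs ?H \<inter> B i \<times> B i = parcs G \<inter> B i \<times> B i" unfolding pa using 1 that by auto
      then show ?thesis using b(1)[OF that] unfolding H.conn_def G.conn_def by simp
    qed
    moreover have "H.adj (B i) (B j)" if ij: "i < 3" "3 \<le> j" "j < 6" for i j
    proof -
      have "i < 6" using ij by simp
      obtain p q where pq: "p \<in> B i" "q \<in> B j" "(p, q) \<in> parcs G" using b(5)[OF ij] unfolding G.adj_def by blast
      then have "p \<noteq> v" "q \<noteq> v" using 1(2) \<open>i < 6\<close> ij(3) by auto
      then have "(p, q) \<in> parcs ?H" unfolding pa using pq(3) by simp
      then show ?thesis unfolding H.adj_def using pq by (intro bexI)
    qed
    moreover have "B i \<subseteq> pverts ?H" if "i < 6" for i using b(3)[OF that] 1(2) that unfolding pv by blast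
    ultimately have br: "branch_sets ?H B" unfolding branch_sets_def using b(2,4) by simp
    have "card (pverts ?H) < card (pverts G)" unfolding pv using 1 g(1) by (meson card_Diff1_less)
    moreover have "card (parcs ?H) \<le> card (parcs G)" using sub g(2) by (rule card_mono[rotated])
    ultimately show ?thesis using step[OF minor_step.delete_vertex[OF 1(1)] pg br] by simp
  next
    case 2
    have "(x, y) \<in> (parcs G \<inter> B i \<times> B i)\<^sup>*" using b(1)[OF 2(1)] 2 unfolding G.conn_def by blast
    then obtain v where v: "(x, v) \<in> parcs G" "v \<in> B i" using 2(4) by (cases rule: converse_rtranclE) auto
    have xv: "x \<noteq> v" using v g(5) by (auto simp: irrefl_def)
    define f where "f = (id(v := x) :: 'a \<Rightarrow> 'a)"
    let ?H = "contract_edge G x v"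
    have pv: "pverts ?H = pverts G - {v}" and pa: "parcs ?H = {(f a, f b) | a b. (a, b) \<in> parcs G \<and> f a \<noteq> f b}"
      unfolding contract_edge_def Let_def f_def by simp_all
    have xG: "x \<in> pverts G" "v \<in> pverts G" using b(3)[OF 2(1)] 2 v by auto
    have fv: "f a \<in> pverts G - {v}" if "a \<in> pverts G" for a using that xG xv unfolding f_def by auto
    have pg: "pair_graph ?H"
    proof (rule pair_graphI)
      show "parcs ?H \<subseteq> pverts ?H \<times> pverts ?H" unfolding pa pv using g(3) fv by blast
      show "sym (parcs ?H)"
      proof (rule symI)
        fix p q assume "(p, q) \<in> parcs ?H"
        then obtain a c where "p = f a" "q = f c" "(a, c) \<in> parcs G" "f a \<noteq> f c" unfolding pa by blast
        moreover then have "(c, a) \<in> parcs G" using g(4) by (auto dest: symD)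
        ultimately show "(q, p) \<in> parcs ?H" unfolding pa by fastforce
      qed
      show "irrefl (parcs ?H)" unfolding pa by (auto simp: irrefl_def)
    qed (use g pv in auto)
    interpret H: sym_rel "parcs ?H" using pair_graph_sym_rel[OF pg] .
    define B' where "B' j = B j - {v}" for j
    have fB: "f a \<in> B' j" if "a \<in> B j" "j < 6" for a j
      using that b(4)[OF that(2) 2(1)] v 2 xv unfolding f_def B'_def by (cases "j = i") auto
    have "H.conn (B' j)" if j: "j < 6" for j
      unfolding H.conn_def
    proof (intro ballI)
      fix p q assume pq: "p \<in> B' j" "q \<in> B' j"
      then have "(p, q) \<in> (parcs G \<inter> B j \<times> B j)\<^sup>*" using b(1)[OF j] unfolding G.conn_def B'_def by blast
      then have "(f p, f q) \<in> (parcs ?H \<inter> B' j \<times> B' j)\<^sup>*"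
      proof (induction rule: rtrancl_induct)
        case (step y z)
        then have yz: "(y, z) \<in> parcs G" "f y \<in> B' j" "f z \<in> B' j" using fB j by auto
        show ?case
        proof (cases "f y = f z")
          case False
          then have "(f y, f z) \<in> parcs ?H \<inter> B' j \<times> B' j" unfolding pa using yz by blast
          then show ?thesis using step(3) by (meson rtrancl.rtrancl_into_rtrancl)
        qed (use step in simp)
      qed simp
      moreover have "f p = p" "f q = q" using pq unfolding f_def B'_def by auto
      ultimately show "(p, q) \<in> (parcs ?H \<inter> B' j \<times> B' j)\<^sup>*" by simp
    qed
    moreover have "H.adj (B' j) (B' k)" if jk: "j < 3" "3 \<le> k" "k < 6" for j k
    proof -
      have j6: "j < 6" "j \<noteq> k" using jk by auto
      obtain p q where pq: "p \<in> B j" "q \<in> B k" "(p, q) \<in> parcs G" using b(5)[OF jk] unfolding G.adj_def by blast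
      have m: "f p \<in> B' j" "f q \<in> B' k" using fB pq j6 jk by auto
      then have "f p \<noteq> f q" using b(4)[OF j6(1) jk(3) j6(2)] unfolding B'_def by auto
      then have "(f p, f q) \<in> parcs ?H" unfolding pa using pq by blast
      then show ?thesis unfolding H.adj_def using m by blast
    qed
    moreover have "B' j \<noteq> {}" if "j < 6" for j using fB[OF _ that] b(2)[OF that] by blast
    moreover have "B' j \<subseteq> pverts ?H" if "j < 6" for j using b(3)[OF that] unfolding B'_def pv by blast
    moreover have "B' j \<inter> B' k = {}" if "j < 6" "k < 6" "j \<noteq> k" for j k using b(4)[OF that] unfolding B'_def by blast
    ultimately have br: "branch_sets ?H B'" unfolding branch_sets_def by simp
    have "card (pverts ?H) < card (pverts G)" unfolding pv using xG g(1) by (meson card_Diff1_less)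
    moreover have "card (parcs ?H) \<le> card (parcs G)"
    proof -
      have "parcs ?H \<subseteq> map_prod f f ` parcs G" unfolding pa by force
      then have "card (parcs ?H) \<le> card (map_prod f f ` parcs G)" using g(2) by (intro card_mono) auto
      also have "\<dots> \<le> card (parcs G)" using g(2) by (rule card_image_le)
      finally show ?thesis .
    qed
    ultimately show ?thesis using step[OF minor_step.contract_edge[OF v(1)] pg br] by simp
  next
    case 3
    define c where "c i = (SOME x. x \<in> B i)" for i
    have Bc: "B i = {c i}" if "i < 6" for i
    proof -
      have "c i \<in> B i" unfolding c_def using b(2)[OF that] by (simp add: some_in_eq)
      then show ?thesis using 3(2) that by blast
    qed
    have ne: "c i \<noteq> c j" if "i < 6" "j < 6" "i \<noteq> j" for i j using b(4)[OF that] Bc that by auto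
    define U V where "U = c ` {0, 1, 2}" and "V = c ` {3, 4, 5}"
    have lt6: "i < 6 \<longleftrightarrow> i = 0 \<or> i = 1 \<or> i = 2 \<or> i = 3 \<or> i = 4 \<or> i = (5::nat)" for i by auto
    have inj: "inj_on c {..<6}" using ne by (meson inj_onI lessThan_iff)
    have cU: "card U = 3" unfolding U_def by (subst card_image[OF inj_on_subset[OF inj]]) auto
    have cV: "card V = 3" unfolding V_def by (subst card_image[OF inj_on_subset[OF inj]]) auto
    have UV: "U \<inter> V = {}" unfolding U_def V_def using ne by (auto simp: lt6)
    have pUV: "pverts G = U \<union> V"
    proof
      show "pverts G \<subseteq> U \<union> V"
      proof
        fix x assume "x \<in> pverts G"
        then obtain i where i: "i < 6" "x \<in> B i" using 3(1) by blast
        then have "x = c i" using Bc by auto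
        then show "x \<in> U \<union> V" using i(1) unfolding lt6 U_def V_def by auto
      qed
      have "c i \<in> pverts G" if "i < 6" for i using b(3)[OF that] Bc[OF that] by simp
      then show "U \<union> V \<subseteq> pverts G" unfolding U_def V_def by auto
    qed
    have e: "(c i, c j) \<in> parcs G" if "i < 3" "3 \<le> j" "j < 6" for i j
      using b(5)[OF that] Bc[of i] Bc[of j] that unfolding G.adj_def by auto
    have UVp: "U \<times> V \<subseteq> parcs G"
    proof
      fix p assume "p \<in> U \<times> V"
      then obtain i j where ij: "i \<in> {0, 1, 2}" "j \<in> {3, 4, 5}" "p = (c i, c j)" unfolding U_def V_def by blast
      have "i < 3" "3 \<le> j" "j < 6" using ij(1,2) by auto
      then show "p \<in> parcs G" using e ij(3) by simp
    qed
    then have VUp: "V \<times> U \<subseteq> parcs G" using g(4) by (auto dest: symD)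
    show ?thesis
    proof (cases "parcs G \<subseteq> U \<times> V \<union> V \<times> U")
      case True
      then have "parcs G = U \<times> V \<union> V \<times> U" using UVp VUp by (intro subset_antisym) simp_all
      then have "K\<^bsub>3,3\<^esub> (with_proj G)"
        unfolding complete_bipartite_digraph_pair_def using g(1) pUV UV cU cV by (intro conjI exI[of _ U] exI[of _ V])
      then show ?thesis unfolding has_K33_minor_def graph_minor_def by blast
    next
      case False
      then obtain x y where xy: "(x, y) \<in> parcs G" "(x, y) \<notin> U \<times> V \<union> V \<times> U" by auto
      let ?H = "delete_edge G x y"
      have pv: "pverts ?H = pverts G" and pa: "parcs ?H = parcs G - {(x, y), (y, x)}" unfolding delete_edge_def by simp_all
      have pg: "pair_graph ?H"
      proof (rule pair_graphI)
        show "sym (parcs ?H)" using g(4) unfolding pa by (auto simp: sym_def)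
        show "irrefl (parcs ?H)" using g(5) unfolding pa by (auto simp: irrefl_def)
      qed (use g in \<open>auto simp: pv pa\<close>)
      interpret H: sym_rel "parcs ?H" using pair_graph_sym_rel[OF pg] .
      have "H.conn (B i)" if "i < 6" for i unfolding Bc[OF that] by (rule H.conn_sing)
      moreover have "H.adj (B i) (B j)" if ij: "i < 3" "3 \<le> j" "j < 6" for i j
      proof -
        have "i \<in> {0, 1, 2}" "j \<in> {3, 4, 5}" using ij by auto
        then have "c i \<in> U" "c j \<in> V" unfolding U_def V_def by blast+
        then have "(c i, c j) \<in> parcs ?H" unfolding pa using e[OF ij] xy(2) by auto
        moreover have "i < 6" using ij by simp
        ultimately show ?thesis unfolding H.adj_def using Bc[of i] Bc[OF ij(3)] by auto
      qed
      ultimately have br: "branch_sets ?H B" unfolding branch_sets_def pv using b(2-4) by simp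
      have "card (parcs ?H) < card (parcs G)" unfolding pa using xy(1) g(2) by (intro psubset_card_mono) auto
      then show ?thesis using step[OF minor_step.delete_edge[OF xy(1)] pg br] pv by simp
    qed
  qed
qed

lemma K33_model_imp_minor:
  assumes pg: "pair_graph G" and m: "sym_rel.K33_model (parcs G)"
  shows "has_K33_minor G"
proof -
  interpret G: sym_rel "parcs G" using pair_graph_sym_rel[OF pg] .
  note g = pair_graphD[OF pg]
  obtain P H :: "nat \<Rightarrow> 'a set" where c: "\<forall>i<3. G.conn (P i) \<and> P i \<noteq> {} \<and> G.conn (H i) \<and> H i \<noteq> {}"
    and d: "\<forall>i<3. \<forall>j<3. i \<noteq> j \<longrightarrow> P i \<inter> P j = {} \<and> H i \<inter> H j = {}"
    and a: "\<forall>i<3. \<forall>j<3. P i \<inter> H j = {} \<and> G.adj (P i) (H j)"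
    using m unfolding G.K33_model_def by blast
  \<comment> \<open>\<open>K33_model\<close> does not mention the vertex set, but every vertex of a
    connected set with an edge leaving from it is an end of some arc.\<close>
  have sub: "A \<subseteq> pverts G" if A: "G.conn A" "G.adj A A'" for A A'
  proof
    fix x assume x: "x \<in> A"
    obtain y z where y: "y \<in> A" "(y, z) \<in> parcs G" using A(2) unfolding G.adj_def by blast
    have "(x, y) \<in> (parcs G \<inter> A \<times> A)\<^sup>*" using A(1) x y unfolding G.conn_def by blast
    then show "x \<in> pverts G" by (cases rule: converse_rtranclE) (use g(3) y in auto)
  qed
  define B where "B i = (if i < 3 then P i else H (i - 3))" for i
  have sP: "P i \<subseteq> pverts G" if "i < 3" for i using sub[of "P i" "H 0"] c a that by auto
  have sH: "H i \<subseteq> pverts G" if "i < 3" for i using sub[of "H i" "P 0"] c a that G.adj_sym by auto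
  have r: "i - 3 < 3" if "i < 6" for i :: nat using that by simp
  have "branch_sets G B"
    unfolding branch_sets_def
  proof (intro conjI allI impI)
    fix i :: nat assume "i < 6"
    then show "G.conn (B i)" "B i \<noteq> {}" "B i \<subseteq> pverts G" using c sP sH r[of i] unfolding B_def by auto
  next
    fix i j :: nat assume ij: "i < 6" "j < 6" "i \<noteq> j"
    show "B i \<inter> B j = {}"
    proof (cases "i < 3"; cases "j < 3")
      assume "i < 3" "j < 3" then show ?thesis using d ij unfolding B_def by simp
    next
      assume "i < 3" "\<not> j < 3" then show ?thesis using a ij r[of j] unfolding B_def by simp
    next
      assume "\<not> i < 3" "j < 3" moreover then have "P j \<inter> H (i - 3) = {}" using a ij r[of i] by simp
      ultimately show ?thesis unfolding B_def by auto
    next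
      assume "\<not> i < 3" "\<not> j < 3"
      then have "i - 3 \<noteq> j - 3" using ij by simp
      then show ?thesis using d r[of i] r[of j] ij \<open>\<not> i < 3\<close> \<open>\<not> j < 3\<close> unfolding B_def by simp
    qed
  next
    fix i j :: nat assume "i < 3" "3 \<le> j \<and> j < 6"
    then show "G.adj (B i) (B j)" using a r[of j] unfolding B_def by simp
  qed
  then show ?thesis using branch_sets_imp_minor[OF pg] by blast
qed

section \<open>Circuits as cyclic lists\<close>

lemma rtrancl_on_iff: "r \<subseteq> A \<times> A \<Longrightarrow> (u, v) \<in> rtrancl_on A r \<longleftrightarrow> u \<in> A \<and> (u, v) \<in> r\<^sup>*"
proof (intro iffI conjI)
  assume "(u, v) \<in> rtrancl_on A r"
  then show "u \<in> A" "(u, v) \<in> r\<^sup>*" using in_rtrancl_on_in_F rtrancl_on_rtranclI by metis+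
next
  assume r: "r \<subseteq> A \<times> A" and "u \<in> A \<and> (u, v) \<in> r\<^sup>*"
  then have "(u, v) \<in> r\<^sup>*" "u \<in> A" by auto
  then show "(u, v) \<in> rtrancl_on A r"
  proof (induction rule: rtrancl_induct)
    case base then show ?case by (rule rtrancl_on_refl)
  next
    case (step y z) then show ?case using r by (meson SigmaD2 rtrancl_on_into_rtrancl_on subsetD)
  qed
qed

lemma connected_iff:
  assumes "parcs (mk_symmetric H) \<subseteq> verts H \<times> verts H"
  shows "Digraph_Component.connected H \<longleftrightarrow> verts H \<noteq> {} \<and> (\<forall>u\<in>verts H. \<forall>v\<in>verts H. (u, v) \<in> (parcs (mk_symmetric H))\<^sup>*)"
  unfolding Digraph_Component.connected_def strongly_connected_def reachable_def
  using rtrancl_on_iff[OF assms] by simp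

lemma connected_induce_iff:
  assumes s: "sym (parcs G)"
  shows "Digraph_Component.connected (with_proj G \<restriction> A) \<longleftrightarrow> A \<noteq> {} \<and> sym_rel.conn (parcs G) A"
proof -
  interpret sym_rel "parcs G" by unfold_locales fact
  have e: "parcs (mk_symmetric (with_proj G \<restriction> A)) = parcs G \<inter> A \<times> A"
    unfolding parcs_mk_symmetric using s by (auto dest: symD)
  show ?thesis by (subst connected_iff) (auto simp: e conn_def)
qed

lemma connected_pair_iff:
  assumes "pair_graph D"
  shows "Digraph_Component.connected (with_proj D) \<longleftrightarrow> pverts D \<noteq> {} \<and> (\<forall>u\<in>pverts D. \<forall>v\<in>pverts D. (u, v) \<in> (parcs D)\<^sup>*)"
proof -
  note d = pair_graphD[OF assms]
  have e: "parcs (mk_symmetric (with_proj D)) = parcs D"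
    unfolding parcs_mk_symmetric using d(4) by (auto dest: symD)
  show ?thesis by (subst connected_iff) (use d(3) in \<open>auto simp: e\<close>)
qed

lemma out_degree_pair: "out_degree (with_proj D) x = card {y. (x, y) \<in> parcs D}"
proof -
  have "out_arcs (with_proj D) x = Pair x ` {y. (x, y) \<in> parcs D}" unfolding out_arcs_def by auto
  then show ?thesis unfolding out_degree_def by (simp add: card_image inj_on_def)
qed

lemma is_circuitD:
  assumes "is_circuit C G"
  shows "pair_graph C" "pverts C \<subseteq> pverts G" "parcs C \<subseteq> parcs G" "pverts C \<noteq> {}"
    "x \<in> pverts C \<Longrightarrow> y \<in> pverts C \<Longrightarrow> (x, y) \<in> (parcs C)\<^sup>*" "x \<in> pverts C \<Longrightarrow> card {y. (x, y) \<in> parcs C} = 2"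
proof -
  show pg: "pair_graph C" using assms unfolding is_circuit_def by blast
  show "pverts C \<subseteq> pverts G" "parcs C \<subseteq> parcs G" using assms unfolding is_circuit_def subgraph_def by simp_all
  show "pverts C \<noteq> {}" "x \<in> pverts C \<Longrightarrow> y \<in> pverts C \<Longrightarrow> (x, y) \<in> (parcs C)\<^sup>*"
    using assms unfolding is_circuit_def connected_pair_iff[OF pg] by blast+
  show "x \<in> pverts C \<Longrightarrow> card {y. (x, y) \<in> parcs C} = 2"
    using assms unfolding is_circuit_def out_degree_pair by blast
qed

text \<open>Double counting of arcs: two leave each vertex, and two belong to each edge.\<close>

lemma card_uedges_circuit:
  fixes D G :: "'a pair_pre_digraph"
  assumes "is_circuit D G"
  shows "card (uedges D) = card (pverts D)"
proof -
  note c = is_circuitD[OF assms]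
  note d = pair_graphD[OF c(1)]
  have "parcs D = Sigma (pverts D) (\<lambda>x. {y. (x, y) \<in> parcs D})" using d(3) by auto
  moreover have "finite {y. (x, y) \<in> parcs D}" for x
    by (rule finite_subset[OF _ d(1)]) (use d(3) in auto)
  ultimately have "card (parcs D) = (\<Sum>x\<in>pverts D. card {y. (x, y) \<in> parcs D})"
    using card_SigmaI[OF d(1)] by metis
  then have 1: "card (parcs D) = 2 * card (pverts D)" using c(6) by simp
  have "card (parcs D) = (\<Sum>p\<in>parcs D. 1)" by simp
  also have "\<dots> = (\<Sum>e\<in>uedges D. \<Sum>p\<in>{p \<in> parcs D. (case p of (u, v) \<Rightarrow> {u, v}) = e}. 1)"
    unfolding uedges_def by (rule sum.image_gen[OF d(2)])
  also have "\<dots> = (\<Sum>e\<in>uedges D. 2)"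
  proof (rule sum.cong)
    fix e assume "e \<in> uedges D"
    then obtain u v where uv: "(u, v) \<in> parcs D" "e = {u, v}" unfolding uedges_def by auto
    have vu: "(v, u) \<in> parcs D" using uv(1) d(4) by (auto dest: symD)
    have "u \<noteq> v" using uv(1) d(5) by (auto simp: irrefl_def)
    moreover have "{p \<in> parcs D. (case p of (u, v) \<Rightarrow> {u, v}) = e} = {(u, v), (v, u)}"
    proof (intro set_eqI)
      fix p :: "'a \<times> 'a"
      obtain a b where p: "p = (a, b)" by force
      show "p \<in> {p \<in> parcs D. (case p of (u, v) \<Rightarrow> {u, v}) = e} \<longleftrightarrow> p \<in> {(u, v), (v, u)}"
      proof
        assume "p \<in> {p \<in> parcs D. (case p of (u, v) \<Rightarrow> {u, v}) = e}"
        then have "{a, b} = {u, v}" unfolding p uv(2) by simp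
        then show "p \<in> {(u, v), (v, u)}" unfolding p by (metis doubleton_eq_iff insertCI)
      next
        assume "p \<in> {(u, v), (v, u)}"
        then consider "p = (u, v)" | "p = (v, u)" by blast
        then show "p \<in> {p \<in> parcs D. (case p of (u, v) \<Rightarrow> {u, v}) = e}"
          by cases (use uv vu in \<open>simp_all add: insert_commute\<close>)
      qed
    qed
    ultimately show "(\<Sum>p\<in>{p \<in> parcs D. (case p of (u, v) \<Rightarrow> {u, v}) = e}. 1) = 2" by simp
  qed simp
  finally show ?thesis using 1 by simp
qed

lemma circuit_of_list:
  assumes pg: "pair_graph G" and l: "3 \<le> length xs" and d: "distinct xs"
    and s: "successively (\<lambda>x y. (x, y) \<in> parcs G) xs" and c: "(last xs, hd xs) \<in> parcs G"
  shows "\<exists>D. is_circuit D G \<and> pverts D = set xs"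
proof -
  note g = pair_graphD[OF pg]
  define k where "k = length xs"
  define nx where "nx i = (if Suc i < k then Suc i else 0)" for i
  define pv where "pv i = (if i = 0 then k - 1 else i - 1)" for i
  have k: "3 \<le> k" using l k_def by simp
  have nxk: "nx i < k" "pv i < k" if "i < k" for i using that k unfolding nx_def pv_def by auto
  have np: "pv (nx i) = i" "nx (pv i) = i" if "i < k" for i using that k unfolding nx_def pv_def by auto
  \<comment> \<open>Length at least 3 keeps successor and predecessor apart, which gives degree
    2.\<close>
  have neq: "nx i \<noteq> pv i" "nx i \<noteq> i" if "i < k" for i using that k unfolding nx_def pv_def by (auto split: if_splits)
  have inj: "xs ! i = xs ! j \<longleftrightarrow> i = j" if "i < k" "j < k" for i j
    using d that nth_eq_iff_index_eq unfolding k_def by blast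
  have arc: "(xs ! i, xs ! nx i) \<in> parcs G" if "i < k" for i
  proof (cases "Suc i < k")
    case True
    then show ?thesis using successively_nth[OF s, of i] unfolding nx_def k_def by simp
  next
    case False
    then have "i = k - 1" using that by simp
    moreover have "xs \<noteq> []" using l by auto
    ultimately show ?thesis using c False unfolding nx_def k_def by (simp add: last_conv_nth hd_conv_nth)
  qed
  define E where "E = (\<lambda>i. (xs ! i, xs ! nx i)) ` {..<k}"
  define D where "D = \<lparr>pverts = set xs, parcs = E \<union> E\<inverse>\<rparr>"
  have D: "pverts D = set xs" "parcs D = E \<union> E\<inverse>" unfolding D_def by simp_all
  have Esub: "E \<subseteq> set xs \<times> set xs" unfolding E_def using nxk(1) unfolding k_def by auto
  have EG: "parcs D \<subseteq> parcs G"
  proof -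
    have "E \<subseteq> parcs G" unfolding E_def using arc by auto
    moreover then have "E\<inverse> \<subseteq> parcs G" using g(4) by (auto dest: symD)
    ultimately show ?thesis unfolding D by simp
  qed
  have pD: "pair_graph D"
  proof (rule pair_graphI)
    show "sym (parcs D)" unfolding D by (auto simp: sym_def)
    show "irrefl (parcs D)" using EG g(5) by (auto simp: irrefl_def)
  qed (use D Esub in auto)
  have nb: "{y. (xs ! i, y) \<in> parcs D} = {xs ! nx i, xs ! pv i}" if i: "i < k" for i
  proof -
    have "(xs ! i, y) \<in> E \<longleftrightarrow> y = xs ! nx i" for y
      unfolding E_def using inj i by auto
    moreover have "(y, xs ! i) \<in> E \<longleftrightarrow> y = xs ! pv i" for y
    proof
      assume "(y, xs ! i) \<in> E"
      then obtain j where j: "j < k" "y = xs ! j" "xs ! i = xs ! nx j" unfolding E_def by auto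
      then have "i = nx j" using inj[of i "nx j"] i nxk(1) by simp
      then show "y = xs ! pv i" using np(1)[OF j(1)] j(2) by simp
    next
      assume "y = xs ! pv i"
      then have "(y, xs ! i) = (\<lambda>i. (xs ! i, xs ! nx i)) (pv i)" using np(2)[OF i] by simp
      then show "(y, xs ! i) \<in> E" unfolding E_def using nxk(2)[OF i] by blast
    qed
    ultimately show ?thesis unfolding D by auto
  qed
  have reach: "(xs ! 0, xs ! i) \<in> (parcs D)\<^sup>*" if "i < k" for i
    using that
  proof (induction i)
    case (Suc i)
    then have "(xs ! i, xs ! Suc i) \<in> parcs D" using nb[of i] unfolding nx_def by auto
    then show ?case using Suc by (meson Suc_lessD rtrancl.rtrancl_into_rtrancl)
  qed simp
  have sD: "sym ((parcs D)\<^sup>*)" using pair_graphD(4)[OF pD] by (rule sym_rtrancl)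
  have "is_circuit D G"
    unfolding is_circuit_def
  proof (intro conjI ballI)
    show "pair_graph D" by (rule pD)
    have "wf_digraph (with_proj D)" "wf_digraph (with_proj G)"
      using pair_graphD(3)[OF pD] g(3) by (unfold_locales; auto)+
    moreover have "set xs \<subseteq> pverts G"
    proof
      fix x assume "x \<in> set xs"
      then obtain i where "i < k" "x = xs ! i" unfolding k_def by (metis in_set_conv_nth)
      then show "x \<in> pverts G" using arc[of i] g(3) by auto
    qed
    ultimately show "subgraph (with_proj D) (with_proj G)"
      unfolding subgraph_def compatible_def using EG D by simp
    have "(u, v) \<in> (parcs D)\<^sup>*" if uv: "u \<in> set xs" "v \<in> set xs" for u v
    proof -
      obtain i j where "i < k" "u = xs ! i" "j < k" "v = xs ! j" using uv unfolding k_def by (metis in_set_conv_nth)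
      then have "(xs ! 0, u) \<in> (parcs D)\<^sup>*" "(xs ! 0, v) \<in> (parcs D)\<^sup>*" using reach by auto
      then show ?thesis using sD by (meson rtrancl_trans symD)
    qed
    then show "Digraph_Component.connected (with_proj D)"
      unfolding connected_pair_iff[OF pD] D using l by auto
    fix x assume "x \<in> pverts D"
    then obtain i where i: "i < k" "x = xs ! i" unfolding k_def D by (metis in_set_conv_nth)
    have "xs ! nx i \<noteq> xs ! pv i" using inj nxk[OF i(1)] neq(1)[OF i(1)] by blast
    then show "out_degree (with_proj D) x = 2" unfolding out_degree_pair i(2) nb[OF i(1)] by simp
  qed
  then show ?thesis using D by blast
qed

text \<open>The list is a path of maximal length; its ends must be adjacent because inner vertices have no further neighbours.\<close>

lemma circuit_list:
  assumes C: "is_circuit C G"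
  obtains p where "distinct p" "3 \<le> length p" "set p = pverts C"
    "\<And>i. i < length p \<Longrightarrow> {y. (p ! i, y) \<in> parcs C} = {p ! ((i + 1) mod length p), p ! ((i + length p - 1) mod length p)}"
proof -
  note c = is_circuitD[OF C]
  note d = pair_graphD[OF c(1)]
  define Q where "Q p \<longleftrightarrow> p \<noteq> [] \<and> distinct p \<and> set p \<subseteq> pverts C \<and> successively (\<lambda>x y. (x, y) \<in> parcs C) p" for p
  obtain x0 where "x0 \<in> pverts C" using c(4) by blast
  then have "Q [x0]" unfolding Q_def by simp
  moreover have "length p \<le> card (pverts C)" if "Q p" for p
    using that d(1) unfolding Q_def by (metis card_mono distinct_card)
  ultimately obtain p where p: "Q p" and mx: "\<And>q. Q q \<Longrightarrow> length q \<le> length p"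
    using ex_has_greatest_nat[of Q "[x0]" length "Suc (card (pverts C))"] by (auto simp: less_Suc_eq_le)
  have pd: "p \<noteq> []" "distinct p" "set p \<subseteq> pverts C" "successively (\<lambda>x y. (x, y) \<in> parcs C) p" using p unfolding Q_def by auto
  define k where "k = length p"
  have k0: "0 < k" using pd k_def by simp
  have inj: "p ! i = p ! j \<longleftrightarrow> i = j" if "i < k" "j < k" for i j
    using pd(2) that nth_eq_iff_index_eq unfolding k_def by blast
  have pV: "p ! i \<in> pverts C" if "i < k" for i using that pd(3) unfolding k_def by auto
  have nb2: "card {y. (p ! i, y) \<in> parcs C} = 2" if "i < k" for i using c(6) pV that by blast
  have fnb: "finite {y. (x, y) \<in> parcs C}" for x by (rule finite_subset[OF _ d(1)]) (use d(3) in auto)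
  have symC: "(x, y) \<in> parcs C \<Longrightarrow> (y, x) \<in> parcs C" for x y using d(4) by (auto dest: symD)
  have arc: "(p ! i, p ! Suc i) \<in> parcs C" if "Suc i < k" for i using successively_nth[OF pd(4)] that unfolding k_def by blast
  have nbl: "y \<in> set p" if y: "(p ! (k - 1), y) \<in> parcs C" for y
  proof (rule ccontr)
    assume ny: "y \<notin> set p"
    have "Q (p @ [y])" unfolding Q_def
      using pd ny y d(3) k0 unfolding k_def by (auto simp: successively_append_iff last_conv_nth)
    then show False using mx by fastforce
  qed
  have two: "{y. (p ! i, y) \<in> parcs C} = {a, b}" if "i < k" "(p ! i, a) \<in> parcs C" "(p ! i, b) \<in> parcs C" "a \<noteq> b" for i a b
    using card_subset_eq[OF fnb, of "{a, b}" "p ! i"] nb2[OF that(1)] that by simp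
  have irr: "(x, x) \<notin> parcs C" for x using d(5) by (auto simp: irrefl_def)
  obtain y1 y2 where y12: "{y. (p ! (k - 1), y) \<in> parcs C} = {y1, y2}" "y1 \<noteq> y2" using nb2[of "k - 1"] k0 by (auto simp: card_2_iff)
  have "p ! (k - 1) \<notin> {y1, y2}" using irr[of "p ! (k - 1)"] unfolding y12(1)[symmetric] by simp
  then have "card {y1, y2, p ! (k - 1)} = 3" using y12(2) by (auto simp: card_insert_if)
  moreover have "{y1, y2, p ! (k - 1)} \<subseteq> set p" using y12 nbl k0 unfolding k_def by auto
  ultimately have k3: "3 \<le> k" unfolding k_def by (metis List.finite_set card_mono distinct_card pd(2))
  have mid: "{y. (p ! i, y) \<in> parcs C} = {p ! (i + 1), p ! (i - 1)}" if i: "0 < i" "i < k - 1" for i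
  proof (rule two)
    show "(p ! i, p ! (i + 1)) \<in> parcs C" using arc[of i] i by simp
    show "(p ! i, p ! (i - 1)) \<in> parcs C" using symC arc[of "i - 1"] i by simp
    show "p ! (i + 1) \<noteq> p ! (i - 1)" using inj i by simp
  qed (use i in simp)
  have prev: "(p ! (k - 1), p ! (k - 2)) \<in> parcs C"
    using symC arc[of "k - 2"] k3 by (simp add: numeral_2_eq_2 Suc_diff_Suc)
  obtain j where j: "j < k" "j \<noteq> k - 2" "(p ! (k - 1), p ! j) \<in> parcs C"
  proof -
    obtain y where "(p ! (k - 1), y) \<in> parcs C" "y \<noteq> p ! (k - 2)" using y12 by blast
    then show ?thesis using nbl that unfolding k_def by (metis in_set_conv_nth)
  qed
  have "j \<noteq> k - 1" using j(3) irr by metis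
  have "j = 0"
  proof (rule ccontr)
    assume "j \<noteq> 0"
    then have "0 < j" "j < k - 1" using j(1) \<open>j \<noteq> k - 1\<close> by linarith+
    then have "p ! (k - 1) \<in> {p ! (j + 1), p ! (j - 1)}" using symC[OF j(3)] unfolding mid[symmetric, OF \<open>0 < j\<close> \<open>j < k - 1\<close>] by simp
    then have "p ! (k - 1) = p ! (j + 1) \<or> p ! (k - 1) = p ! (j - 1)" by blast
    then show False using inj[of "k - 1" "j + 1"] inj[of "k - 1" "j - 1"] j \<open>j \<noteq> k - 1\<close> \<open>j \<noteq> 0\<close> by auto
  qed
  then have l0: "(p ! (k - 1), p ! 0) \<in> parcs C" using j by simp
  have nb: "{y. (p ! i, y) \<in> parcs C} = {p ! ((i + 1) mod k), p ! ((i + k - 1) mod k)}" if i: "i < k" for i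
  proof -
    consider "i = 0" | "0 < i" "i < k - 1" | "i = k - 1" using i by linarith
    then show ?thesis
    proof cases
      case 1
      then show ?thesis using two[of 0 "p ! 1" "p ! (k - 1)"] arc[of 0] symC[OF l0] inj[of 1 "k - 1"] k3 by simp
    next
      case 2
      then have "(i + k - 1) mod k = i - 1" by (simp add: mod_if)
      then show ?thesis using mid[OF 2] 2 by simp
    next
      case 3
      then have e: "(i + 1) mod k = 0" "(i + k - 1) mod k = k - 2" using k3 by (auto simp: mod_if)
      have "p ! 0 \<noteq> p ! (k - 2)" using inj[of 0 "k - 2"] k3 by simp
      then show ?thesis unfolding e using two[OF i, of "p ! 0" "p ! (k - 2)"] l0 prev 3 by simp
    qed
  qed
  have cl: "y \<in> set p" if "x \<in> set p" "(x, y) \<in> parcs C" for x y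
  proof -
    obtain i where "i < k" "x = p ! i" using \<open>x \<in> set p\<close> unfolding k_def by (metis in_set_conv_nth)
    then have "y \<in> {p ! ((i + 1) mod k), p ! ((i + k - 1) mod k)}" using nb[of i] that(2) by blast
    then show ?thesis using k0 unfolding k_def by auto
  qed
  have "set p = pverts C"
  proof
    show "pverts C \<subseteq> set p"
    proof
      fix y assume y: "y \<in> pverts C"
      have "(p ! 0, y) \<in> (parcs C)\<^sup>*" using c(5) pV k0 y by blast
      then show "y \<in> set p"
      proof (induction rule: rtrancl_induct)
        case base then show ?case using k0 k_def by simp
      next
        case (step y z) then show ?case using cl by blast
      qed
    qed
  qed (rule pd(3))
  then show ?thesis using that[OF pd(2)] k3 nb unfolding k_def by blast
qed

section \<open>Colouring the bridges, and paths inside them\<close>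

context sym_rel begin

text \<open>
  The colour of a bridge is the parity of the walks in the overlap relation that lead to it from the representative
  of its component; it is well defined because closed walks are even.
\<close>

lemma two_colouring:
  assumes sys: "bridge_system N bag \<S>" and nK: "\<not> K33_model"
  shows "\<exists>sd. \<forall>S\<in>\<S>. \<forall>T\<in>\<S>. S \<noteq> T \<and> sd S = (sd T :: bool) \<longrightarrow> non_overlapping N (snd S) (snd T)"
proof -
  define E where "E = {(S, T). S \<in> \<S> \<and> T \<in> \<S> \<and> crosses N S T}"
  have per: "periodic N (snd S)" if "S \<in> \<S>" for S
    using sys that bridge_periodic unfolding bridge_system_def by blast
  have symE: "sym E" unfolding E_def sym_def crosses_def using non_overlapping_sym per by blast
  have symP: "(T, S) \<in> E ^^ k" if "(S, T) \<in> E ^^ k" for S T k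
    using that
  proof (induction k arbitrary: T)
    case (Suc k)
    then obtain M where "(S, M) \<in> E ^^ k" "(M, T) \<in> E" by auto
    then have "(M, S) \<in> E ^^ k" "(T, M) \<in> E" using Suc.IH symE by (auto dest: symD)
    then show ?case by (rule relpow_Suc_I2[rotated])
  qed simp
  have even_closed: "even k" if k: "(S, S) \<in> E ^^ k" for S k
  proof (rule ccontr)
    assume odd: "odd k"
    then have k0: "0 < k" by (simp add: odd_pos)
    obtain f where f: "f 0 = S" "f k = S" "\<And>i. i < k \<Longrightarrow> (f i, f (Suc i)) \<in> E"
      using k unfolding relpow_fun_conv by auto
    define xs where "xs = map f [0..<k]"
    have "hd xs = f k" unfolding xs_def using k0 f by (simp add: hd_map)
    then have e: "xs @ [hd xs] = map f [0..<Suc k]" unfolding xs_def by simp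
    have "successively (crosses N) (map f [0..<Suc k])"
      unfolding successively_conv_nth using f(3) unfolding E_def by (auto simp del: upt_Suc)
    then have "closed_walk N xs" unfolding closed_walk_def e using k0 by (simp add: xs_def)
    moreover have "set xs \<subseteq> \<S>" unfolding xs_def using f(3) unfolding E_def by auto
    then have "bridge_system N bag (set xs)" using sys unfolding bridge_system_def by blast
    moreover have "odd (length xs)" using odd unfolding xs_def by simp
    ultimately show False using K33_odd_walk nK by blast
  qed
  define root where "root S = (SOME r. (r, S) \<in> E\<^sup>*)" for S
  define sd where "sd S \<longleftrightarrow> (\<exists>k. even k \<and> (root S, S) \<in> E ^^ k)" for S
  have rt: "\<exists>k. (root S, S) \<in> E ^^ k" for S
  proof -
    have "(root S, S) \<in> E\<^sup>*" unfolding root_def by (rule someI[of _ S]) simp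
    then show ?thesis using rtrancl_imp_relpow by metis
  qed
  have "non_overlapping N (snd S) (snd T)" if S: "S \<in> \<S>" and T: "T \<in> \<S>" and ne: "S \<noteq> T" and eq: "sd S = sd T" for S T
  proof (rule ccontr)
    assume "\<not> ?thesis"
    then have ST: "(S, T) \<in> E" "(T, S) \<in> E" using S T ne symE unfolding E_def crosses_def by (auto dest: symD)
    \<comment> \<open>Crossing bridges are reached from the same elements, so the choice operator
      picks the same representative for both.\<close>
    have "(\<lambda>r. (r, S) \<in> E\<^sup>*) = (\<lambda>r. (r, T) \<in> E\<^sup>*)" using ST by (auto intro: rtrancl_into_rtrancl)
    then have r: "root S = root T" unfolding root_def by simp
    have par: "even (k + l + 1)" if "(root S, S) \<in> E ^^ k" "(root T, T) \<in> E ^^ l" for k l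
    proof -
      have "(root S, T) \<in> E ^^ Suc k" using that(1) ST(1) by (rule relpow_Suc_I)
      moreover have "(T, root S) \<in> E ^^ l" using symP[OF that(2)] r by simp
      ultimately have "(root S, root S) \<in> E ^^ (Suc k + l)" unfolding relpow_add by blast
      then show ?thesis using even_closed by fastforce
    qed
    show False
    proof (cases "sd S")
      case True
      then obtain k l where "even k" "(root S, S) \<in> E ^^ k" "even l" "(root T, T) \<in> E ^^ l" using eq unfolding sd_def by blast
      then show False using par by fastforce
    next
      case False
      obtain k l where kl: "(root S, S) \<in> E ^^ k" "(root T, T) \<in> E ^^ l" using rt by metis
      then have "odd k" "odd l" using False eq unfolding sd_def by auto
      then show False using par[OF kl] by simp
    qed
  qed
  then show ?thesis by blast
qed

definition path :: "'a \<Rightarrow> 'a list \<Rightarrow> 'a \<Rightarrow> bool" where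
  "path x p y \<longleftrightarrow> p \<noteq> [] \<and> distinct p \<and> successively (\<lambda>x y. (x, y) \<in> R) p \<and> hd p = x \<and> last p = y"

lemma path_append:
  assumes "path x p y" "path y' q z" "(y, y') \<in> R" "set p \<inter> set q = {}"
  shows "path x (p @ q) z"
  using assms unfolding path_def by (simp add: successively_append_iff)

lemma path_in_conn:
  assumes "conn K" "x \<in> K" "y \<in> K"
  obtains p where "path x p y" "set p \<subseteq> K"
proof -
  have "(x, y) \<in> (R \<inter> K \<times> K)\<^sup>*" using assms unfolding conn_def by blast
  then have "\<exists>p. path x p y \<and> set p \<subseteq> K"
  proof (induction rule: rtrancl_induct)
    case base
    show ?case by (rule exI[of _ "[x]"]) (use assms in \<open>simp add: path_def\<close>)
  next
    case (step y z)
    then obtain p where p: "path x p y" "set p \<subseteq> K" by blast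
    show ?case
    proof (cases "z \<in> set p")
      case True
      \<comment> \<open>A vertex met again cuts the path short instead of extending it.\<close>
      then obtain a b where ab: "p = a @ z # b" using split_list by metis
      have "path x (a @ [z]) z"
        using p(1) successively_split(1)[of "\<lambda>x y. (x, y) \<in> R" a z b] unfolding path_def ab by (cases a) auto
      then show ?thesis using p(2) unfolding ab by (intro exI[of _ "a @ [z]"]) auto
    next
      case False
      have "path z [z] z" unfolding path_def by simp
      then have "path x (p @ [z]) z" using path_append[OF p(1)] False step by auto
      then show ?thesis using p(2) step by (intro exI[of _ "p @ [z]"]) auto
    qed
  qed
  then show ?thesis using that by blast
qed

end

section \<open>Exchanges along a longest circuit\<close>

text \<open>The circuit is unrolled to a sequence \<open>v\<close> of period \<open>n\<close>, and
  maximality becomes a bound on closed vertex lists. \<open>W\<close> will be the components off the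
  circuit.\<close>

locale long_cycle = sym_rel R for R :: "'a rel" +
  fixes n :: int and v :: "int \<Rightarrow> 'a" and W :: "'a set set"
  assumes n3: "3 \<le> n"
    and v_eq: "v i = v j \<longleftrightarrow> i mod n = j mod n"
    and v_adj: "(v i, v (i + 1)) \<in> R"
    and longest: "path x p y \<Longrightarrow> (y, x) \<in> R \<Longrightarrow> 3 \<le> length p \<Longrightarrow> int (length p) \<le> n"
    and W_conn: "K \<in> W \<Longrightarrow> conn K"
    and W_disj: "K \<in> W \<Longrightarrow> L \<in> W \<Longrightarrow> K \<noteq> L \<Longrightarrow> K \<inter> L = {}"
    and W_off: "K \<in> W \<Longrightarrow> v i \<notin> K"
begin

definition P :: "'a set \<Rightarrow> int \<Rightarrow> bool" where "P K i \<longleftrightarrow> adj K {v i}"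

lemma v_inj: "inj_on v {w..<w + n}"
proof (rule inj_onI)
  fix i j assume ij: "i \<in> {w..<w + n}" "j \<in> {w..<w + n}" "v i = v j"
  then have "n dvd i - j" using v_eq by (simp add: mod_eq_dvd_iff)
  moreover have "\<bar>i - j\<bar> < n" using ij by auto
  ultimately show "i = j" using zdvd_imp_le[of n "\<bar>i - j\<bar>"] by force
qed

lemma v_per: "v (i + n) = v i" using v_eq by simp

lemma P_per: "P K (i + n) \<longleftrightarrow> P K i" unfolding P_def v_per ..

definition segment :: "int list \<Rightarrow> bool" where
  "segment l \<longleftrightarrow> l \<noteq> [] \<and> successively (\<lambda>i j. j = i + 1 \<or> j = i - 1) l"

text \<open>
  A route runs through segments of the circuit, each left through the bridge next to it, and finally reaches \<open>z\<close>.
\<close>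

fun route :: "(int list \<times> 'a set) list \<Rightarrow> int \<Rightarrow> bool" where
  "route [] z \<longleftrightarrow> False"
| "route [(l, K)] z \<longleftrightarrow> segment l \<and> P K (last l) \<and> P K z"
| "route ((l, K) # (l', K') # r) z \<longleftrightarrow> segment l \<and> P K (last l) \<and> P K (hd l') \<and> route ((l', K') # r) z"

lemma segment_path:
  assumes "segment l" "distinct l" "set l \<subseteq> {w..<w + n}"
  shows "path (v (hd l)) (map v l) (v (last l))"
proof -
  have "(v i, v j) \<in> R" if "j = i + 1 \<or> j = i - 1" for i j
    using that v_adj[of i] v_adj[of j] sym_R by (auto dest: symD)
  then have "successively (\<lambda>x y. (x, y) \<in> R) (map v l)"
    using assms(1) unfolding segment_def successively_map by (auto elim: successively_mono)
  moreover have "distinct (map v l)" using assms(2) inj_on_subset[OF v_inj assms(3)] by (simp add: distinct_map)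
  ultimately show ?thesis using assms(1) unfolding path_def segment_def by (simp add: hd_map last_map)
qed

lemma hop:
  assumes "K \<in> W" "P K i" "P K j"
  obtains q x y where "path x q y" "set q \<subseteq> K" "(v i, x) \<in> R" "(y, v j) \<in> R"
proof -
  obtain x where x: "x \<in> K" "(v i, x) \<in> R" using assms(2) sym_R unfolding P_def adj_def by (auto dest: symD)
  obtain y where y: "y \<in> K" "(y, v j) \<in> R" using assms(3) unfolding P_def adj_def by auto
  obtain q where "path x q y" "set q \<subseteq> K" using path_in_conn[OF W_conn[OF assms(1)] x(1) y(1)] .
  then show ?thesis using that x y by blast
qed

text \<open>Each bridge contributes at least one vertex, whence the summand \<open>length r\<close>.
  Distinct bridges and disjoint segments make the pieces fit into one path.\<close>

lemma route_path:
  assumes "route r z" "distinct (concat (map fst r))" "set (concat (map fst r)) \<subseteq> {w..<w + n}"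
    "distinct (map snd r)" "set (map snd r) \<subseteq> W"
  shows "\<exists>p y. path (v (hd (fst (hd r)))) p y \<and> (y, v z) \<in> R \<and>
     set p \<subseteq> v ` set (concat (map fst r)) \<union> \<Union>(set (map snd r)) \<and> length (concat (map fst r)) + length r \<le> length p"
  using assms
proof (induction r z rule: route.induct)
  case (2 l K z)
  have s: "path (v (hd l)) (map v l) (v (last l))" using segment_path[of l w] 2 by simp
  have K: "K \<in> W" "P K (last l)" "P K z" using 2 by simp_all
  obtain q x y where q: "path x q y" "set q \<subseteq> K" "(v (last l), x) \<in> R" "(y, v z) \<in> R"
    by (rule hop[OF K])
  have d: "set (map v l) \<inter> set q = {}" using W_off[OF K(1)] q(2) by auto
  have "length q \<ge> 1" using q(1) unfolding path_def by (cases q) auto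
  then show ?case using path_append[OF s q(1,3) d] q(2,4)
    by (intro exI[of _ "map v l @ q"] exI[of _ y]) auto
next
  case (3 l K l' K' r z)
  have s: "path (v (hd l)) (map v l) (v (last l))" using segment_path[of l w] 3(2-4) by simp
  have KW: "K \<in> W" and Kh: "P K (last l)" "P K (hd l')" using 3 by simp_all
  obtain q x y where q: "path x q y" "set q \<subseteq> K" "(v (last l), x) \<in> R" "(y, v (hd l')) \<in> R"
    by (rule hop[OF KW Kh])
  obtain p y' where p: "path (v (hd l')) p y'" "(y', v z) \<in> R"
    "set p \<subseteq> v ` set (concat (map fst ((l', K') # r))) \<union> \<Union>(set (map snd ((l', K') # r)))"
    "length (concat (map fst ((l', K') # r))) + length ((l', K') # r) \<le> length p"
    using 3(1) 3(2-6) by auto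
  have d1: "set (map v l) \<inter> set q = {}" using W_off[OF KW] q(2) by auto
  have sq: "path (v (hd l)) (map v l @ q) y" by (rule path_append[OF s q(1,3) d1])
  let ?I = "set (concat (map fst ((l', K') # r)))" and ?U = "\<Union>(set (map snd ((l', K') # r)))"
  have UW: "L \<in> W" if "L \<in> set (map snd ((l', K') # r))" for L using 3(6) that by auto
  have lI: "set l \<inter> ?I = {}" "set l \<subseteq> {w..<w + n}" "?I \<subseteq> {w..<w + n}" using 3(3,4) by auto
  have "v ` set l \<inter> v ` ?I = {}"
    using lI inj_on_image_Int[OF v_inj, of "set l" w ?I] by simp
  moreover have "v ` set l \<inter> ?U = {}" using W_off UW by blast
  moreover have "K \<inter> v ` ?I = {}" using W_off[OF KW] by blast
  moreover have "K \<inter> ?U = {}"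
  proof -
    have "K \<notin> set (map snd ((l', K') # r))" using 3(5) by simp
    then show ?thesis using W_disj[OF KW UW] by blast
  qed
  ultimately have XY: "(v ` set l \<union> K) \<inter> (v ` ?I \<union> ?U) = {}" by (simp only: Int_Un_distrib Int_Un_distrib2 Un_empty)
  have "set (map v l @ q) \<subseteq> v ` set l \<union> K" using q(2) by auto
  from Int_mono[OF this p(3)] have "set (map v l @ q) \<inter> set p = {}" unfolding XY by simp
  then have "path (v (hd l)) ((map v l @ q) @ p) y'" using path_append[OF sq p(1) q(4)] by blast
  moreover have "length q \<ge> 1" using q(1) unfolding path_def by (cases q) auto
  moreover have "set ((map v l @ q) @ p) \<subseteq> v ` set (concat (map fst ((l, K) # (l', K') # r))) \<union> \<Union>(set (map snd ((l, K) # (l', K') # r)))"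
    using p(3) q(2) by auto
  ultimately show ?case using p(2,4) by (intro exI[of _ "(map v l @ q) @ p"] exI[of _ y']) auto
qed simp

text \<open>A closed route must leave out at least as many vertices of the circuit as it visits
  bridges; each exchange below violates or evaluates this.\<close>

lemma route_bound:
  assumes "route r (hd (fst (hd r)))" "distinct (concat (map fst r))" "set (concat (map fst r)) \<subseteq> {w..<w + n}"
    "distinct (map snd r)" "set (map snd r) \<subseteq> W"
  shows "int (length (concat (map fst r)) + length r) \<le> n"
proof -
  obtain p y where p: "path (v (hd (fst (hd r)))) p y" "(y, v (hd (fst (hd r)))) \<in> R"
     "length (concat (map fst r)) + length r \<le> length p" using route_path[OF assms] by blast
  show ?thesis
  proof (cases "3 \<le> length p")
    case True then show ?thesis using longest[OF p(1,2)] p(3) by linarith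
  next
    case False then show ?thesis using p(3) n3 by linarith
  qed
qed

section \<open>Explicit routes for the five exchanges\<close>

lemma segment_upto: "i \<le> j \<Longrightarrow> segment [i..j]" "i \<le> j \<Longrightarrow> segment (rev [i..j])"
proof -
  have s: "successively (\<lambda>i j. j = i + 1) [i..j]"
    unfolding successively_conv_nth by auto
  assume ij: "i \<le> j"
  show "segment [i..j]" unfolding segment_def using s ij by (auto elim: successively_mono)
  show "segment (rev [i..j])" unfolding segment_def successively_rev using s ij by (auto elim: successively_mono)
qed

lemma upto_ends: "i \<le> j \<Longrightarrow> hd [i..j] = i" "i \<le> j \<Longrightarrow> last [i..j] = j"
  by (simp add: upto_rec1, simp add: upto_rec2)

lemmas route_simps = segment_upto upto_ends hd_rev last_rev P_per

text \<open>The route keeps every vertex of the circuit and replaces one edge by a visit to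
  \<open>K\<close>.\<close>

lemma move0: assumes "K \<in> W" "P K i" shows "\<not> P K (i + 1)"
proof
  assume "P K (i + 1)"
  then have "int (length (concat (map fst [([i + 1..i + n], K)])) + length [([i + 1..i + n], K)]) \<le> n"
    by (intro route_bound[of _ "i + 1"]) (use assms n3 in \<open>auto simp: route_simps\<close>)
  then show False using n3 by simp
qed

text \<open>The segment from \<open>v1\<close> to \<open>u2\<close> is run backwards. Two bridges
  are gained, and only the vertices strictly between \<open>u1\<close>, \<open>v1\<close> and
  between \<open>u2\<close>, \<open>v2\<close> are lost.\<close>

lemma move2:
  assumes "K \<in> W" "L \<in> W" "K \<noteq> L" "u1 < v1" "v1 \<le> u2" "u2 < v2" "v2 \<le> u1 + n" "P K u1" "P K u2" "P L v1" "P L v2"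
  shows "4 \<le> (v1 - u1) + (v2 - u2)"
proof -
  have "int (length (concat (map fst [([v2..u1 + n], K), (rev [v1..u2], L)])) + length [([v2..u1 + n], K), (rev [v1..u2], L)]) \<le> n"
    by (rule route_bound[of _ v1]) (use assms in \<open>auto simp: route_simps\<close>)
  then show ?thesis using assms by simp
qed

text \<open>The kept segments are taken in the order \<open>[v3..u1 + n]\<close>,
  \<open>[v2..u3]\<close>, \<open>[v1..u2]\<close>, the last one backwards.\<close>

lemma move3:
  assumes "K \<in> W" "L \<in> W" "M \<in> W" "K \<noteq> L" "K \<noteq> M" "L \<noteq> M" "u1 < v1" "v1 \<le> u2" "u2 < v2" "v2 \<le> u3" "u3 < v3"
    "v3 \<le> u1 + n" "P K u1" "P K v2" "P L v1" "P L v3" "P M u2" "P M u3"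
  shows "6 \<le> (v1 - u1) + (v2 - u2) + (v3 - u3)"
proof -
  let ?r = "[([v3..u1 + n], K), ([v2..u3], M), (rev [v1..u2], L)]"
  have "int (length (concat (map fst ?r)) + length ?r) \<le> n"
    by (rule route_bound[of _ v1]) (use assms in \<open>auto simp: route_simps\<close>)
  then show ?thesis using assms by simp
qed

text \<open>Four bridges are visited while only \<open>y + 1\<close> and \<open>y + 2\<close> are
  left out. The pairs \<open>p\<close>, \<open>p + 1\<close> and \<open>p + 2\<close>,
  \<open>p + 3\<close> are run backwards.\<close>

lemma move4l:
  assumes "K \<in> W" "L \<in> W" "L' \<in> W" "M \<in> W" "distinct [K, L, L', M]" "P M (p - 1)" "P M (p + 1)" "P K p" "P K (p + 4)"
    "P L (p + 2)" "P L' (p + 3)" "P L' y" "P L (y + 3)" "p + 4 \<le> y" "y + 4 \<le> p + n"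
  shows False
proof -
  let ?r = "[([y + 3..p - 1 + n], M), (rev [p..p + 1], K), ([p + 4..y], L'), (rev [p + 2..p + 3], L)]"
  have "int (length (concat (map fst ?r)) + length ?r) \<le> n"
  proof (rule route_bound[of _ p])
    show "route ?r (hd (fst (hd ?r)))" using assms(6-15) by (simp add: route_simps)
    show "distinct (concat (map fst ?r))" using assms(14,15) by auto
    show "set (concat (map fst ?r)) \<subseteq> {p..<p + n}" using assms(14,15) by auto
  qed (use assms(1-5) in auto)
  then show ?thesis using assms by simp
qed

text \<open>The mirror image of \<open>move4l\<close>.\<close>

lemma move4r:
  assumes "K \<in> W" "L \<in> W" "L' \<in> W" "M \<in> W" "distinct [K, L, L', M]" "P M (p + 3)" "P M (p + 5)" "P K p" "P K (p + 4)"
    "P L (p + 1)" "P L' (p + 2)" "P L' y" "P L (y + 3)" "p + 5 \<le> y" "y + 3 \<le> p + n"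
  shows False
proof -
  let ?r = "[([y + 3..p + n], K), (rev [p + 3..p + 4], M), ([p + 5..y], L'), (rev [p + 1..p + 2], L)]"
  have "int (length (concat (map fst ?r)) + length ?r) \<le> n"
  proof (rule route_bound[of _ "p + 1"])
    show "route ?r (hd (fst (hd ?r)))" using assms(6-15) by (simp add: route_simps)
    show "distinct (concat (map fst ?r))" using assms(14,15) by auto
    show "set (concat (map fst ?r)) \<subseteq> {p + 1..<p + 1 + n}" using assms(14,15) by auto
  qed (use assms(1-5) in auto)
  then show ?thesis using assms by simp
qed

end

section \<open>From overlap to the discharging assumptions\<close>

lemma non_overlapping_noncrossing:
  assumes A: "periodic N A" "big N A" and B: "periodic N B" "big N B" and n: "non_overlapping N A B"
    and ab: "a \<in> A" "b \<in> A" "\<forall>i. a < i \<and> i < b \<longrightarrow> i \<notin> A"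
    and x: "x \<in> B" "a < x" "x < b" and y: "y \<in> B" "a \<le> y" "y < a + N"
  shows "y \<le> b"
proof -
  obtain c' c where c: "gap A c' c" "\<And>i. c < i \<Longrightarrow> i < c' + N \<Longrightarrow> i \<notin> B" using non_overlapping_gap[OF A B(2) n] by blast
  obtain k where k: "c' \<le> x + k * N" "x + k * N < c' + N" using shift_window[OF periodicD(3)[OF A(1)]] .
  have xB: "x + k * N \<in> B" using x periodic_mult[OF B(1)] by blast
  have "x \<notin> A" using ab(3) x by blast
  then have xA: "x + k * N \<notin> A" using periodic_mult[OF A(1)] by blast
  have cA: "c' \<in> A" "c \<in> A" using c(1) unfolding gap_def by auto
  have "\<not> c < x + k * N" using c(2) xB k(2) by blast
  moreover have "x + k * N \<noteq> c" "x + k * N \<noteq> c'" using xA cA by auto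
  ultimately have xc: "c' < x + k * N" "x + k * N < c" using k(1) by linarith+
  have "gap A a b" using ab x unfolding gap_def by auto
  then have g: "gap A (a + k * N) (b + k * N)" using gap_shift[OF A(1)] by blast
  have e: "c' = a + k * N" "c = b + k * N" using gap_unique[OF c(1) g xc] x by auto
  have "y + k * N \<in> B" using y periodic_mult[OF B(1)] by blast
  then have "\<not> c < y + k * N" using c(2) y(3) e by auto
  then show ?thesis using e by simp
qed

text \<open>An element of \<open>B\<close> strictly between the cuts is off \<open>A\<close>; this
  supplies \<open>nsub\<close>.\<close>

lemma non_overlapping_not_subset:
  assumes "big N B" "non_overlapping N A B"
  shows "\<exists>x\<in>B. x \<notin> A"
proof -
  obtain p q where pq: "p \<le> q" "q \<le> p + N" "\<forall>i. p < i \<and> i < q \<longrightarrow> i \<notin> A" "\<forall>i. q < i \<and> i < p + N \<longrightarrow> i \<notin> B"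
    using assms(2) unfolding non_overlapping_def by blast
  show ?thesis using non_overlapping_inside[OF assms(1) pq(1,2,4)] pq(3) by metis
qed

lemma big_of_card:
  assumes p: "periodic N X" and c: "3 \<le> card {i \<in> {0..<N}. i \<in> X}"
  shows "big N X"
proof -
  obtain T where T: "T \<subseteq> {i \<in> {0..<N}. i \<in> X}" "card T = 3" using c by (meson obtain_subset_with_card_n)
  then obtain x y z where xyz: "T = {x, y, z}" "x \<noteq> y" "x \<noteq> z" "y \<noteq> z" by (auto simp: card_3_iff)
  have m: "x \<in> X" "y \<in> X" "z \<in> X" "0 \<le> x" "x < N" "0 \<le> y" "y < N" "0 \<le> z" "z < N" using T(1) xyz(1) by auto
  consider "x < y" "y < z" | "x < z" "z < y" | "y < x" "x < z" | "y < z" "z < x" | "z < x" "x < y" | "z < y" "y < x"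
    using xyz by linarith
  then show ?thesis
  proof cases
    case 1 show ?thesis by (rule bigI[OF p m(1,2,3)]) (use 1 m in linarith)+
  next
    case 2 show ?thesis by (rule bigI[OF p m(1,3,2)]) (use 2 m in linarith)+
  next
    case 3 show ?thesis by (rule bigI[OF p m(2,1,3)]) (use 3 m in linarith)+
  next
    case 4 show ?thesis by (rule bigI[OF p m(2,3,1)]) (use 4 m in linarith)+
  next
    case 5 show ?thesis by (rule bigI[OF p m(3,1,2)]) (use 5 m in linarith)+
  next
    case 6 show ?thesis by (rule bigI[OF p m(3,2,1)]) (use 6 m in linarith)+
  qed
qed

context long_cycle begin

lemma ring_v: "ring n (\<lambda>i. {v i})"
proof -
  have "v i \<noteq> v j" if "i < j" "j < i + n" for i j
    using inj_onD[OF v_inj[of i], of i j] that n3 by auto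
  moreover have "adj {v i} {v j}" if "i < j" "\<forall>k. i < k \<and> k < j \<longrightarrow> {v k} = {}" for i j
  proof -
    have "j = i + 1" using that(1) that(2)[rule_format, of "i + 1"] by force
    then show ?thesis unfolding adj_def using v_adj by simp
  qed
  ultimately show ?thesis unfolding ring_def using n3 conn_sing v_per by auto
qed

lemma K33_of_long_cycle:
  assumes fin: "finite W" and cov: "\<And>i. \<exists>K\<in>W. P K i"
    and card3: "\<And>K. K \<in> W \<Longrightarrow> 3 \<le> card {i \<in> {0..<n}. P K i}"
  shows K33_model
proof (rule ccontr)
  assume nK: "\<not> K33_model"
  define X where "X K = {i. P K i}" for K
  have per: "periodic n (X K)" for K unfolding periodic_def X_def using n3 P_per by auto
  have bg: "big n (X K)" if "K \<in> W" for K
    using big_of_card[OF per] card3[OF that] unfolding X_def by simp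
  have br: "bridge n (\<lambda>i. {v i}) (K, X K)" if "K \<in> W" for K
    unfolding bridge_def using W_conn[OF that] W_off[OF that] P_per unfolding X_def P_def by simp
  have "bridge_system n (\<lambda>i. {v i}) ((\<lambda>K. (K, X K)) ` W)"
    unfolding bridge_system_def using ring_v br bg W_disj by auto
  from two_colouring[OF this nK]
  obtain sd where sd: "\<forall>S\<in>(\<lambda>K. (K, X K)) ` W. \<forall>T\<in>(\<lambda>K. (K, X K)) ` W. S \<noteq> T \<and> sd S = (sd T :: bool) \<longrightarrow> non_overlapping n (snd S) (snd T)"
    by (elim exE)
  define side where "side K = sd (K, X K)" for K
  have nv: "non_overlapping n (X K) (X L)" if "K \<in> W" "L \<in> W" "K \<noteq> L" "side K = side L" for K L
    using sd that unfolding side_def by auto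
  interpret cycle_bridges n W P side
  proof unfold_locales
    show "0 < n" using n3 by simp
    show "finite W" by (rule fin)
    show "P K (i + n) \<longleftrightarrow> P K i" for K i by (rule P_per)
    show "\<exists>K\<in>W. P K i" for i by (rule cov)
    show "3 \<le> card {i \<in> {0..<n}. P K i}" if "K \<in> W" for K by (rule card3[OF that])
    show "y \<le> b" if h: "K \<in> W" "L \<in> W" "K \<noteq> L" "side K = side L" "P K a" "P K b" "\<forall>i. a < i \<and> i < b \<longrightarrow> \<not> P K i"
      "P L x" "a < x" "x < b" "P L y" "a \<le> y" "y < a + n" for K L a b x y
      using non_overlapping_noncrossing[OF per bg[OF h(1)] per bg[OF h(2)] nv[OF h(1-4)], of a b x y] h unfolding X_def by simp
    show "\<exists>x. P L x \<and> \<not> P K x" if h: "K \<in> W" "L \<in> W" "K \<noteq> L" "side K = side L" for K L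
      using non_overlapping_not_subset[OF bg[OF h(2)] nv[OF h]] unfolding X_def by auto
    show "\<not> P K (i + 1)" if "K \<in> W" "P K i" for K i by (rule move0[OF that])
  qed (rule move2 move3 move4l move4r; assumption)+
  show False by (rule contradiction)
qed

end

section \<open>Components off a chordless longest circuit\<close>

theorem theorem2:
  fixes G :: "'a pair_pre_digraph"
  assumes "pair_graph G"
    and "three_connected G"
    and "\<not> has_K33_minor G"
  shows "\<forall>C. longest_circuit C G \<longrightarrow> (\<exists>e. is_chord e C G)"
proof (intro allI impI, rule ccontr)
  fix C assume lc: "longest_circuit C G" and nochord: "\<not> (\<exists>e. is_chord e C G)"
  interpret G: sym_rel "parcs G" using pair_graph_sym_rel[OF assms(1)] .
  note g = pair_graphD[OF assms(1)]
  have symG: "(y, x) \<in> parcs G" if "(x, y) \<in> parcs G" for x y using that g(4) by (auto dest: symD)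
  have circ: "is_circuit C G" and mx: "\<And>D. is_circuit D G \<Longrightarrow> card (uedges D) \<le> card (uedges C)"
    using lc unfolding longest_circuit_def by blast+
  note c = is_circuitD[OF circ]
  have symC: "(y, x) \<in> parcs C" if "(x, y) \<in> parcs C" for x y using that pair_graphD(4)[OF c(1)] by (auto dest: symD)
  obtain p where p: "distinct p" "3 \<le> length p" "set p = pverts C"
    and nb: "\<And>i. i < length p \<Longrightarrow> {y. (p ! i, y) \<in> parcs C} = {p ! ((i + 1) mod length p), p ! ((i + length p - 1) mod length p)}"
    using circuit_list[OF circ] by blast
  define k n where "k = length p" and "n = int k"
  define v where "v i = p ! nat (i mod n)" for i
  have k3: "3 \<le> k" and n3: "3 \<le> n" using p(2) unfolding k_def n_def by simp_all
  have nk: "nat (i mod n) < k" for i using n3 unfolding n_def by (simp add: nat_less_iff)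
  have v_eq: "v i = v j \<longleftrightarrow> i mod n = j mod n" for i j
    unfolding v_def using p(1) nk n3 nth_eq_iff_index_eq[OF p(1)] unfolding k_def[symmetric] by (simp add: eq_nat_nat_iff)
  have vC: "v i \<in> pverts C" for i unfolding v_def using nk[of i] p(3) unfolding k_def by (metis nth_mem)
  have vsurj: "\<exists>i\<in>{0..<n}. x = v i" if xC: "x \<in> pverts C" for x
  proof -
    obtain i where i: "i < k" "x = p ! i" using xC p(3) unfolding k_def by (metis in_set_conv_nth)
    then have "x = v (int i)" unfolding v_def n_def by simp
    then show ?thesis using i(1) unfolding n_def by (intro bexI[of _ "int i"]) auto
  qed
  have nbv: "{y. (v i, y) \<in> parcs C} = {v (i + 1), v (i - 1)}" for i
  proof -
    define m where "m = nat (i mod n)"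
    have m: "m < k" "int m = i mod n" using nk[of i] n3 unfolding m_def by simp_all
    have "(i + 1) mod n = (int m + 1) mod n" unfolding m(2) by (simp add: mod_add_left_eq)
    also have "\<dots> = int ((m + 1) mod k)" unfolding n_def by (simp add: zmod_int add.commute)
    finally have 1: "nat ((i + 1) mod n) = (m + 1) mod k" by simp
    have "(i - 1) mod n = (int m - 1) mod n" unfolding m(2) by (simp add: mod_diff_left_eq)
    also have "\<dots> = (int m - 1 + n) mod n" by simp
    also have "int m - 1 + n = int (m + k - 1)" unfolding n_def using k3 by simp
    also have "\<dots> mod n = int ((m + k - 1) mod k)" unfolding n_def by (simp add: zmod_int)
    finally have 2: "nat ((i - 1) mod n) = (m + k - 1) mod k" by simp
    show ?thesis using nb[of m] m(1) unfolding v_def 1 2 m_def[symmetric] k_def by simp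
  qed
  define Vo where "Vo = pverts G - pverts C"
  define comp where "comp x = {y. (x, y) \<in> (parcs G \<inter> Vo \<times> Vo)\<^sup>*}" for x
  define W where "W = comp ` Vo"
  have compVo: "comp x \<subseteq> Vo" if "x \<in> Vo" for x
  proof
    fix y assume "y \<in> comp x"
    then have "(x, y) \<in> (parcs G \<inter> Vo \<times> Vo)\<^sup>*" unfolding comp_def by simp
    then show "y \<in> Vo" by (cases rule: rtranclE) (use that in auto)
  qed
  have symVo: "sym ((parcs G \<inter> Vo \<times> Vo)\<^sup>*)" by (rule G.sym_restrict)
  have comp_eq: "comp x = comp y" if "y \<in> comp x" for x y
    unfolding comp_def using that symVo unfolding comp_def by (auto intro: rtrancl_trans dest: symD)
  have compI: "z \<in> comp x" if "y \<in> comp x" "(y, z) \<in> parcs G" "y \<in> Vo" "z \<in> Vo" for x y z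
    using that unfolding comp_def by (auto intro: rtrancl_into_rtrancl)
  have compx: "x \<in> comp x" for x unfolding comp_def by simp
  have W_conn: "G.conn (comp x)" for x
  proof (rule G.connI_centre[of _ x])
    fix y assume "y \<in> comp x"
    then have "(x, y) \<in> (parcs G \<inter> Vo \<times> Vo)\<^sup>*" unfolding comp_def by simp
    then show "(x, y) \<in> (parcs G \<inter> comp x \<times> comp x)\<^sup>*"
    proof (induction rule: rtrancl_induct)
      case (step y z)
      have "y \<in> comp x" using step(1) unfolding comp_def by simp
      moreover have "z \<in> comp x" using compI[OF \<open>y \<in> comp x\<close>] step(2) by blast
      ultimately have "(y, z) \<in> parcs G \<inter> comp x \<times> comp x" using step(2) by blast
      then show ?case using step(3) by (rule rtrancl_into_rtrancl[rotated])
    qed simp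
  qed
  have three: "G.conn (pverts G - S)" if "S \<subseteq> pverts G" "card S \<le> 2" for S
    using assms(2) that unfolding three_connected_def connected_induce_iff[OF g(4)] by blast
  interpret long_cycle "parcs G" n v W
  proof unfold_locales
    show "3 \<le> n" by (rule n3)
    show "v i = v j \<longleftrightarrow> i mod n = j mod n" for i j by (rule v_eq)
    show "(v i, v (i + 1)) \<in> parcs G" for i using nbv[of i] c(3) by blast
    show "int (length q) \<le> n" if q: "G.path x q y" "(y, x) \<in> parcs G" "3 \<le> length q" for x q y
    proof -
      have q': "distinct q" "successively (\<lambda>x y. (x, y) \<in> parcs G) q" "hd q = x" "last q = y"
        using q(1) unfolding G.path_def by auto
      obtain D where D: "is_circuit D G" "pverts D = set q"
        using circuit_of_list[OF assms(1) q(3) q'(1,2)] q(2) q'(3,4) by blast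
      have "card (uedges D) = length q" using card_uedges_circuit[OF D(1)] D(2) distinct_card[OF q'(1)] by simp
      moreover have "card (uedges C) = k"
        using card_uedges_circuit[OF circ] p(3) distinct_card[OF p(1)] unfolding k_def by simp
      ultimately show ?thesis using mx[OF D(1)] unfolding n_def by simp
    qed
    show "G.conn K" if "K \<in> W" for K using that W_conn unfolding W_def by blast
    show "K \<inter> L = {}" if "K \<in> W" "L \<in> W" "K \<noteq> L" for K L
      using that comp_eq unfolding W_def by (metis (no_types, lifting) disjoint_iff imageE)
    show "v i \<notin> K" if "K \<in> W" for K i using that compVo vC unfolding W_def Vo_def by blast
  qed
  have "finite W" unfolding W_def Vo_def using g(1) by simp
  moreover have "\<exists>K\<in>W. P K i" for i
  proof -
    \<comment> \<open>Deleting the two neighbours of \<open>v i\<close> on the circuit leaves the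
      graph connected, so \<open>v i\<close> has a further neighbour \<open>y\<close>. As there is
      no chord, \<open>y\<close> lies off the circuit, and its component has a foot at
      \<open>i\<close>.\<close>
    define S where "S = {v (i + 1), v (i - 1)}"
    have S: "S \<subseteq> pverts G" "card S \<le> 2" unfolding S_def using vC c(2) by (auto simp: card_insert_if)
    have fS: "finite S" unfolding S_def by simp
    have "v i \<noteq> v (i + 1)" "v i \<noteq> v (i - 1)"
      using inj_onD[OF v_inj[of i], of i "i + 1"] inj_onD[OF v_inj[of "i - 1"], of i "i - 1"] n3 by auto
    then have vi: "v i \<in> pverts G - S" unfolding S_def using vC c(2) by auto
    have "2 \<le> card (pverts G - S)"
      using assms(2) S(2) card_Diff_subset[OF fS S(1)] unfolding three_connected_def by linarith
    then have "\<not> pverts G - S \<subseteq> {v i}" by (metis card_mono card.empty card_insert_if empty_iff finite.emptyI finite.insertI One_nat_def not_less_eq_eq numeral_2_eq_2 order.trans)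
    then obtain z where z: "z \<in> pverts G - S" "z \<noteq> v i" by blast
    have "(v i, z) \<in> (parcs G \<inter> (pverts G - S) \<times> (pverts G - S))\<^sup>*"
      using three[OF S] vi z(1) unfolding G.conn_def by blast
    then obtain y where y: "(v i, y) \<in> parcs G" "y \<in> pverts G - S"
      using z(2) by (cases rule: converse_rtranclE) auto
    have "y \<notin> pverts C"
    proof
      assume yC: "y \<in> pverts C"
      have "{v i, y} \<in> uedges G" using y(1) unfolding uedges_def by force
      moreover have "{v i, y} \<subseteq> pverts C" using yC vC by simp
      ultimately have "{v i, y} \<in> uedges C" using nochord unfolding is_chord_def by blast
      then obtain a b where ab: "(a, b) \<in> parcs C" "{v i, y} = {a, b}" unfolding uedges_def by auto
      then have "(v i, y) \<in> parcs C" using symC by (auto simp: doubleton_eq_iff)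
      then have "y \<in> S" using nbv[of i] unfolding S_def by blast
      then show False using y(2) by blast
    qed
    then have yVo: "y \<in> Vo" using y(2) unfolding Vo_def by blast
    have "P (comp y) i" unfolding P_def G.adj_def using compx symG[OF y(1)] by blast
    then show ?thesis using yVo unfolding W_def by blast
  qed
  moreover have "3 \<le> card {i \<in> {0..<n}. P K i}" if "K \<in> W" for K
  proof (rule ccontr)
    assume less: "\<not> ?thesis"
    obtain x where x: "x \<in> Vo" "K = comp x" using \<open>K \<in> W\<close> unfolding W_def by blast
    \<comment> \<open>With at most two feet, deleting them would separate \<open>K\<close> from a
      vertex \<open>v j\<close> of the circuit that is not a foot.\<close>
    define I where "I = {i \<in> {0..<n}. P K i}"
    have fI: "finite I" unfolding I_def by (rule finite_subset[of _ "{0..<n}"]) auto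
    have cI: "card I \<le> 2" using less unfolding I_def by simp
    have S: "v ` I \<subseteq> pverts G" "card (v ` I) \<le> 2" using vC c(2) card_image_le[OF fI, of v] cI by auto
    have "\<not> {0..<n} \<subseteq> I"
    proof
      assume "{0..<n} \<subseteq> I"
      then have "card {0..<n} \<le> card I" using fI by (rule card_mono[rotated])
      then show False using cI n3 by simp
    qed
    then obtain j where j: "j \<in> {0..<n}" "j \<notin> I" by blast
    have vj: "v j \<notin> v ` I"
    proof
      assume "v j \<in> v ` I"
      then obtain i where "i \<in> I" "v j = v i" by blast
      then have "j = i" using inj_onD[OF v_inj[of 0], of j i] j(1) unfolding I_def by auto
      then show False using j(2) \<open>i \<in> I\<close> by blast
    qed
    let ?A = "pverts G - v ` I"
    have "x \<in> ?A" using x(1) vC unfolding Vo_def by blast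
    moreover have "v j \<in> ?A" using vj vC c(2) by blast
    ultimately have "(x, v j) \<in> (parcs G \<inter> ?A \<times> ?A)\<^sup>*" using three[OF S] unfolding G.conn_def by blast
    then have "v j \<in> K"
    proof (induction rule: rtrancl_induct)
      case base then show ?case using x compx by simp
    next
      case (step y z)
      have yVo: "y \<in> Vo" using compVo[OF x(1)] step(3) x(2) by blast
      show ?case
      proof (cases "z \<in> Vo")
        case True then show ?thesis using compI[of y x z] step yVo x(2) by blast
      next
        case False
        then have "z \<in> pverts C" using step(2) unfolding Vo_def by blast
        then obtain i where i: "i \<in> {0..<n}" "z = v i" using vsurj by blast
        then have "P K i" unfolding P_def G.adj_def using step(2,3) by blast
        then show ?thesis using i step(2) unfolding I_def by blast
      qed
    qed
    then show False using W_off[OF \<open>K \<in> W\<close>] by blast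
  qed
  ultimately have G.K33_model by (rule K33_of_long_cycle)
  then show False using K33_model_imp_minor[OF assms(1)] assms(3) by blast
qed

end
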